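(* Let $A_1,\ldots,A_n \in \mathbb{R}^{d \times d}$ be symmetric. There is a partial fractional coloring $x \in [-1,1]^n$ such that at least $c n$ indices $i$ have $|x_i| = 1$ (for a universal constant $c>0$) and \[ \Big\|\sum_{i \leq n} x_i A_i\Big\| \leq \Big\| \sum_{i \leq n} A_i^2 \Big\|^{1/2} \cdot O\Bigg(\sqrt{ 1 + \log \frac{\operatorname{Tr} \sum_{i \leq n} A_i^2}{\sqrt{n}\, \big\|\sum_{i \leq n} A_i^2\big\|} }\Bigg), \] where the implicit constant is universal. Furthermore, there is a randomized polynomial-time algorithm which finds such a coloring with high probability.
   Context: $\|\cdot\|$ denotes the spectral norm of a matrix and $\operatorname{Tr}$ the trace.
   Formalization: The logarithm is replaced by max(0, log), since its argument can be below 1/e (e.g. d = 1, A_i = 1, n = 16), where the square root is undefined; polynomial time counts exact arithmetic operations and comparisons on real numbers, polynomial in n + d. *)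

theory Defs
  imports
    "HOL-Probability.Probability_Mass_Function"
    "HOL-Computational_Algebra.Polynomial"
    "Jordan_Normal_Form.Matrix"
begin

text \<open>
  The dimension \<open>d\<close> is an input of the algorithm below, so it is a number and not a type:
  matrices and vectors are those of Jordan_Normal_Form. A family of \<open>n\<close> matrices is a function
  on \<open>nat\<close> of which only the values at \<open>i < n\<close> matter.
\<close>

definition symmetric_family :: "nat \<Rightarrow> nat \<Rightarrow> (nat \<Rightarrow> real Matrix.mat) \<Rightarrow> bool" where
  "symmetric_family n d A \<longleftrightarrow> (\<forall>i<n. A i \<in> carrier_mat d d \<and> transpose_mat (A i) = A i)"

definition mat_sum :: "nat \<Rightarrow> nat \<Rightarrow> (nat \<Rightarrow> real Matrix.mat) \<Rightarrow> real Matrix.mat" where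
  "mat_sum n d F = Matrix.mat d d (\<lambda>jk. \<Sum>i<n. F i $$ jk)"

definition mat_trace :: "real Matrix.mat \<Rightarrow> real" where
  "mat_trace M = (\<Sum>j<dim_row M. M $$ (j, j))"

definition l2_norm :: "real Matrix.vec \<Rightarrow> real" where
  "l2_norm v = sqrt (scalar_prod v v)"

definition spectral_norm :: "real Matrix.mat \<Rightarrow> real" where
  "spectral_norm M = Sup {l2_norm (M *\<^sub>v v) |v. v \<in> carrier_vec (dim_col M) \<and> l2_norm v \<le> 1}"

text \<open>
  The logarithm is truncated at 0. The ratio inside it can be as small as \<open>1 / sqrt n\<close>, and
  without truncation \<open>1 + ln (...)\<close> can be zero or negative, where no such bound can hold.
  For ratios at least 1 the truncation changes nothing.
\<close>

definition discrepancy_bound :: "nat \<Rightarrow> nat \<Rightarrow> (nat \<Rightarrow> real Matrix.mat) \<Rightarrow> real" where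
  "discrepancy_bound n d A =
    (let S = mat_sum n d (\<lambda>i. A i * A i)
     in sqrt (spectral_norm S) *
        sqrt (1 + max 0 (ln (mat_trace S / (sqrt (real n) * spectral_norm S)))))"

definition good_partial_coloring ::
  "real \<Rightarrow> real \<Rightarrow> nat \<Rightarrow> nat \<Rightarrow> (nat \<Rightarrow> real Matrix.mat) \<Rightarrow> real Matrix.vec \<Rightarrow> bool" where
  "good_partial_coloring c C n d A x \<longleftrightarrow>
     x \<in> carrier_vec n \<and>
     (\<forall>i<n. vec_index x i \<in> {-1..1}) \<and>
     real (card {i. i < n \<and> \<bar>vec_index x i\<bar> = 1}) \<ge> c * real n \<and>
     spectral_norm (mat_sum n d (\<lambda>i. vec_index x i \<cdot>\<^sub>m A i)) \<le> C * discrepancy_bound n d A"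

section \<open>Randomized algorithms on real inputs\<close>

text \<open>
  The inputs are arbitrary real matrices, so algorithms are programs of a real random access
  machine (Blum-Shub-Smale arithmetic: exact \<open>+\<close>, \<open>-\<close>, \<open>*\<close>, \<open>/\<close> and comparisons of reals at
  unit cost, division by 0 giving 0, with no rounding, square roots or non-rational constants)
  that can toss fair coins.
  One fixed program handles all \<open>n\<close> and \<open>d\<close>.

  Memory consists of named arrays of naturals and of reals, addressed by tuples of naturals;
  scalars are arrays with the empty index. Naturals serve as indices and counters and have only
  addition and truncated subtraction, so that in \<open>t\<close> steps they reach at most \<open>O(t)\<close> bits.
  There is no conversion from reals to naturals. An expression is evaluated in one step; the
  number of operations this involves is bounded by the size of the program.
\<close>

datatype nexp =
    NConst nat
  | NGet string "nexp list"
  | NAdd nexp nexp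
  | NSub nexp nexp

datatype rexp =
    RNat nexp
  | RGet string "nexp list"
  | RAdd rexp rexp
  | RSub rexp rexp
  | RMul rexp rexp
  | RDiv rexp rexp

datatype bexp =
    NLess nexp nexp
  | RLess rexp rexp
  | Not bexp
  | And bexp bexp

datatype com =
    Skip
  | NAssign string "nexp list" nexp
  | RAssign string "nexp list" rexp
  | Flip string "nexp list"
  | Seq com com
  | If bexp com com
  | While bexp com

type_synonym store = "(string \<Rightarrow> nat list \<Rightarrow> nat) \<times> (string \<Rightarrow> nat list \<Rightarrow> real)"

fun nval :: "nexp \<Rightarrow> store \<Rightarrow> nat" where
  "nval (NConst m) s = m"
| "nval (NGet a is) s = fst s a (map (\<lambda>e. nval e s) is)"
| "nval (NAdd e f) s = nval e s + nval f s"
| "nval (NSub e f) s = nval e s - nval f s"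

fun rval :: "rexp \<Rightarrow> store \<Rightarrow> real" where
  "rval (RNat e) s = real (nval e s)"
| "rval (RGet a is) s = snd s a (map (\<lambda>e. nval e s) is)"
| "rval (RAdd e f) s = rval e s + rval f s"
| "rval (RSub e f) s = rval e s - rval f s"
| "rval (RMul e f) s = rval e s * rval f s"
| "rval (RDiv e f) s = rval e s / rval f s"

fun bval :: "bexp \<Rightarrow> store \<Rightarrow> bool" where
  "bval (NLess e f) s = (nval e s < nval f s)"
| "bval (RLess e f) s = (rval e s < rval f s)"
| "bval (Not b) s = (\<not> bval b s)"
| "bval (And b b') s = (bval b s \<and> bval b' s)"

definition nstore :: "string \<Rightarrow> nat list \<Rightarrow> nat \<Rightarrow> store \<Rightarrow> store" where
  "nstore a is m s = ((fst s)(a := (fst s a)(is := m)), snd s)"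

definition rstore :: "string \<Rightarrow> nat list \<Rightarrow> real \<Rightarrow> store \<Rightarrow> store" where
  "rstore a is r s = (fst s, (snd s)(a := (snd s a)(is := r)))"

fun step :: "com \<Rightarrow> store \<Rightarrow> (com \<times> store) pmf" where
  "step Skip s = return_pmf (Skip, s)"
| "step (NAssign a is e) s =
     return_pmf (Skip, nstore a (map (\<lambda>i. nval i s) is) (nval e s) s)"
| "step (RAssign a is e) s =
     return_pmf (Skip, rstore a (map (\<lambda>i. nval i s) is) (rval e s) s)"
| "step (Flip a is) s =
     map_pmf (\<lambda>m. (Skip, nstore a (map (\<lambda>i. nval i s) is) m s)) (pmf_of_set {0, 1})"
| "step (Seq p q) s =
     (if p = Skip then return_pmf (q, s) else map_pmf (\<lambda>(p', s'). (Seq p' q, s')) (step p s))"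
| "step (If b p q) s = return_pmf (if bval b s then p else q, s)"
| "step (While b p) s = return_pmf (if bval b s then Seq p (While b p) else Skip, s)"

fun run :: "nat \<Rightarrow> com \<Rightarrow> store \<Rightarrow> (com \<times> store) pmf" where
  "run 0 p s = return_pmf (p, s)"
| "run (Suc t) p s = bind_pmf (step p s) (\<lambda>(p', s'). run t p' s')"

definition input_store :: "nat \<Rightarrow> nat \<Rightarrow> (nat \<Rightarrow> real Matrix.mat) \<Rightarrow> store" where
  "input_store n d A =
    ((\<lambda>a is. if a = ''n'' \<and> is = [] then n else if a = ''d'' \<and> is = [] then d else 0),
     (\<lambda>a is. case is of
         [i, j, k] \<Rightarrow> if a = ''A'' \<and> i < n \<and> j < d \<and> k < d then A i $$ (j, k) else 0
       | _ \<Rightarrow> 0))"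

definition output_vec :: "nat \<Rightarrow> store \<Rightarrow> real Matrix.vec" where
  "output_vec n s = Matrix.vec n (\<lambda>i. snd s ''x'' [i])"

text \<open>The running time is bounded for every outcome of the coin tosses.\<close>

definition polynomial_time :: "com \<Rightarrow> bool" where
  "polynomial_time P \<longleftrightarrow>
    (\<exists>q :: nat poly. \<forall>n d A. symmetric_family n d A \<longrightarrow>
       (\<forall>(p, s) \<in> set_pmf (run (poly q (n + d)) P (input_store n d A)). p = Skip))"

text \<open>
  A halted program stays put, so any \<open>t\<close> from the halting time on gives the same probability
  that the program has halted with an output satisfying \<open>Q\<close>; before, it can only be smaller.
\<close>

definition success_prob ::
  "com \<Rightarrow> nat \<Rightarrow> nat \<Rightarrow> (nat \<Rightarrow> real Matrix.mat) \<Rightarrow> (real Matrix.vec \<Rightarrow> bool) \<Rightarrow> real" where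
  "success_prob P n d A Q =
    (SUP t. measure_pmf.prob (run t P (input_store n d A)) {(p, s). p = Skip \<and> Q (output_vec n s)})"

end

theory Submission
  imports Defs "HOL-Analysis.Analysis" "Jordan_Normal_Form.Determinant" "Jordan_Normal_Form.Spectral_Radius"
begin

text \<open>
  The coloring is found by a deterministic walk in the cube, so every success probability is 1.
  Let \<open>M = \<Sum> x\<^sub>i A\<^sub>i\<close>, let \<open>\<sigma>\<close> be \<open>\<parallel>\<Sum> A\<^sub>i\<^sup>2\<parallel>\<close> up to a constant factor, let \<open>T\<close> be the trace of \<open>\<Sum> A\<^sub>i\<^sup>2\<close>, and
  let \<open>q \<ge> 1\<close> be minimal with \<open>T \<le> \<surd>n \<sigma> 2^q\<close>. With \<open>s = |x|\<^sup>2 / n\<close> and suitable \<open>B\<^sub>p\<close>, the potential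
  \<open>\<Psi>(x) = \<Sum> (1 + Tr M^(2p) / B\<^sub>p) / (1 + s)^p\<close>, summed over \<open>p \<in> {q, d}\<close>, is 2 at the origin and is kept
  from increasing. The term \<open>p = q\<close> leaves at most \<open>\<surd>n / 4\<close> eigenvalues of \<open>M\<close> with \<open>\<lambda>\<^sup>2\<close> above a
  multiple of \<open>q \<sigma>\<close>, and the term \<open>p = d\<close> bounds the norm of \<open>M\<close>.

  As long as more than half of the coordinates are strictly inside the cube, some direction \<open>v\<close>
  on them is orthogonal to \<open>x\<close> and decreases \<open>\<Psi>\<close> to second order: impose the at most \<open>n / 16\<close>
  linear conditions that the block of \<open>\<Sum> v\<^sub>i A\<^sub>i\<close> on the eigenvectors of \<open>M\<close> with large eigenvalues
  vanishes, and average the Hessian over an orthonormal basis of the remaining space. Without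
  that block one factor of each mixed term \<open>\<lambda>^a \<mu>^b\<close> is small, so the Hessian of \<open>Tr M^(2d)\<close> grows
  like \<open>d\<close> instead of \<open>d\<^sup>2\<close>. The walk needs no eigenvectors: Gram-Schmidt orthogonalisation with
  respect to the indefinite Hessian exposes such a direction by rational operations. Steps have
  length at least \<open>1 / poly(n, d)\<close> unless they hit a face of the cube, and each increases \<open>|x|\<^sup>2\<close>,
  which bounds their number.
\<close>

section \<open>Orthonormal families and the spectral theorem\<close>

text \<open>The square root of \<open>n\<close> inside the logarithm comes from counting:
  annihilating the block of a direction on \<open>k\<close> eigenvectors costs \<open>k^2\<close>
  linear conditions, and only a fixed fraction of \<open>n\<close> conditions can be afforded, so
  about \<open>sqrt n\<close> eigenvalues may be large. Neither exponent suffices alone. With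
  \<open>p = q\<close> only, a squared eigenvalue may still exceed \<open>q \<sigma>\<close> by a
  factor of order \<open>n^(1/(2q))\<close>. With \<open>p = d\<close> only, the Hessian grows like
  \<open>d^2\<close>, and the norm bound would contain \<open>d\<close> in place of
  \<open>q\<close>. The denominators are the budget: a step orthogonal to \<open>x\<close> raises
  \<open>s\<close>, so each term falls by a multiple of \<open>p\<close> times itself, and the
  averaged Hessian has to be of order \<open>p\<close> relative to the same term. For
  \<open>p = q\<close> the surplus factor \<open>q\<close> is hidden in the base of
  \<open>Bq\<close>. Exact field arithmetic without roots shapes the rest: directions are normalised
  in the l1 norm, the scale \<sigma> is found by halving against the trace of a power, and
  \<open>q\<close> by comparing squares.\<close>

definition ip :: "nat \<Rightarrow> (nat \<Rightarrow> real) \<Rightarrow> (nat \<Rightarrow> real) \<Rightarrow> real" where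
  "ip d x y = (\<Sum>i<d. x i * y i)"

definition orthonormal :: "nat \<Rightarrow> nat \<Rightarrow> (nat \<Rightarrow> nat \<Rightarrow> real) \<Rightarrow> bool" where
  "orthonormal d r u \<longleftrightarrow> (\<forall>i<r. \<forall>j<r. ip d (u i) (u j) = (if i = j then 1 else 0))"

lemma ip_commute: "ip d x y = ip d y x"
  by (simp add: ip_def mult.commute)

lemma ip_diff_right: "ip d x (\<lambda>i. y i - z i) = ip d x y - ip d x z"
  by (simp add: ip_def right_diff_distrib sum_subtractf)

lemma ip_scale_right: "ip d x (\<lambda>i. a * y i) = a * ip d x y"
  by (simp add: ip_def sum_distrib_left mult_ac)

lemma ip_scale_left: "ip d (\<lambda>i. a * x i) y = a * ip d x y"
  by (simp add: ip_def sum_distrib_left mult_ac)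

lemma ip_sum_right: "ip d x (\<lambda>i. \<Sum>l\<in>L. y l i) = (\<Sum>l\<in>L. ip d x (y l))"
  unfolding ip_def sum_distrib_left by (rule sum.swap)

lemma ip_self_nonneg: "0 \<le> ip d x x"
  by (simp add: ip_def sum_nonneg)

lemma ip_self_eq_0: "ip d x x = 0 \<longleftrightarrow> (\<forall>i<d. x i = 0)"
  by (auto simp: ip_def sum_nonneg_eq_0_iff)

text \<open>Padding the equations with zero rows to a square matrix leaves at least one zero row,
  and Laplace expansion along it shows that the determinant vanishes; a kernel vector is the desired
  solution.\<close>

lemma underdetermined:
  fixes C :: "(nat \<Rightarrow> real) set"
  assumes "finite C" "card C < d"
  shows "\<exists>v. (\<exists>j<d. v j \<noteq> 0) \<and> (\<forall>c\<in>C. ip d c v = 0)"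
proof -
  obtain f where f: "bij_betw f {0..<card C} C"
    using ex_bij_betw_nat_finite[OF assms(1)] by blast
  define X where "X = Matrix.mat d d (\<lambda>(i, j). if i < card C then f i j else 0)"
  have X: "X \<in> carrier_mat d d" by (simp add: X_def)
  have "Determinant.det X = (\<Sum>j<d. X $$ (card C, j) * cofactor X (card C) j)"
    by (rule laplace_expansion_row[OF X assms(2)])
  also have "\<dots> = 0"
    using assms(2) by (intro sum.neutral) (auto simp: X_def)
  finally have "Determinant.det X = 0" .
  then obtain v where v: "v \<in> carrier_vec d" "v \<noteq> 0\<^sub>v d" "X *\<^sub>v v = 0\<^sub>v d"
    using det_0_iff_vec_prod_zero_field[OF X] by blast
  have "\<exists>j<d. vec_index v j \<noteq> 0"
  proof (rule ccontr)
    assume "\<not> ?thesis"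
    then have "v = 0\<^sub>v d" using v(1) by (intro eq_vecI) auto
    then show False using v(2) by simp
  qed
  moreover have "ip d c (vec_index v) = 0" if c: "c \<in> C" for c
  proof -
    have "c \<in> f ` {0..<card C}"
      using f c by (simp add: bij_betw_def)
    then obtain i where i: "i < card C" "f i = c" by auto
    have "vec_index (X *\<^sub>v v) i = 0"
      using v(3) i assms(2) by simp
    moreover have "vec_index (X *\<^sub>v v) i = ip d c (vec_index v)"
      using i assms(2) v(1) by (simp add: X_def scalar_prod_def ip_def lessThan_atLeast0)
    ultimately show ?thesis by simp
  qed
  ultimately show ?thesis by blast
qed

lemma inverse_sqrt_twice: "0 < t \<Longrightarrow> 1 / sqrt t * (1 / sqrt t * t) = 1"
proof -
  assume "0 < t"
  then have "sqrt t * sqrt t = t" by simp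
  moreover have "1 / sqrt t * (1 / sqrt t * t) = t / (sqrt t * sqrt t)" by simp
  ultimately show ?thesis using \<open>0 < t\<close> by simp
qed

text \<open>Vectors are added one at a time, each a normalised solution of the conditions in
  \<open>C\<close> and of orthogonality to its predecessors. Only the number of conditions counts,
  so \<open>C\<close> may be linearly dependent. Both the spectral theorem and the averaging of the
  Hessian take their orthonormal families from here.\<close>

lemma orthonormal_complement:
  assumes "finite C" "card C + r \<le> d"
  shows "\<exists>w. orthonormal d r w \<and> (\<forall>i<r. \<forall>c\<in>C. ip d c (w i) = 0)"
  using assms(2)
proof (induction r)
  case 0
  then show ?case by (auto simp: orthonormal_def)
next
  case (Suc r)
  then obtain w where w: "orthonormal d r w" "\<forall>i<r. \<forall>c\<in>C. ip d c (w i) = 0" by auto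
  have "card (C \<union> w ` {..<r}) \<le> card C + r"
    by (rule order.trans[OF card_Un_le]) (simp add: card_image_le[of "{..<r}", simplified])
  then have "card (C \<union> w ` {..<r}) < d" using Suc.prems by simp
  then obtain v where v: "\<exists>j<d. v j \<noteq> 0" "\<And>c. c \<in> C \<Longrightarrow> ip d c v = 0" "\<And>i. i < r \<Longrightarrow> ip d (w i) v = 0"
    using underdetermined[of "C \<union> w ` {..<r}" d] assms(1) by auto
  have pos: "ip d v v > 0"
    using v(1) ip_self_eq_0[of d v] ip_self_nonneg[of d v] by force
  define z where "z = (\<lambda>i. (1 / sqrt (ip d v v)) * v i)"
  have zz: "ip d z z = 1"
    using pos unfolding z_def ip_scale_left ip_scale_right by (rule inverse_sqrt_twice)
  have zc: "ip d c z = 0" if "ip d c v = 0" for c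
    using that unfolding z_def ip_scale_right by simp
  have "orthonormal d (Suc r) (w(r := z))"
    using w(1) zz zc[OF v(3)] zc[OF v(3), unfolded ip_commute[of d _ z]] by (auto simp: orthonormal_def less_Suc_eq)
  moreover have "\<forall>i<Suc r. \<forall>c\<in>C. ip d c ((w(r := z)) i) = 0"
    using w(2) zc[OF v(2)] by (auto simp: less_Suc_eq)
  ultimately show ?case by blast
qed

text \<open>Orthonormal rows mean \<open>U * V = 1\<close> for the transpose \<open>V\<close>; a
  one-sided inverse of a square matrix is two-sided, so the columns are orthonormal as well.\<close>

lemma orthonormal_complete:
  assumes "orthonormal d d u" "j < d" "k < d"
  shows "(\<Sum>i<d. u i j * u i k) = (if j = k then 1 else 0)"
proof -
  define U where "U = Matrix.mat d d (\<lambda>(i, j). u i j)"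
  define V where "V = Matrix.mat d d (\<lambda>(i, j). u j i)"
  have UV: "U \<in> carrier_mat d d" "V \<in> carrier_mat d d" by (auto simp: U_def V_def)
  have "U * V = 1\<^sub>m d"
    using assms(1)
    by (intro eq_matI) (auto simp: U_def V_def scalar_prod_def orthonormal_def ip_def lessThan_atLeast0)
  then have "V * U = 1\<^sub>m d"
    using mat_mult_left_right_inverse[OF UV] by simp
  then have "(V * U) $$ (j, k) = (if j = k then 1 else 0)"
    using assms by simp
  then show ?thesis
    using assms by (simp add: U_def V_def scalar_prod_def lessThan_atLeast0)
qed

lemma orthonormal_expand:
  assumes "orthonormal d d u" "k < d"
  shows "y k = (\<Sum>i<d. ip d (u i) y * u i k)"
proof -
  have "(\<Sum>i<d. ip d (u i) y * u i k) = (\<Sum>j<d. y j * (\<Sum>i<d. u i j * u i k))"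
    unfolding ip_def sum_distrib_left sum_distrib_right
    by (subst sum.swap) (simp add: mult_ac)
  also have "\<dots> = (\<Sum>j<d. y j * (if j = k then 1 else 0))"
    using assms by (intro sum.cong) (auto simp: orthonormal_complete)
  finally show ?thesis using assms(2) by (simp add: mult_delta_right)
qed

text \<open>The difference between \<open>c\<close> and its projection \<open>p\<close> onto the
  family has nonnegative square, and \<open>ip d p p = ip d c p\<close>.\<close>

lemma bessel:
  assumes "orthonormal d r w"
  shows "(\<Sum>i<r. (ip d c (w i))\<^sup>2) \<le> ip d c c"
proof -
  define p where "p = (\<lambda>k. \<Sum>i<r. ip d c (w i) * w i k)"
  have wp: "ip d x p = (\<Sum>i<r. ip d c (w i) * ip d x (w i))" for x
    unfolding p_def ip_sum_right ip_scale_right ..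
  have cp: "ip d c p = (\<Sum>i<r. (ip d c (w i))\<^sup>2)"
    by (simp add: wp power2_eq_square)
  have "ip d (w i) p = ip d c (w i)" if "i < r" for i
  proof -
    have "ip d (w i) p = (\<Sum>j<r. ip d c (w j) * (if i = j then 1 else 0))"
      unfolding wp using assms that by (intro sum.cong) (auto simp: orthonormal_def)
    then show ?thesis using that by (simp add: mult_delta_right)
  qed
  then have pp: "ip d p p = ip d c p"
    unfolding cp wp[of p] by (intro sum.cong) (auto simp: power2_eq_square ip_commute[of d p])
  have "0 \<le> ip d (\<lambda>k. c k - p k) (\<lambda>k. c k - p k)" by (rule ip_self_nonneg)
  also have "\<dots> = ip d c c - ip d c p"
    unfolding ip_diff_right ip_commute[of d "\<lambda>k. c k - p k" c] ip_commute[of d "\<lambda>k. c k - p k" p]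
    using pp by (simp add: ip_diff_right ip_commute[of d p c])
  finally show ?thesis using cp by simp
qed

text \<open>Over the complex numbers an eigenvector \<open>z\<close> exists. Its Hermitian form
  \<open>t\<close> is \<open>l\<close> times a positive number and, by symmetry, equal to its own
  conjugate. Hence \<open>l\<close> is real, and the real and imaginary parts of \<open>z\<close>
  satisfy the eigenvalue equation separately; one of them is nonzero.\<close>

lemma symmetric_real_eigenvector:
  fixes a :: "nat \<Rightarrow> nat \<Rightarrow> real"
  assumes sym: "\<And>j k. j < d \<Longrightarrow> k < d \<Longrightarrow> a j k = a k j" and "0 < d"
  shows "\<exists>l w. (\<exists>j<d. w j \<noteq> 0) \<and> (\<forall>j<d. ip d (a j) w = l * w j)"
proof -
  define X where "X = Matrix.mat d d (\<lambda>(i, j). complex_of_real (a i j))"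
  have X: "X \<in> carrier_mat d d" by (simp add: X_def)
  obtain l v where lv: "eigenvector X v l"
    using spectrum_non_empty[OF X] assms(2) by (auto simp: spectrum_def eigenvalue_def)
  then have v: "v \<in> carrier_vec d" "v \<noteq> 0\<^sub>v d" "X *\<^sub>v v = l \<cdot>\<^sub>v v"
    using X by (auto simp: eigenvector_def)
  define z where "z = vec_index v"
  have ev: "(\<Sum>k<d. of_real (a j k) * z k) = l * z j" if "j < d" for j
  proof -
    have "vec_index (X *\<^sub>v v) j = l * z j" using v that by (simp add: z_def)
    then show ?thesis
      using that v(1) by (simp add: X_def z_def scalar_prod_def lessThan_atLeast0)
  qed
  obtain j0 where j0: "j0 < d" "z j0 \<noteq> 0"
  proof -
    have "\<exists>j<d. z j \<noteq> 0"
    proof (rule ccontr)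
      assume "\<not> ?thesis"
      then have "v = 0\<^sub>v d" using v(1) by (intro eq_vecI) (auto simp: z_def)
      then show False using v(2) by simp
    qed
    then show ?thesis using that by blast
  qed
  define N where "N = (\<Sum>j<d. (cmod (z j))\<^sup>2)"
  have "N > 0"
    unfolding N_def using j0 by (intro sum_pos2[of _ j0]) auto
  define t where "t = (\<Sum>j<d. cnj (z j) * (\<Sum>k<d. of_real (a j k) * z k))"
  have "t = (\<Sum>j<d. l * (z j * cnj (z j)))"
    unfolding t_def using ev by (intro sum.cong) auto
  then have tN: "t = l * of_real N"
    by (simp only: N_def sum_distrib_left of_real_sum complex_norm_square)
  have "cnj t = (\<Sum>j<d. \<Sum>k<d. z j * (of_real (a j k) * cnj (z k)))"
    by (simp add: t_def sum_distrib_left)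
  also have "\<dots> = (\<Sum>k<d. \<Sum>j<d. z j * (of_real (a j k) * cnj (z k)))" by (rule sum.swap)
  also have "\<dots> = t"
    unfolding t_def sum_distrib_left using sym by (intro sum.cong) auto
  finally have "cnj l = l" using tN \<open>N > 0\<close> by auto
  then have l: "l = of_real (Re l)" by (simp add: complex_eq_iff)
  have re: "ip d (a j) (\<lambda>k. Re (z k)) = Re l * Re (z j)" if "j < d" for j
  proof -
    have "Re (\<Sum>k<d. of_real (a j k) * z k) = Re (of_real (Re l) * z j)" using ev[OF that] l by metis
    then show ?thesis by (simp add: ip_def)
  qed
  have im: "ip d (a j) (\<lambda>k. Im (z k)) = Re l * Im (z j)" if "j < d" for j
  proof -
    have "Im (\<Sum>k<d. of_real (a j k) * z k) = Im (of_real (Re l) * z j)" using ev[OF that] l by metis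
    then show ?thesis by (simp add: ip_def)
  qed
  have "Re (z j0) \<noteq> 0 \<or> Im (z j0) \<noteq> 0" using j0(2) complex_eq_iff by auto
  then show ?thesis
  proof
    assume "Re (z j0) \<noteq> 0"
    then show ?thesis using re j0(1) by (intro exI[of _ "Re l"] exI[of _ "\<lambda>k. Re (z k)"]) auto
  next
    assume "Im (z j0) \<noteq> 0"
    then show ?thesis using im j0(1) by (intro exI[of _ "Re l"] exI[of _ "\<lambda>k. Im (z k)"]) auto
  qed
qed

lemma ip_symmetric_matrix:
  assumes sym: "\<And>j k. j < d \<Longrightarrow> k < d \<Longrightarrow> a j k = a k j"
  shows "ip d x (\<lambda>j. ip d (a j) y) = ip d y (\<lambda>j. ip d (a j) x)"
proof -
  have "ip d x (\<lambda>j. ip d (a j) y) = (\<Sum>j<d. \<Sum>k<d. x j * (a j k * y k))"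
    by (simp add: ip_def sum_distrib_left)
  also have "\<dots> = (\<Sum>k<d. \<Sum>j<d. x j * (a j k * y k))" by (rule sum.swap)
  also have "\<dots> = (\<Sum>k<d. \<Sum>j<d. y k * (a k j * x j))"
    using sym by (intro sum.cong) auto
  finally show ?thesis by (simp add: ip_def sum_distrib_left)
qed

text \<open>Deflation: an eigenvector of the compression of \<open>a\<close> to the orthogonal
  complement of the eigenvectors found so far is an eigenvector of \<open>a\<close> itself.\<close>

lemma spectral_partial:
  fixes a :: "nat \<Rightarrow> nat \<Rightarrow> real"
  assumes sym: "\<And>j k. j < d \<Longrightarrow> k < d \<Longrightarrow> a j k = a k j" and "r \<le> d"
  shows "\<exists>u l. orthonormal d r u \<and> (\<forall>i<r. \<forall>j<d. ip d (a j) (u i) = l i * u i j)"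
  using assms(2)
proof (induction r)
  case 0
  then show ?case by (auto simp: orthonormal_def)
next
  case (Suc r)
  then obtain u l where u: "orthonormal d r u" "\<And>i j. i < r \<Longrightarrow> j < d \<Longrightarrow> ip d (a j) (u i) = l i * u i j"
    by auto
  let ?m = "d - r"
  have "card (u ` {..<r}) \<le> r" by (metis card_image_le card_lessThan finite_lessThan)
  then have "card (u ` {..<r}) + ?m \<le> d" using Suc.prems by simp
  then obtain b where b: "orthonormal d ?m b" "\<And>i k. i < ?m \<Longrightarrow> k < r \<Longrightarrow> ip d (u k) (b i) = 0"
    using orthonormal_complement[of "u ` {..<r}" ?m d] by auto
  define c where "c = (\<lambda>j k. ip d (b j) (\<lambda>p. ip d (a p) (b k)))"
  have "c j k = c k j" for j k
    unfolding c_def by (rule ip_symmetric_matrix[OF sym])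
  then obtain \<mu> w where w: "\<exists>j<?m. w j \<noteq> 0" "\<And>j. j < ?m \<Longrightarrow> ip ?m (c j) w = \<mu> * w j"
    using symmetric_real_eigenvector[of ?m c] Suc.prems by auto
  define v where "v = (\<lambda>p. \<Sum>j<?m. w j * b j p)"
  have xv: "ip d x v = (\<Sum>j<?m. w j * ip d x (b j))" for x
    unfolding v_def ip_sum_right ip_scale_right ..
  have uv: "ip d (u k) v = 0" if "k < r" for k
    using b(2) that by (simp add: xv)
  have bv: "ip d (b k) v = w k" if "k < ?m" for k
  proof -
    have "ip d (b k) v = (\<Sum>j<?m. w j * (if k = j then 1 else 0))"
      unfolding xv using b(1) that by (intro sum.cong) (auto simp: orthonormal_def)
    then show ?thesis using that by (simp add: mult_delta_right)
  qed
  \<comment> \<open>The residual of the eigenvalue equation. It is orthogonal to the old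
    eigenvectors because \<open>a\<close> is symmetric, and to the \<open>b k\<close> because
    \<open>w\<close> is an eigenvector of the compression \<open>c\<close>. Together these vectors
    form an orthonormal basis, so the residual vanishes.\<close>
  define y where "y = (\<lambda>p. ip d (a p) v - \<mu> * v p)"
  have xy: "ip d x y = ip d x (\<lambda>p. ip d (a p) v) - \<mu> * ip d x v" for x
    unfolding y_def ip_diff_right ip_scale_right ..
  have uy: "ip d (u k) y = 0" if "k < r" for k
  proof -
    have "ip d (u k) (\<lambda>p. ip d (a p) v) = ip d v (\<lambda>p. ip d (a p) (u k))"
      by (rule ip_symmetric_matrix[OF sym])
    also have "\<dots> = ip d v (\<lambda>p. l k * u k p)"
      using u(2)[OF that] unfolding ip_def[of d v] by (intro sum.cong) auto
    also have "\<dots> = 0" using uv[OF that] by (simp add: ip_scale_right ip_commute)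
    finally show ?thesis using uv[OF that] by (simp add: xy)
  qed
  have by0: "ip d (b k) y = 0" if "k < ?m" for k
  proof -
    have "ip d (b k) (\<lambda>p. ip d (a p) v) = ip ?m (c k) w"
      unfolding xv ip_sum_right ip_scale_right c_def by (simp add: ip_def[of ?m] mult.commute)
    then show ?thesis using w(2)[OF that] bv[OF that] by (simp add: xy)
  qed
  define e where "e = (\<lambda>i. if i < r then u i else b (i - r))"
  have "orthonormal d d e"
    unfolding orthonormal_def
  proof (intro allI impI)
    fix i j assume ij: "i < d" "j < d"
    consider "i < r" "j < r" | "i < r" "j \<ge> r" | "i \<ge> r" "j < r" | "i \<ge> r" "j \<ge> r" by linarith
    then show "ip d (e i) (e j) = (if i = j then 1 else 0)"
    proof cases
      case 1 then show ?thesis using u(1) by (simp add: e_def orthonormal_def)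
    next
      case 2 then show ?thesis using b(2)[of "j - r" i] ij by (simp add: e_def)
    next
      case 3 then show ?thesis using b(2)[of "i - r" j] ij by (simp add: e_def ip_commute)
    next
      case 4
      then have "i - r < d - r" "j - r < d - r" "(i - r = j - r) = (i = j)" using ij by auto
      then show ?thesis using 4 b(1) by (simp add: e_def orthonormal_def)
    qed
  qed
  then have "y p = 0" if "p < d" for p
    using orthonormal_expand[of d e p y] that uy by0 by (auto simp: e_def intro!: sum.neutral)
  then have ev: "ip d (a p) v = \<mu> * v p" if "p < d" for p using that by (simp add: y_def)
  have "ip d v v = (\<Sum>j<?m. w j * w j)"
    unfolding xv using bv by (intro sum.cong) (auto simp: ip_commute)
  also have "\<dots> > 0" 
  proof -
    obtain j where "j < ?m" "w j \<noteq> 0" using w(1) by blast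
    then show ?thesis
      by (intro sum_pos2[of _ j]) (auto simp: zero_less_mult_iff linorder_neq_iff)
  qed
  finally have pos: "ip d v v > 0" .
  define z where "z = (\<lambda>p. (1 / sqrt (ip d v v)) * v p)"
  have zz: "ip d z z = 1"
    using pos unfolding z_def ip_scale_left ip_scale_right by (rule inverse_sqrt_twice)
  have uz: "ip d (u k) z = 0" if "k < r" for k
    unfolding z_def ip_scale_right using uv[OF that] by simp
  have "orthonormal d (Suc r) (u(r := z))"
    using u(1) zz uz uz[unfolded ip_commute[of d _ z]] by (auto simp: orthonormal_def less_Suc_eq)
  moreover have "\<forall>i<Suc r. \<forall>j<d. ip d (a j) ((u(r := z)) i) = (l(r := \<mu>)) i * (u(r := z)) i j"
    using u(2) ev by (auto simp: less_Suc_eq z_def ip_scale_right simp del: times_divide_eq_left)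
  ultimately show ?case by blast
qed

definition eigenbasis :: "nat \<Rightarrow> (nat \<Rightarrow> nat \<Rightarrow> real) \<Rightarrow> (nat \<Rightarrow> nat \<Rightarrow> real) \<Rightarrow> (nat \<Rightarrow> real) \<Rightarrow> bool" where
  "eigenbasis d a u l \<longleftrightarrow> orthonormal d d u \<and>
     (\<forall>j<d. \<forall>k<d. a j k = (\<Sum>i<d. l i * u i j * u i k))"

theorem spectral_theorem:
  fixes a :: "nat \<Rightarrow> nat \<Rightarrow> real"
  assumes "\<And>j k. j < d \<Longrightarrow> k < d \<Longrightarrow> a j k = a k j"
  shows "\<exists>u l. eigenbasis d a u l"
proof -
  obtain u l where u: "orthonormal d d u" "\<And>i j. i < d \<Longrightarrow> j < d \<Longrightarrow> ip d (a j) (u i) = l i * u i j"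
    using spectral_partial[of d a d, OF assms order_refl] by blast
  have "a j k = (\<Sum>i<d. l i * u i j * u i k)" if "j < d" "k < d" for j k
    using orthonormal_expand[OF u(1) that(2), of "a j"] u(2)[OF _ that(1)]
    by (simp add: ip_commute[of d _ "a j"])
  then show ?thesis using u(1) unfolding eigenbasis_def by blast
qed

section \<open>Powers of perturbed matrices\<close>

definition mm :: "nat \<Rightarrow> (nat \<Rightarrow> nat \<Rightarrow> real) \<Rightarrow> (nat \<Rightarrow> nat \<Rightarrow> real) \<Rightarrow> nat \<Rightarrow> nat \<Rightarrow> real" where
  "mm d X Y = (\<lambda>j k. \<Sum>l<d. X j l * Y l k)"

definition idm :: "nat \<Rightarrow> nat \<Rightarrow> real" where
  "idm = (\<lambda>j k. if j = k then 1 else 0)"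

fun mpow :: "nat \<Rightarrow> (nat \<Rightarrow> nat \<Rightarrow> real) \<Rightarrow> nat \<Rightarrow> nat \<Rightarrow> nat \<Rightarrow> real" where
  "mpow d X 0 = idm"
| "mpow d X (Suc a) = mm d X (mpow d X a)"

definition tr :: "nat \<Rightarrow> (nat \<Rightarrow> nat \<Rightarrow> real) \<Rightarrow> real" where
  "tr d X = (\<Sum>j<d. X j j)"

text \<open>\<open>pert d M H k i\<close> is the coefficient of \<open>t ^ i\<close> in \<open>(M + t H) ^ k\<close>.\<close>

fun pert :: "nat \<Rightarrow> (nat \<Rightarrow> nat \<Rightarrow> real) \<Rightarrow> (nat \<Rightarrow> nat \<Rightarrow> real) \<Rightarrow> nat \<Rightarrow> nat \<Rightarrow> nat \<Rightarrow> nat \<Rightarrow> real" where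
  "pert d M H 0 i = (if i = 0 then idm else (\<lambda>a b. 0))"
| "pert d M H (Suc k) 0 = mm d M (pert d M H k 0)"
| "pert d M H (Suc k) (Suc i) = (\<lambda>a b. mm d M (pert d M H k (Suc i)) a b + mm d H (pert d M H k i) a b)"

lemma pert_0: "pert d M H k 0 = mpow d M k"
  by (induction k) auto

lemma pert_gt: "k < i \<Longrightarrow> pert d M H k i = (\<lambda>a b. 0)"
proof (induction k arbitrary: i)
  case (Suc k)
  then obtain i' where "i = Suc i'" "k < i'" by (cases i) auto
  then show ?case using Suc.IH[of i'] Suc.IH[of "Suc i'"] by (simp add: mm_def)
qed simp

lemma mpow_perturb:
  "mpow d (\<lambda>a b. M a b + t * H a b) k a b = (\<Sum>i\<le>k. t ^ i * pert d M H k i a b)"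
proof (induction k arbitrary: a b)
  case (Suc k)
  let ?W = "pert d M H"
  have "mpow d (\<lambda>a b. M a b + t * H a b) (Suc k) a b
      = (\<Sum>l<d. (M a l + t * H a l) * (\<Sum>i\<le>k. t ^ i * ?W k i l b))"
    by (simp add: mm_def Suc.IH)
  also have "\<dots> = (\<Sum>l<d. \<Sum>i\<le>k. t ^ i * (M a l * ?W k i l b)) + (\<Sum>l<d. \<Sum>i\<le>k. t ^ Suc i * (H a l * ?W k i l b))"
    unfolding sum.distrib[symmetric] sum_distrib_left
    by (intro sum.cong refl) (simp add: algebra_simps)
  also have "\<dots> = (\<Sum>i\<le>k. t ^ i * mm d M (?W k i) a b) + (\<Sum>i\<le>k. t ^ Suc i * mm d H (?W k i) a b)"
    unfolding mm_def sum_distrib_left by (intro arg_cong2[where f = "(+)"] sum.swap)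
  also have "(\<Sum>i\<le>k. t ^ i * mm d M (?W k i) a b) = (\<Sum>i\<le>Suc k. t ^ i * mm d M (?W k i) a b)"
    by (simp add: pert_gt) (simp add: mm_def)
  also have "\<dots> = mm d M (?W k 0) a b + (\<Sum>i\<le>k. t ^ Suc i * mm d M (?W k (Suc i)) a b)"
    unfolding sum.atMost_Suc_shift[of _ k] by simp
  also have "\<dots> + (\<Sum>i\<le>k. t ^ Suc i * mm d H (?W k i) a b) = (\<Sum>i\<le>Suc k. t ^ i * ?W (Suc k) i a b)"
    unfolding sum.atMost_Suc_shift[of _ k] add.assoc sum.distrib[symmetric]
    by (simp add: distrib_left)
  finally show ?case .
qed (simp add: idm_def)

lemma tr_mpow_perturb:
  "tr d (mpow d (\<lambda>a b. M a b + t * H a b) k) = (\<Sum>i\<le>k. t ^ i * tr d (pert d M H k i))"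
  unfolding tr_def mpow_perturb sum_distrib_left by (rule sum.swap)

section \<open>Operator bounds\<close>

text \<open>An upper bound for the operator norm, stated as a relation so that no supremum is
  involved. Nonnegativity is included because for \<open>d = 0\<close> the inequality alone says
  nothing about the bound.\<close>

definition opbound :: "nat \<Rightarrow> (nat \<Rightarrow> nat \<Rightarrow> real) \<Rightarrow> real \<Rightarrow> bool" where
  "opbound d M \<mu> \<longleftrightarrow> 0 \<le> \<mu> \<and>
     (\<forall>y. L2_set (\<lambda>j. \<Sum>k<d. M j k * y k) {..<d} \<le> \<mu> * L2_set y {..<d})"

lemma L2_set_mm_column:
  assumes "opbound d M \<mu>"
  shows "L2_set (\<lambda>j. mm d M X j c) {..<d} \<le> \<mu> * L2_set (\<lambda>j. X j c) {..<d}"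
  using assms[unfolded opbound_def, THEN conjunct2, THEN spec, of "\<lambda>j. X j c"] by (simp add: mm_def)

text \<open>\<open>pert d M H k i\<close> is the sum of the \<open>k choose i\<close> words with
  \<open>i\<close> letters \<open>H\<close> and \<open>k - i\<close> letters \<open>M\<close>, so
  the recursion for \<open>pert\<close> becomes Pascal's rule for the bound. Working column by
  column keeps the estimate in terms of vector norms.\<close>

lemma pert_column_bound:
  assumes M: "opbound d M \<mu>" and H: "opbound d H \<eta>" and c: "c < d"
  shows "L2_set (\<lambda>j. pert d M H k i j c) {..<d} \<le> real (k choose i) * \<mu> ^ (k - i) * \<eta> ^ i"
proof (induction k arbitrary: i)
  case 0
  show ?case
    using c by (cases i) (auto simp: L2_set_def idm_def power2_eq_square mult_delta_right)
next
  case (Suc k)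
  have nonneg: "0 \<le> \<mu>" "0 \<le> \<eta>" using M H by (auto simp: opbound_def)
  show ?case
  proof (cases i)
    case 0
    have "L2_set (\<lambda>j. pert d M H (Suc k) 0 j c) {..<d} \<le> \<mu> * L2_set (\<lambda>j. pert d M H k 0 j c) {..<d}"
      using L2_set_mm_column[OF M] by simp
    also have "\<dots> \<le> \<mu> * \<mu> ^ k"
      using Suc.IH[of 0] nonneg by (intro mult_left_mono) auto
    finally show ?thesis using 0 by simp
  next
    case (Suc i')
    let ?W = "pert d M H k"
    have "L2_set (\<lambda>j. pert d M H (Suc k) (Suc i') j c) {..<d}
        \<le> L2_set (\<lambda>j. mm d M (?W (Suc i')) j c) {..<d} + L2_set (\<lambda>j. mm d H (?W i') j c) {..<d}"
      using L2_set_triangle_ineq by simp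
    also have "\<dots> \<le> \<mu> * L2_set (\<lambda>j. ?W (Suc i') j c) {..<d} + \<eta> * L2_set (\<lambda>j. ?W i' j c) {..<d}"
      by (intro add_mono L2_set_mm_column M H)
    also have "\<dots> \<le> \<mu> * (real (k choose Suc i') * \<mu> ^ (k - Suc i') * \<eta> ^ Suc i')
        + \<eta> * (real (k choose i') * \<mu> ^ (k - i') * \<eta> ^ i')"
      by (intro add_mono mult_left_mono Suc.IH nonneg)
    also have "\<mu> * (real (k choose Suc i') * \<mu> ^ (k - Suc i') * \<eta> ^ Suc i')
        = real (k choose Suc i') * \<mu> ^ (k - i') * \<eta> ^ Suc i'"
    \<comment> \<open>For \<open>Suc i' > k\<close> truncated subtraction makes the exponents
      disagree, but then the binomial coefficient is 0.\<close>
    proof (cases "Suc i' \<le> k")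
      case True
      then have "k - i' = Suc (k - Suc i')" by simp
      then show ?thesis by simp
    qed simp
    finally show ?thesis using Suc by (simp add: algebra_simps)
  qed
qed

lemma tr_pert_bound:
  assumes M: "opbound d M \<mu>" and H: "opbound d H \<eta>"
  shows "\<bar>tr d (pert d M H k i)\<bar> \<le> real d * (real (k choose i) * \<mu> ^ (k - i) * \<eta> ^ i)"
proof -
  have "\<bar>pert d M H k i c c\<bar> \<le> real (k choose i) * \<mu> ^ (k - i) * \<eta> ^ i" if "c < d" for c
  proof -
    have "\<bar>pert d M H k i c c\<bar> \<le> L2_set (\<lambda>j. \<bar>pert d M H k i j c\<bar>) {..<d}"
      using that by (intro member_le_L2_set) auto
    also have "\<dots> = L2_set (\<lambda>j. pert d M H k i j c) {..<d}" by (simp add: L2_set_def)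
    finally show ?thesis using pert_column_bound[OF M H that, of k i] by linarith
  qed
  then have "\<bar>tr d (pert d M H k i)\<bar> \<le> (\<Sum>c<d. real (k choose i) * \<mu> ^ (k - i) * \<eta> ^ i)"
    unfolding tr_def by (intro order.trans[OF sum_abs] sum_mono) auto
  then show ?thesis by simp
qed

text \<open>The product is at most the \<open>k\<close>-th power of the larger base. This crude
  inequality stands in for Young's inequality, at the cost of a constant.\<close>

lemma power_mult_power_le:
  fixes a b :: real
  assumes "0 \<le> a" "0 \<le> b" "i \<le> k"
  shows "a ^ (k - i) * b ^ i \<le> a ^ k + b ^ k"
proof (cases "a \<le> b")
  case True
  then have "a ^ (k - i) * b ^ i \<le> b ^ (k - i) * b ^ i" using assms by (intro mult_right_mono power_mono) auto
  also have "\<dots> = b ^ k" using assms by (simp flip: power_add)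
  finally show ?thesis using assms by (simp add: add_increasing)
next
  case False
  then have "a ^ (k - i) * b ^ i \<le> a ^ (k - i) * a ^ i" using assms by (intro mult_left_mono power_mono) auto
  also have "\<dots> = a ^ k" using assms by (simp flip: power_add)
  finally show ?thesis using assms by (simp add: add_increasing2)
qed

lemma geometric_tail_le:
  fixes z :: real
  assumes "0 \<le> z" "z \<le> 1 / 2"
  shows "(\<Sum>i\<in>{m..k}. z ^ i) \<le> 2 * z ^ m"
proof -
  have "(\<Sum>i\<in>{m..k}. z ^ i) * (1 - z) \<le> z ^ m"
    using assms by (cases "m \<le> k") (auto simp: sum_gp0 sum_gp mult.commute)
  moreover have "(\<Sum>i\<in>{m..k}. z ^ i) * (1 / 2) \<le> (\<Sum>i\<in>{m..k}. z ^ i) * (1 - z)"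
    using assms by (intro mult_left_mono sum_nonneg) auto
  ultimately show ?thesis by linarith
qed

text \<open>Since \<open>k choose i\<close> is at most \<open>k ^ i\<close>, the terms are dominated
  by multiples of \<open>(k t) ^ i\<close>, a geometric sequence of ratio at most
  \<open>1 / 2\<close>. Keeping the full exponent \<open>k\<close> on the two norms makes the error
  comparable to a trace of \<open>k\<close>-th powers.\<close>

lemma pert_tail_bound:
  assumes M: "opbound d M \<mu>" and H: "opbound d H \<eta>" and t: "0 \<le> t" "real k * t \<le> 1 / 2"
  shows "\<bar>\<Sum>i\<in>{m..k}. t ^ i * tr d (pert d M H k i)\<bar>
       \<le> real d * (\<mu> ^ k + \<eta> ^ k) * (2 * (real k * t) ^ m)"
proof -
  have nonneg: "0 \<le> \<mu>" "0 \<le> \<eta>" using M H by (auto simp: opbound_def)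
  have "\<bar>t ^ i * tr d (pert d M H k i)\<bar> \<le> real d * (\<mu> ^ k + \<eta> ^ k) * (real k * t) ^ i"
    if "i \<in> {m..k}" for i
  proof -
    have "\<bar>t ^ i * tr d (pert d M H k i)\<bar> \<le> t ^ i * (real d * (real (k choose i) * \<mu> ^ (k - i) * \<eta> ^ i))"
      using tr_pert_bound[OF M H, of k i] t(1) by (simp add: abs_mult mult_left_mono)
    also have "\<dots> = real d * (\<mu> ^ (k - i) * \<eta> ^ i) * (real (k choose i) * t ^ i)"
      by (simp add: algebra_simps)
    also have "\<dots> \<le> real d * (\<mu> ^ k + \<eta> ^ k) * (real k ^ i * t ^ i)"
    proof (intro mult_mono)
      show "real (k choose i) \<le> real k ^ i"
      proof (cases "i \<le> k")
        case True
        then have "k choose i \<le> k ^ i" by (rule binomial_le_pow)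
        then show ?thesis by (metis of_nat_le_iff of_nat_power)
      qed (simp add: binomial_eq_0)
    qed (use that nonneg t power_mult_power_le[of \<mu> \<eta> i k] in auto)
    finally show ?thesis by (simp add: power_mult_distrib)
  qed
  then have "\<bar>\<Sum>i\<in>{m..k}. t ^ i * tr d (pert d M H k i)\<bar>
      \<le> (\<Sum>i\<in>{m..k}. real d * (\<mu> ^ k + \<eta> ^ k) * (real k * t) ^ i)"
    by (intro order.trans[OF sum_abs] sum_mono)
  also have "\<dots> \<le> real d * (\<mu> ^ k + \<eta> ^ k) * (2 * (real k * t) ^ m)"
    unfolding sum_distrib_left[symmetric]
    using geometric_tail_le[of "real k * t" m k] t nonneg by (intro mult_left_mono) auto
  finally show ?thesis .
qed

section \<open>Coordinates in an eigenbasis\<close>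

definition hat :: "nat \<Rightarrow> (nat \<Rightarrow> nat \<Rightarrow> real) \<Rightarrow> (nat \<Rightarrow> nat \<Rightarrow> real) \<Rightarrow> nat \<Rightarrow> nat \<Rightarrow> real" where
  "hat d u X p q = (\<Sum>j<d. \<Sum>k<d. u p j * X j k * u q k)"

lemma hat_add: "hat d u (\<lambda>a b. X a b + Y a b) p q = hat d u X p q + hat d u Y p q"
  by (simp add: hat_def algebra_simps sum.distrib)

lemma hat_zero: "hat d u (\<lambda>a b. 0) p q = 0"
  by (simp add: hat_def)

lemma hat_sum: "hat d u (\<lambda>a b. \<Sum>i\<in>I. c i * X i a b) p q = (\<Sum>i\<in>I. c i * hat d u (X i) p q)"
proof -
  have "hat d u (\<lambda>a b. \<Sum>i\<in>I. c i * X i a b) p q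
      = (\<Sum>j<d. \<Sum>k<d. \<Sum>i\<in>I. c i * (u p j * X i j k * u q k))"
    by (simp add: hat_def sum_distrib_left sum_distrib_right mult_ac)
  also have "\<dots> = (\<Sum>j<d. \<Sum>i\<in>I. \<Sum>k<d. c i * (u p j * X i j k * u q k))"
    by (rule sum.cong, rule refl, rule sum.swap)
  also have "\<dots> = (\<Sum>i\<in>I. \<Sum>j<d. \<Sum>k<d. c i * (u p j * X i j k * u q k))"
    by (rule sum.swap)
  finally show ?thesis by (simp add: hat_def sum_distrib_left)
qed

lemma hat_symmetric:
  assumes "\<And>j k. j < d \<Longrightarrow> k < d \<Longrightarrow> X j k = X k j"
  shows "hat d u X p q = hat d u X q p"
proof -
  have "hat d u X p q = (\<Sum>k<d. \<Sum>j<d. u p j * X j k * u q k)"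
    unfolding hat_def by (rule sum.swap)
  also have "\<dots> = hat d u X q p"
    unfolding hat_def by (intro sum.cong refl) (use assms in auto)
  finally show ?thesis .
qed

text \<open>The completeness relation of \<open>u\<close> is inserted between the two factors, so
  passing to coordinates is multiplicative.\<close>

lemma hat_mm:
  assumes u: "orthonormal d d u"
  shows "hat d u (mm d X Y) p q = (\<Sum>r<d. hat d u X p r * hat d u Y r q)"
proof -
  have "(\<Sum>r<d. hat d u X p r * hat d u Y r q)
      = (\<Sum>r<d. \<Sum>j<d. \<Sum>m<d. \<Sum>l<d. \<Sum>k<d. (u p j * X j l * (Y m k * u q k)) * (u r l * u r m))"
    unfolding hat_def sum_product by (intro sum.cong refl) (simp add: mult_ac)
  also have "\<dots> = (\<Sum>j<d. \<Sum>m<d. \<Sum>l<d. \<Sum>k<d. \<Sum>r<d. (u p j * X j l * (Y m k * u q k)) * (u r l * u r m))"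
    by ((rule trans[OF sum.swap], rule sum.cong, rule refl)+, rule refl)
  also have "\<dots> = (\<Sum>j<d. \<Sum>m<d. \<Sum>l<d. \<Sum>k<d. (u p j * X j l * (Y m k * u q k)) * (if l = m then 1 else 0))"
    unfolding sum_distrib_left[symmetric] by (intro sum.cong refl) (use u in \<open>simp add: orthonormal_complete\<close>)
  also have "\<dots> = (\<Sum>j<d. \<Sum>m<d. \<Sum>k<d. u p j * X j m * (Y m k * u q k))"
  proof (rule sum.cong[OF refl], rule sum.cong[OF refl])
    fix j m assume "m \<in> {..<d}"
    have "(\<Sum>l<d. \<Sum>k<d. (u p j * X j l * (Y m k * u q k)) * (if l = m then 1 else 0))
       = (\<Sum>l<d. if l = m then (\<Sum>k<d. u p j * X j l * (Y m k * u q k)) else 0)"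
      by (intro sum.cong refl) auto
    then show "(\<Sum>l<d. \<Sum>k<d. (u p j * X j l * (Y m k * u q k)) * (if l = m then 1 else 0))
       = (\<Sum>k<d. u p j * X j m * (Y m k * u q k))"
      using \<open>m \<in> {..<d}\<close> by simp
  qed
  also have "\<dots> = (\<Sum>j<d. \<Sum>k<d. \<Sum>l<d. u p j * X j l * (Y l k * u q k))"
    by (rule sum.cong, rule refl, rule sum.swap)
  also have "\<dots> = hat d u (mm d X Y) p q"
    by (simp add: hat_def mm_def sum_distrib_left sum_distrib_right mult_ac)
  finally show ?thesis by simp
qed

lemma tr_hat:
  assumes u: "orthonormal d d u"
  shows "tr d X = (\<Sum>p<d. hat d u X p p)"
proof -
  have "(\<Sum>p<d. hat d u X p p) = (\<Sum>p<d. \<Sum>j<d. \<Sum>k<d. X j k * (u p j * u p k))"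
    by (simp add: hat_def mult_ac)
  also have "\<dots> = (\<Sum>j<d. \<Sum>p<d. \<Sum>k<d. X j k * (u p j * u p k))" by (rule sum.swap)
  also have "\<dots> = (\<Sum>j<d. \<Sum>k<d. \<Sum>p<d. X j k * (u p j * u p k))"
    by (rule sum.cong, rule refl, rule sum.swap)
  also have "\<dots> = (\<Sum>j<d. \<Sum>k<d. X j k * (if j = k then 1 else 0))"
    unfolding sum_distrib_left[symmetric] by (intro sum.cong refl) (use u in \<open>simp add: orthonormal_complete\<close>)
  also have "\<dots> = tr d X" by (simp add: tr_def mult_delta_right)
  finally show ?thesis by simp
qed

lemma hat_idm:
  assumes "orthonormal d d u" "p < d" "q < d"
  shows "hat d u idm p q = (if p = q then 1 else 0)"
  using assms by (simp add: hat_def idm_def orthonormal_def ip_def mult_delta_left mult_delta_right)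

lemma hat_eigenbasis:
  assumes e: "eigenbasis d M u l" and "p < d" "q < d"
  shows "hat d u M p q = (if p = q then l p else 0)"
proof -
  have u: "orthonormal d d u" using e by (simp add: eigenbasis_def)
  have "hat d u M p q = hat d u (\<lambda>j k. \<Sum>i<d. l i * (u i j * u i k)) p q"
    unfolding hat_def using e by (intro sum.cong refl) (auto simp: eigenbasis_def mult_ac)
  also have "\<dots> = (\<Sum>i<d. l i * hat d u (\<lambda>j k. u i j * u i k) p q)" by (rule hat_sum)
  also have "\<dots> = (\<Sum>i<d. l i * (ip d (u p) (u i) * ip d (u q) (u i)))"
    by (simp add: hat_def ip_def sum_product mult_ac)
  also have "\<dots> = (\<Sum>i<d. if i = p then (if p = q then l p else 0) else 0)"
    using u assms by (intro sum.cong refl) (auto simp: orthonormal_def)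
  finally show ?thesis using assms by simp
qed

lemma hat_eigen_mm:
  assumes e: "eigenbasis d M u l" and "p < d"
  shows "hat d u (mm d M X) p q = l p * hat d u X p q"
proof -
  have "hat d u (mm d M X) p q = (\<Sum>r<d. if r = p then l p * hat d u X p q else 0)"
    unfolding hat_mm[OF e[unfolded eigenbasis_def, THEN conjunct1]]
    using assms by (intro sum.cong refl) (auto simp: hat_eigenbasis)
  then show ?thesis using assms by simp
qed

lemma hat_mpow_mm:
  assumes e: "eigenbasis d M u l" and "p < d" "q < d"
  shows "hat d u (mm d (mpow d M a) X) p q = l p ^ a * hat d u X p q"
proof -
  have u: "orthonormal d d u" using e by (simp add: eigenbasis_def)
  have pw: "hat d u (mpow d M a) p r = (if p = r then l p ^ a else 0)" if "r < d" for r
    using that assms by (induction a) (auto simp: hat_idm[OF u] hat_eigen_mm)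
  have "hat d u (mm d (mpow d M a) X) p q = (\<Sum>r<d. if p = r then l p ^ a * hat d u X p q else 0)"
    unfolding hat_mm[OF u] using pw by (intro sum.cong refl) auto
  then show ?thesis using assms by simp
qed

lemma tr_mpow:
  assumes e: "eigenbasis d M u l"
  shows "tr d (mpow d M a) = (\<Sum>p<d. l p ^ a)"
proof -
  have u: "orthonormal d d u" using e by (simp add: eigenbasis_def)
  have "hat d u (mpow d M a) p p = l p ^ a" if "p < d" for p
    using that assms by (induction a) (auto simp: hat_idm[OF u] hat_eigen_mm)
  then show ?thesis by (simp add: tr_hat[OF u])
qed

text \<open>The factor is the first divided difference of \<open>z ^ k\<close> at two eigenvalues,
  and the induction is its recursion in \<open>k\<close>. Written as a sum, it needs no case
  distinction for equal eigenvalues.\<close>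

lemma hat_pert_1:
  assumes e: "eigenbasis d M u l" and "p < d" "q < d"
  shows "hat d u (pert d M H k 1) p q = (\<Sum>a<k. l p ^ a * l q ^ (k - 1 - a)) * hat d u H p q"
proof (induction k)
  case 0
  then show ?case by (simp add: hat_zero)
next
  case (Suc k)
  have u: "orthonormal d d u" using e by (simp add: eigenbasis_def)
  have "hat d u (mm d H (mpow d M k)) p q = (\<Sum>r<d. if r = q then hat d u H p q * l q ^ k else 0)"
    unfolding hat_mm[OF u]
  proof (intro sum.cong refl)
    fix r assume "r \<in> {..<d}"
    then have "hat d u (mpow d M k) r q = (if r = q then l q ^ k else 0)"
      using assms by (induction k) (auto simp: hat_idm[OF u] hat_eigen_mm)
    then show "hat d u H p r * hat d u (mpow d M k) r q = (if r = q then hat d u H p q * l q ^ k else 0)"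
      by auto
  qed
  also have "\<dots> = l q ^ k * hat d u H p q" using assms by simp
  finally have 1: "hat d u (mm d H (mpow d M k)) p q = l q ^ k * hat d u H p q" .
  have "hat d u (pert d M H (Suc k) 1) p q = l p * hat d u (pert d M H k 1) p q + l q ^ k * hat d u H p q"
    using assms by (simp add: hat_add hat_eigen_mm pert_0 1)
  also have "\<dots> = (l p * (\<Sum>a<k. l p ^ a * l q ^ (k - 1 - a)) + l q ^ k) * hat d u H p q"
    by (simp add: Suc.IH[unfolded One_nat_def] algebra_simps)
  also have "l p * (\<Sum>a<k. l p ^ a * l q ^ (k - 1 - a)) + l q ^ k = (\<Sum>a<Suc k. l p ^ a * l q ^ (Suc k - 1 - a))"
    unfolding sum.lessThan_Suc_shift by (simp add: sum_distrib_left mult_ac)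
  finally show ?case .
qed

lemma tr_pert_1:
  assumes e: "eigenbasis d M u l"
  shows "tr d (pert d M H k 1) = real k * tr d (mm d (mpow d M (k - 1)) H)"
proof -
  have u: "orthonormal d d u" using e by (simp add: eigenbasis_def)
  have *: "(\<Sum>a<k. l p ^ a * l p ^ (k - Suc a)) = real k * l p ^ (k - 1)" for p
  proof -
    have "(\<Sum>a<k. l p ^ a * l p ^ (k - Suc a)) = (\<Sum>a<k. l p ^ (k - 1))"
      by (intro sum.cong refl) (simp flip: power_add)
    then show ?thesis by simp
  qed
  have "hat d u (pert d M H k 1) p p = real k * hat d u (mm d (mpow d M (k - 1)) H) p p" if "p < d" for p
    using hat_pert_1[OF e that that, of H k] hat_mpow_mm[OF e that that] * by simp
  then show ?thesis
    unfolding tr_hat[OF u] sum_distrib_left by (intro sum.cong refl) auto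
qed

text \<open>The divided difference of \<open>z ^ k\<close> at the points \<open>x\<close>,
  \<open>x\<close>, \<open>y\<close>. The weight \<open>k - 1 - b\<close> counts the ways to split
  the exponent \<open>k - 2 - b\<close> between the two coincident points.\<close>

definition g2 :: "nat \<Rightarrow> real \<Rightarrow> real \<Rightarrow> real" where
  "g2 k x y = (\<Sum>b<k - 1. real (k - 1 - b) * (x ^ (k - 2 - b) * y ^ b))"

lemma g2_Suc: "g2 (Suc k) x y = x * g2 k x y + (\<Sum>a<k. y ^ a * x ^ (k - 1 - a))"
proof (cases k)
  case (Suc m)
  have "x * g2 k x y = (\<Sum>b<m. real (m - b) * (x ^ (m - b) * y ^ b))"
    unfolding g2_def Suc sum_distrib_left
  proof (intro sum.cong)
    fix b assume "b \<in> {..<m}"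
    then have "m - b = Suc (m - Suc b)" by auto
    then show "x * (real (Suc m - 1 - b) * (x ^ (Suc m - 2 - b) * y ^ b)) = real (m - b) * (x ^ (m - b) * y ^ b)"
      by simp
  qed simp
  also have "\<dots> = (\<Sum>b<k. real (m - b) * (x ^ (m - b) * y ^ b))"
    by (simp add: Suc)
  finally have "x * g2 k x y + (\<Sum>a<k. y ^ a * x ^ (k - 1 - a))
      = (\<Sum>b<k. real (m - b) * (x ^ (m - b) * y ^ b) + y ^ b * x ^ (k - 1 - b))"
    by (simp add: sum.distrib)
  also have "\<dots> = g2 (Suc k) x y"
    unfolding g2_def by (intro sum.cong) (auto simp: Suc algebra_simps of_nat_diff)
  finally show ?thesis by simp
qed (simp add: g2_def)

text \<open>A diagonal entry runs through paths \<open>p\<close>, \<open>r\<close>,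
  \<open>p\<close>, which visit \<open>p\<close> twice; hence two nodes of the divided difference
  coincide.\<close>

lemma hat_pert_2:
  assumes e: "eigenbasis d M u l" and "p < d"
  shows "hat d u (pert d M H k 2) p p = (\<Sum>r<d. g2 k (l p) (l r) * (hat d u H p r * hat d u H r p))"
proof (induction k)
  case 0
  then show ?case by (simp add: hat_zero g2_def)
next
  case (Suc k)
  have u: "orthonormal d d u" using e by (simp add: eigenbasis_def)
  have "hat d u (pert d M H (Suc k) 2) p p = l p * hat d u (pert d M H k 2) p p
      + (\<Sum>r<d. hat d u H p r * hat d u (pert d M H k 1) r p)"
    using assms by (simp add: numeral_2_eq_2 hat_add hat_eigen_mm[OF e] hat_mm[OF u, of H])
  also have "\<dots> = (\<Sum>r<d. (l p * g2 k (l p) (l r) + (\<Sum>a<k. l r ^ a * l p ^ (k - 1 - a))) * (hat d u H p r * hat d u H r p))"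
    unfolding Suc.IH sum_distrib_left sum.distrib[symmetric]
    using assms hat_pert_1[OF e] by (intro sum.cong refl) (simp add: algebra_simps)
  finally show ?case by (simp add: g2_Suc)
qed

lemma tr_pert_2:
  assumes e: "eigenbasis d M u l"
  shows "tr d (pert d M H k 2) = (\<Sum>p<d. \<Sum>r<d. g2 k (l p) (l r) * (hat d u H p r * hat d u H r p))"
proof -
  have u: "orthonormal d d u" using e by (simp add: eigenbasis_def)
  show ?thesis unfolding tr_hat[OF u] by (simp add: hat_pert_2[OF e])
qed

text \<open>The bridge between traces of products of powers, which field operations can compute, and
  sums over eigenvalues, which the estimates use.\<close>

lemma tr_two_words:
  assumes e: "eigenbasis d M u l"
  shows "tr d (mm d (mm d (mpow d M a) X) (mm d (mpow d M b) Y))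
       = (\<Sum>p<d. \<Sum>r<d. l p ^ a * l r ^ b * (hat d u X p r * hat d u Y r p))"
proof -
  have u: "orthonormal d d u" using e by (simp add: eigenbasis_def)
  show ?thesis
    unfolding tr_hat[OF u] hat_mm[OF u, of "mm d (mpow d M a) X"]
    by (intro sum.cong refl) (simp add: hat_mpow_mm[OF e])
qed

lemma parseval:
  assumes u: "orthonormal d d u"
  shows "(\<Sum>p<d. (ip d (u p) y)\<^sup>2) = ip d y y"
proof -
  have "ip d y y = (\<Sum>k<d. y k * (\<Sum>p<d. ip d (u p) y * u p k))"
    unfolding ip_def[of d y y] using orthonormal_expand[OF u, of _ y] by (intro sum.cong refl) auto
  also have "\<dots> = (\<Sum>p<d. \<Sum>k<d. y k * (ip d (u p) y * u p k))"
    unfolding sum_distrib_left by (rule sum.swap)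
  also have "\<dots> = (\<Sum>p<d. ip d (u p) y * ip d (u p) y)"
    unfolding ip_def[of d "u _" y] by (simp add: sum_distrib_left sum_distrib_right mult_ac)
  finally show ?thesis by (simp add: power2_eq_square)
qed

lemma eigenvector_ip:
  assumes e: "eigenbasis d M u l" and "p < d" and sym: "\<And>j k. j < d \<Longrightarrow> k < d \<Longrightarrow> M j k = M k j"
  shows "ip d (u p) (\<lambda>j. ip d (M j) y) = l p * ip d (u p) y"
proof -
  have u: "orthonormal d d u" using e by (simp add: eigenbasis_def)
  have Mu: "ip d (M j) (u p) = l p * u p j" if "j < d" for j
  proof -
    have "ip d (M j) (u p) = ip d (u p) (\<lambda>k. \<Sum>i<d. (l i * u i j) * u i k)"
      using e that by (subst ip_commute) (auto simp: ip_def eigenbasis_def intro!: sum.cong)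
    also have "\<dots> = (\<Sum>i<d. (l i * u i j) * ip d (u p) (u i))"
      unfolding ip_sum_right ip_scale_right ..
    also have "\<dots> = (\<Sum>i<d. if p = i then l p * u p j else 0)"
      using u assms by (intro sum.cong refl) (auto simp: orthonormal_def)
    finally show ?thesis using assms by simp
  qed
  have "ip d (u p) (\<lambda>j. ip d (M j) y) = ip d y (\<lambda>j. ip d (M j) (u p))"
    by (rule ip_symmetric_matrix[OF sym])
  also have "\<dots> = ip d y (\<lambda>j. l p * u p j)"
    unfolding ip_def[of d y] using Mu by (intro sum.cong refl) auto
  finally show ?thesis by (simp add: ip_scale_right ip_commute)
qed

lemma opbound_eigen:
  assumes e: "eigenbasis d M u l" and sym: "\<And>j k. j < d \<Longrightarrow> k < d \<Longrightarrow> M j k = M k j"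
    and le: "\<And>p. p < d \<Longrightarrow> \<bar>l p\<bar> \<le> \<mu>" and "0 \<le> \<mu>"
  shows "opbound d M \<mu>"
  unfolding opbound_def
proof (intro conjI allI)
  fix y :: "nat \<Rightarrow> real"
  have u: "orthonormal d d u" using e by (simp add: eigenbasis_def)
  let ?z = "\<lambda>j. ip d (M j) y"
  have "ip d ?z ?z = (\<Sum>p<d. (l p * ip d (u p) y)\<^sup>2)"
    unfolding parseval[OF u, symmetric] by (intro sum.cong refl) (simp add: eigenvector_ip[OF e _ sym])
  also have "\<dots> \<le> (\<Sum>p<d. \<mu>\<^sup>2 * (ip d (u p) y)\<^sup>2)"
    unfolding power_mult_distrib using le \<open>0 \<le> \<mu>\<close> by (intro sum_mono mult_right_mono) (auto simp: abs_le_square_iff[symmetric])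
  also have "\<dots> = \<mu>\<^sup>2 * ip d y y"
    by (simp add: sum_distrib_left[symmetric] parseval[OF u])
  finally have "sqrt (ip d ?z ?z) \<le> \<mu> * sqrt (ip d y y)"
    using \<open>0 \<le> \<mu>\<close> by (metis real_sqrt_le_mono real_sqrt_mult real_sqrt_abs abs_of_nonneg)
  then show "L2_set (\<lambda>j. \<Sum>k<d. M j k * y k) {..<d} \<le> \<mu> * L2_set y {..<d}"
    by (simp add: L2_set_def ip_def power2_eq_square)
qed fact

section \<open>The potential\<close>

text \<open>Here \<sigma> is any upper bound for the norm of the sum of squares, since the program
  knows that norm only up to a constant factor. The last assumption keeps
  \<open>T / \<sigma>\<close> at least \<open>1 / 4\<close> and, with positivity of \<sigma>,
  excludes \<open>n = 0\<close> and \<open>d = 0\<close>.\<close>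

locale matrix_family =
  fixes n d :: nat and A :: "nat \<Rightarrow> nat \<Rightarrow> nat \<Rightarrow> real" and \<sigma> T :: real
  assumes A_sym: "\<And>i j k. i < n \<Longrightarrow> j < d \<Longrightarrow> k < d \<Longrightarrow> A i j k = A i k j"
    and squares_le: "\<And>y. (\<Sum>i<n. ip d (\<lambda>j. ip d (A i j) y) (\<lambda>j. ip d (A i j) y)) \<le> \<sigma> * ip d y y"
    and T_eq: "T = (\<Sum>i<n. \<Sum>j<d. ip d (A i j) (A i j))"
    and sigma_pos: "0 < \<sigma>" and sigma_le: "\<sigma> \<le> 4 * T"
begin

definition comb :: "(nat \<Rightarrow> real) \<Rightarrow> nat \<Rightarrow> nat \<Rightarrow> real" where
  "comb x = (\<lambda>j k. \<Sum>i<n. x i * A i j k)"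

definition Phi :: "nat \<Rightarrow> (nat \<Rightarrow> real) \<Rightarrow> real" where
  "Phi p x = tr d (mpow d (comb x) (2 * p))"

definition sq :: "(nat \<Rightarrow> real) \<Rightarrow> real" where
  "sq x = (\<Sum>i<n. (x i)\<^sup>2) / real n"

definition grad1 :: "nat \<Rightarrow> (nat \<Rightarrow> real) \<Rightarrow> nat \<Rightarrow> real" where
  "grad1 p x i = real (2 * p) * tr d (mm d (mpow d (comb x) (2 * p - 1)) (A i))"

text \<open>Half of the Hessian of \<open>Phi p\<close>. Write \<open>M\<close> for
  \<open>comb x\<close>. Under the trace, the words \<open>M^a A_i M^b A_l M^c\<close> with
  \<open>a + b + c = 2p - 2\<close> depend only on \<open>b\<close>, and \<open>2p - 1 - b\<close>
  of them share the same \<open>b\<close>.\<close>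

definition hess2 :: "nat \<Rightarrow> (nat \<Rightarrow> real) \<Rightarrow> nat \<Rightarrow> nat \<Rightarrow> real" where
  "hess2 p x i l = (\<Sum>b<2 * p - 1. real (2 * p - 1 - b) *
     tr d (mm d (mm d (mpow d (comb x) (2 * p - 2 - b)) (A i)) (mm d (mpow d (comb x) b) (A l))))"

definition pot :: "nat \<Rightarrow> real \<Rightarrow> (nat \<Rightarrow> real) \<Rightarrow> real" where
  "pot p B x = (1 + Phi p x / B) / (1 + sq x) ^ p"

text \<open>Only the numerator is differentiated: along directions orthogonal to \<open>x\<close>
  the denominator is stationary.\<close>

definition gpot :: "nat \<Rightarrow> real \<Rightarrow> (nat \<Rightarrow> real) \<Rightarrow> nat \<Rightarrow> real" where
  "gpot p B x i = grad1 p x i / (B * (1 + sq x) ^ p)"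

text \<open>The subtracted diagonal is the second order decrease that the growing denominator
  guarantees. Of the factor \<open>1 / 4\<close> in \<open>inverse_power_decay\<close>, one half is
  given up when the numerator after the step is compared with the one before, and half of the rest
  pays for the cubic error; \<open>1 / 16\<close> remains.\<close>

definition hpot :: "nat \<Rightarrow> real \<Rightarrow> (nat \<Rightarrow> real) \<Rightarrow> nat \<Rightarrow> nat \<Rightarrow> real" where
  "hpot p B x i l = hess2 p x i l / (B * (1 + sq x) ^ p)
     - (if i = l then real p * (1 + Phi p x / B) / (16 * real n * (1 + sq x) ^ p) else 0)"

definition qform :: "(nat \<Rightarrow> nat \<Rightarrow> real) \<Rightarrow> (nat \<Rightarrow> real) \<Rightarrow> real" where
  "qform G v = (\<Sum>i<n. \<Sum>l<n. v i * G i l * v l)"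

lemma T_pos: "0 < T"
  using sigma_pos sigma_le by linarith

lemma d_pos: "0 < d"
  using T_pos by (cases d) (auto simp: T_eq)

lemma n_pos: "0 < n"
  using T_pos by (cases n) (auto simp: T_eq)

lemma comb_sym: "j < d \<Longrightarrow> k < d \<Longrightarrow> comb x j k = comb x k j"
  unfolding comb_def by (intro sum.cong refl) (auto simp: A_sym)

lemma comb_eigenbasis: "\<exists>u l. eigenbasis d (comb x) u l"
  by (rule spectral_theorem[OF comb_sym])

lemma sq_nonneg: "0 \<le> sq x"
  by (simp add: sq_def sum_nonneg)

lemma comb_step: "comb (\<lambda>i. x i + t * v i) = (\<lambda>j k. comb x j k + t * comb v j k)"
  by (simp add: comb_def algebra_simps sum.distrib sum_distrib_left)

lemma hat_comb: "hat d u (comb v) p s = ip n (\<lambda>i. hat d u (A i) p s) v"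
  unfolding comb_def hat_sum ip_def by (simp add: mult.commute)

lemma hat_comb_sym: "hat d u (comb v) p s = hat d u (comb v) s p"
  by (rule hat_symmetric[OF comb_sym])

lemma Phi_eq: "eigenbasis d (comb x) u l \<Longrightarrow> Phi p x = (\<Sum>j<d. (l j ^ 2) ^ p)"
  by (simp add: Phi_def tr_mpow power_mult)

lemma Phi_nonneg: "0 \<le> Phi p x"
proof -
  obtain u l where "eigenbasis d (comb x) u l" using comb_eigenbasis by blast
  then show ?thesis by (simp add: Phi_eq sum_nonneg)
qed

lemma grad1_sum: "(\<Sum>i<n. v i * grad1 p x i) = tr d (pert d (comb x) (comb v) (2 * p) 1)"
proof -
  obtain u l where e: "eigenbasis d (comb x) u l" using comb_eigenbasis by blast
  have "tr d (mm d P (comb v)) = (\<Sum>i<n. v i * tr d (mm d P (A i)))" for P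
  proof -
  have "tr d (mm d P (comb v)) = (\<Sum>j<d. \<Sum>l<d. \<Sum>i<n. v i * (P j l * A i l j))"
    by (simp add: tr_def mm_def comb_def sum_distrib_left sum_distrib_right mult_ac)
  also have "\<dots> = (\<Sum>j<d. \<Sum>i<n. \<Sum>l<d. v i * (P j l * A i l j))"
    by (rule sum.cong, rule refl, rule sum.swap)
  also have "\<dots> = (\<Sum>i<n. \<Sum>j<d. \<Sum>l<d. v i * (P j l * A i l j))" by (rule sum.swap)
  finally show ?thesis
    by (simp add: tr_def mm_def sum_distrib_left)
  qed
  then show ?thesis
    unfolding tr_pert_1[OF e] grad1_def by (simp add: sum_distrib_left mult_ac)
qed

lemma hess2_eigen:
  assumes e: "eigenbasis d (comb x) u l"
  shows "hess2 p x i m = (\<Sum>j<d. \<Sum>k<d. g2 (2 * p) (l j) (l k) * (hat d u (A i) j k * hat d u (A m) k j))"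
proof -
  let ?f = "\<lambda>b j k. real (2 * p - 1 - b) * (l j ^ (2 * p - 2 - b) * l k ^ b) * (hat d u (A i) j k * hat d u (A m) k j)"
  have "hess2 p x i m = (\<Sum>b<2 * p - 1. \<Sum>j<d. \<Sum>k<d. ?f b j k)"
    unfolding hess2_def tr_two_words[OF e] by (simp add: sum_distrib_left mult_ac)
  also have "\<dots> = (\<Sum>j<d. \<Sum>b<2 * p - 1. \<Sum>k<d. ?f b j k)" by (rule sum.swap)
  also have "\<dots> = (\<Sum>j<d. \<Sum>k<d. \<Sum>b<2 * p - 1. ?f b j k)"
    by (rule sum.cong, rule refl, rule sum.swap)
  finally show ?thesis by (simp add: g2_def sum_distrib_right)
qed

lemma hess2_form: "qform (hess2 p x) v = tr d (pert d (comb x) (comb v) (2 * p) 2)"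
proof -
  obtain u l where e: "eigenbasis d (comb x) u l" using comb_eigenbasis by blast
  let ?f = "\<lambda>i m j k. g2 (2 * p) (l j) (l k) * ((v i * hat d u (A i) j k) * (v m * hat d u (A m) k j))"
  have "qform (hess2 p x) v = (\<Sum>i<n. \<Sum>m<n. \<Sum>j<d. \<Sum>k<d. ?f i m j k)"
    unfolding qform_def hess2_eigen[OF e] by (simp add: sum_distrib_left sum_distrib_right mult_ac)
  also have "\<dots> = (\<Sum>i<n. \<Sum>j<d. \<Sum>m<n. \<Sum>k<d. ?f i m j k)"
    by (rule sum.cong, rule refl, rule sum.swap)
  also have "\<dots> = (\<Sum>j<d. \<Sum>i<n. \<Sum>m<n. \<Sum>k<d. ?f i m j k)" by (rule sum.swap)
  also have "\<dots> = (\<Sum>j<d. \<Sum>i<n. \<Sum>k<d. \<Sum>m<n. ?f i m j k)"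
    by (rule sum.cong, rule refl, rule sum.cong, rule refl, rule sum.swap)
  also have "\<dots> = (\<Sum>j<d. \<Sum>k<d. \<Sum>i<n. \<Sum>m<n. ?f i m j k)"
    by (rule sum.cong, rule refl, rule sum.swap)
  also have "\<dots> = (\<Sum>j<d. \<Sum>k<d. g2 (2 * p) (l j) (l k) * (hat d u (comb v) j k * hat d u (comb v) k j))"
    unfolding hat_comb ip_def sum_product by (intro sum.cong refl) (simp add: sum_distrib_left mult_ac)
  finally show ?thesis by (simp add: tr_pert_2[OF e])
qed

text \<open>By Cauchy-Schwarz over \<open>i\<close>, the squared length of \<open>comb v\<close>
  applied to \<open>y\<close> is at most that of \<open>v\<close> times the sum of the squared
  lengths of the vectors \<open>A i\<close> applied to \<open>y\<close>.\<close>

lemma opbound_comb: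
  assumes "ip n v v \<le> 1"
  shows "opbound d (comb v) (sqrt \<sigma>)"
  unfolding opbound_def
proof (intro conjI allI)
  fix y
  let ?a = "\<lambda>i j. ip d (A i j) y"
  have 1: "(\<Sum>k<d. comb v j k * y k) = (\<Sum>i<n. v i * ?a i j)" for j
    unfolding comb_def ip_def sum_distrib_left sum_distrib_right
    by (subst sum.swap) (simp add: mult_ac)
  have "(\<Sum>j<d. (\<Sum>k<d. comb v j k * y k)\<^sup>2) \<le> (\<Sum>j<d. (\<Sum>i<n. (v i)\<^sup>2) * (\<Sum>i<n. (?a i j)\<^sup>2))"
    unfolding 1 by (intro sum_mono Cauchy_Schwarz_ineq_sum)
  also have "\<dots> = ip n v v * (\<Sum>j<d. \<Sum>i<n. (?a i j)\<^sup>2)"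
    by (simp add: ip_def power2_eq_square sum_distrib_left)
  also have "(\<Sum>j<d. \<Sum>i<n. (?a i j)\<^sup>2) = (\<Sum>i<n. ip d (?a i) (?a i))"
    by (subst sum.swap) (simp add: ip_def[of d "?a _"] power2_eq_square)
  also have "ip n v v * \<dots> \<le> 1 * (\<sigma> * ip d y y)"
    using assms squares_le[of y] by (intro mult_mono) (auto intro!: sum_nonneg ip_self_nonneg)
  finally have "sqrt (\<Sum>j<d. (\<Sum>k<d. comb v j k * y k)\<^sup>2) \<le> sqrt \<sigma> * sqrt (ip d y y)"
    unfolding real_sqrt_mult[symmetric] mult_1 by (rule real_sqrt_le_mono)
  then show "L2_set (\<lambda>j. \<Sum>k<d. comb v j k * y k) {..<d} \<le> sqrt \<sigma> * L2_set y {..<d}"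
    by (simp add: L2_set_def ip_def power2_eq_square)
qed (use sigma_pos in simp)

lemma opbound_Phi: "\<exists>\<mu>. opbound d (comb x) \<mu> \<and> (\<mu>\<^sup>2) ^ p \<le> Phi p x"
proof -
  obtain u l where e: "eigenbasis d (comb x) u l" using comb_eigenbasis by blast
  define \<mu> where "\<mu> = Max ((\<lambda>j. \<bar>l j\<bar>) ` {..<d})"
  have ne: "(\<lambda>j. \<bar>l j\<bar>) ` {..<d} \<noteq> {}" using d_pos by auto
  have le: "\<bar>l j\<bar> \<le> \<mu>" if "j < d" for j
    unfolding \<mu>_def using that by (intro Max_ge) auto
  have "\<mu> \<in> (\<lambda>j. \<bar>l j\<bar>) ` {..<d}" unfolding \<mu>_def using ne by (intro Max_in) auto
  then obtain j where j: "j < d" "\<mu> = \<bar>l j\<bar>" by auto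
  have "(\<mu>\<^sup>2) ^ p = (l j ^ 2) ^ p" using j by simp
  also have "\<dots> \<le> Phi p x"
    unfolding Phi_eq[OF e] using j by (intro member_le_sum) auto
  finally show ?thesis using opbound_eigen[OF e comb_sym le] j by auto
qed

text \<open>Bernoulli's inequality with \<open>y = \<delta> / (1 + s)\<close>, which is at least
  \<open>\<delta> / 2\<close> for \<open>s \<le> 1\<close>, gives
  \<open>(1 + y) ^ p \<ge> 1 + 2 z\<close> for \<open>z = p \<delta> / 4\<close>; and
  \<open>(1 - z) * (1 + 2 z) \<ge> 1\<close> for \<open>z\<close> this small.\<close>

lemma inverse_power_decay:
  fixes s \<delta> :: real
  assumes "0 \<le> s" "s \<le> 1" "0 \<le> \<delta>" "real p * \<delta> \<le> 1"
  shows "1 / (1 + (s + \<delta>)) ^ p \<le> (1 - real p * \<delta> / 4) / (1 + s) ^ p"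
proof -
  define y where "y = \<delta> / (1 + s)"
  have y: "\<delta> / 2 \<le> y" "0 \<le> y" using assms divide_left_mono[of "1 + s" 2 \<delta>] by (auto simp: y_def)
  have "1 + real p * \<delta> / 2 \<le> 1 + real p * y" using y mult_left_mono[OF y(1), of "real p"] by simp
  also have "\<dots> \<le> (1 + y) ^ p" using y Bernoulli_inequality[of y p] by simp
  finally have b: "1 + real p * \<delta> / 2 \<le> (1 + y) ^ p" .
  define z where "z = real p * \<delta> / 4"
  have z: "0 \<le> z" "z \<le> 1 / 4" using assms by (auto simp: z_def)
  have "z * z \<le> z * (1 / 4)" using z by (intro mult_left_mono) auto
  then have "1 \<le> (1 - z) * (1 + 2 * z)" using z by (simp add: algebra_simps)
  also have "1 + 2 * z \<le> (1 + y) ^ p" using b unfolding z_def by linarith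
  then have "(1 - z) * (1 + 2 * z) \<le> (1 - z) * (1 + y) ^ p" using z by (intro mult_left_mono) auto
  finally have c: "1 \<le> (1 - z) * (1 + y) ^ p" .
  have "1 + (s + \<delta>) = (1 + s) * (1 + y)" using assms by (simp add: y_def field_simps)
  then have eq: "(1 + (s + \<delta>)) ^ p = (1 + s) ^ p * (1 + y) ^ p" by (simp add: power_mult_distrib)
  have pos: "0 < (1 + s) ^ p" "0 < (1 + y) ^ p" using assms y by auto
  have "1 / (1 + y) ^ p \<le> 1 - z" using c pos by (simp only: divide_le_eq if_True)
  then have "1 / (1 + y) ^ p / (1 + s) ^ p \<le> (1 - z) / (1 + s) ^ p"
    using pos by (intro divide_right_mono) auto
  then show ?thesis unfolding eq z_def by (simp add: mult.commute)
qed

text \<open>The trace of the power is a polynomial in \<open>t\<close> whose first three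
  coefficients are the value, the gradient and half the Hessian. Its tail is measured against
  \<open>Phi p x + B\<close>, because \<open>Phi\<close> dominates the power of the norm of
  \<open>comb x\<close> and \<open>B\<close> that of \<open>comb v\<close>. The second claim cuts
  the expansion off after the constant term.\<close>

lemma Phi_step:
  assumes p: "0 < p" and B: "\<sigma> ^ p \<le> B" and v: "ip n v v \<le> 1"
    and t: "0 \<le> t" "8 * real d * real p * t \<le> 1"
  shows "\<bar>Phi p (\<lambda>i. x i + t * v i) - (Phi p x + t * (\<Sum>i<n. v i * grad1 p x i) + t\<^sup>2 * qform (hess2 p x) v)\<bar>
      \<le> real d * (Phi p x + B) * (2 * (2 * real p * t) ^ 3)"
    and "Phi p x - real d * (Phi p x + B) * (4 * real p * t) \<le> Phi p (\<lambda>i. x i + t * v i)"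
proof -
  obtain \<mu> where \<mu>: "opbound d (comb x) \<mu>" "(\<mu>\<^sup>2) ^ p \<le> Phi p x" using opbound_Phi by blast
  note H = opbound_comb[OF v]
  let ?W = "\<lambda>i. t ^ i * tr d (pert d (comb x) (comb v) (2 * p) i)"
  have k: "real (2 * p) * t \<le> 1 / 2"
  proof -
    have "real p * t \<le> real d * (real p * t)"
      using d_pos t mult_right_mono[of 1 "real d" "real p * t"] by simp
    then show ?thesis using t by simp
  qed
  have \<mu>B: "\<mu> ^ (2 * p) + sqrt \<sigma> ^ (2 * p) \<le> Phi p x + B"
    using \<mu>(2) B sigma_pos by (simp add: power_mult)
  have bound: "\<bar>\<Sum>i\<in>{m..2 * p}. ?W i\<bar> \<le> real d * (Phi p x + B) * (2 * (2 * real p * t) ^ m)" for m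
  proof -
    have "\<bar>\<Sum>i\<in>{m..2 * p}. ?W i\<bar> \<le> real d * (\<mu> ^ (2 * p) + sqrt \<sigma> ^ (2 * p)) * (2 * (real (2 * p) * t) ^ m)"
      by (rule pert_tail_bound[OF \<mu>(1) H t(1) k])
    also have "\<dots> \<le> real d * (Phi p x + B) * (2 * (real (2 * p) * t) ^ m)"
      using \<mu>B t by (intro mult_right_mono mult_left_mono) auto
    finally show ?thesis by simp
  qed
  have exp: "Phi p (\<lambda>i. x i + t * v i) = (\<Sum>i\<le>2 * p. ?W i)"
    unfolding Phi_def comb_step tr_mpow_perturb ..
  have W0: "?W 0 = Phi p x" by (simp add: Phi_def pert_0)
  have W1: "?W 1 = t * (\<Sum>i<n. v i * grad1 p x i)" by (simp add: grad1_sum)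
  have W2: "?W 2 = t\<^sup>2 * qform (hess2 p x) v" by (simp add: hess2_form)
  have s1: "{..2 * p} = insert 0 {1..2 * p}" by auto
  have s3: "{..2 * p} = insert 0 (insert 1 (insert 2 {3..2 * p}))" using p by auto
  have "(\<Sum>i\<le>2 * p. ?W i) = ?W 0 + (?W 1 + (?W 2 + (\<Sum>i\<in>{3..2 * p}. ?W i)))"
    unfolding s3 by (subst sum.insert, simp, simp)+ simp
  then have "Phi p (\<lambda>i. x i + t * v i) - (Phi p x + t * (\<Sum>i<n. v i * grad1 p x i) + t\<^sup>2 * qform (hess2 p x) v)
      = (\<Sum>i\<in>{3..2 * p}. ?W i)"
    unfolding exp W0 W1 W2 by linarith
  then show "\<bar>Phi p (\<lambda>i. x i + t * v i) - (Phi p x + t * (\<Sum>i<n. v i * grad1 p x i) + t\<^sup>2 * qform (hess2 p x) v)\<bar>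
      \<le> real d * (Phi p x + B) * (2 * (2 * real p * t) ^ 3)"
    using bound[of 3] by simp
  have "(\<Sum>i\<le>2 * p. ?W i) = ?W 0 + (\<Sum>i\<in>{1..2 * p}. ?W i)"
    unfolding s1 by (subst sum.insert) auto
  then show "Phi p x - real d * (Phi p x + B) * (4 * real p * t) \<le> Phi p (\<lambda>i. x i + t * v i)"
    using bound[of 1] W0 unfolding exp by (simp add: abs_le_iff)
qed

lemma sq_step:
  assumes "ip n x v = 0"
  shows "sq (\<lambda>i. x i + t * v i) = sq x + t\<^sup>2 * ip n v v / real n"
proof -
  have "(\<Sum>i<n. (x i + t * v i)\<^sup>2) = (\<Sum>i<n. (x i)\<^sup>2) + 2 * t * ip n x v + t\<^sup>2 * ip n v v"
    by (simp add: ip_def power2_eq_square algebra_simps sum.distrib sum_distrib_left)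
  then show ?thesis using assms by (simp add: sq_def add_divide_distrib)
qed

lemma qform_hpot:
  "qform (hpot p B x) v = qform (hess2 p x) v / (B * (1 + sq x) ^ p)
     - real p * (1 + Phi p x / B) / (16 * real n * (1 + sq x) ^ p) * ip n v v"
proof -
  define a b where "a = B * (1 + sq x) ^ p" and "b = real p * (1 + Phi p x / B) / (16 * real n * (1 + sq x) ^ p)"
  have "v i * hpot p B x i l * v l = v i * hess2 p x i l * v l / a - (if i = l then b * (v i * v l) else 0)" for i l
    by (simp add: hpot_def a_def b_def algebra_simps)
  then have "qform (hpot p B x) v
      = (\<Sum>i<n. \<Sum>l<n. v i * hess2 p x i l * v l / a) - (\<Sum>i<n. \<Sum>l<n. if i = l then b * (v i * v l) else 0)"
    by (simp add: qform_def sum_subtractf)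
  also have "(\<Sum>i<n. \<Sum>l<n. v i * hess2 p x i l * v l / a) = qform (hess2 p x) v / a"
    by (simp add: qform_def sum_divide_distrib)
  also have "(\<Sum>i<n. \<Sum>l<n. if i = l then b * (v i * v l) else 0) = b * ip n v v"
    by (simp add: ip_def sum_distrib_left)
  finally show ?thesis by (simp add: a_def b_def)
qed

text \<open>The bounds on \<open>ip n v v\<close> are those of a direction of l1 norm 1. The bound
  on \<open>t\<close> is what the cubic error demands: it must stay below
  \<open>p \<delta> / 16\<close>, where \<open>\<delta>\<close> is at least
  \<open>t^2 / n^2\<close>. This amounts to \<open>256 d p^2 n^2 t \<le> 1\<close>, and
  \<open>p \<le> d\<close>.\<close>

lemma pot_step:
  assumes p: "0 < p" "p \<le> d" and B: "\<sigma> ^ p \<le> B" and x: "sq x \<le> 1" "ip n x v = 0"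
    and v: "ip n v v \<le> 1" "1 \<le> real n * ip n v v"
    and t: "0 \<le> t" "t \<le> 1 / (256 * real d ^ 3 * (real n)\<^sup>2)"
  shows "pot p B (\<lambda>i. x i + t * v i)
      \<le> pot p B x + t * (\<Sum>i<n. v i * gpot p B x i) + t\<^sup>2 * qform (hpot p B x) v"
proof -
  define \<delta> where "\<delta> = t\<^sup>2 * ip n v v / real n"
  define N where "N = 1 + Phi p x / B"
  define N' where "N' = 1 + Phi p (\<lambda>i. x i + t * v i) / B"
  define X where "X = t * (\<Sum>i<n. v i * grad1 p x i) + t\<^sup>2 * qform (hess2 p x) v"
  define D where "D = (1 + sq x) ^ p"
  have Bpos: "0 < B" using B sigma_pos by (meson less_le_trans zero_less_power)
  have Dpos: "0 < D" unfolding D_def using sq_nonneg[of x] by auto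
  have N1: "1 \<le> N" unfolding N_def using Phi_nonneg Bpos by auto
  have BN: "Phi p x + B = B * N" using Bpos by (simp add: N_def field_simps)
  have rd: "1 \<le> real d" "1 \<le> real n" "1 \<le> real p" "real p \<le> real d" using d_pos n_pos p by auto
  have "256 * real d ^ 3 * (real n)\<^sup>2 * t \<le> 256 * real d ^ 3 * (real n)\<^sup>2 * (1 / (256 * real d ^ 3 * (real n)\<^sup>2))"
    using t by (intro mult_left_mono) auto
  also have "\<dots> = 1" using rd by simp
  finally have t256: "256 * (real d ^ 3 * (real n)\<^sup>2 * t) \<le> 1" by simp
  have "1 * 1 \<le> real d * (real n)\<^sup>2"
    using rd by (intro mult_mono) auto
  then have dn: "1 \<le> real d * (real n)\<^sup>2" by simp
  have dpp: "real d * (real p)\<^sup>2 * (real n)\<^sup>2 * t \<le> real d ^ 3 * (real n)\<^sup>2 * t"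
  proof -
    have "real d * (real p)\<^sup>2 \<le> real d * (real d)\<^sup>2" using rd by (intro mult_left_mono power_mono) auto
    also have "\<dots> = real d ^ 3" by (simp add: power2_eq_square power3_eq_cube)
    finally show ?thesis using t by (intro mult_right_mono) auto
  qed
  have dp: "real d * real p * t \<le> real d * (real p)\<^sup>2 * (real n)\<^sup>2 * t"
  proof -
    have "1 \<le> real p * (real n)\<^sup>2"
      using rd mult_mono[of 1 "real p" 1 "(real n)\<^sup>2"] by auto
    then have "real d * real p * t * 1 \<le> real d * real p * t * (real p * (real n)\<^sup>2)"
      using t by (intro mult_left_mono) auto
    then show ?thesis by (simp add: power2_eq_square mult_ac)
  qed
  have t8: "8 * real d * real p * t \<le> 1" using t256 dpp dp by (simp add: mult_ac)
  note st = Phi_step[OF p(1) B v(1) t(1) t8, of x]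
  have nv: "1 / real n \<le> ip n v v" using v(2) rd by (simp add: field_simps)
  have \<delta>0: "0 \<le> \<delta>" unfolding \<delta>_def using ip_self_nonneg by simp
  have t1: "t \<le> 1" "real p * t \<le> 1"
  proof -
    have "real p * t \<le> real d * (real p * t)" "t \<le> real p * t"
      using mult_right_mono[of 1 "real d" "real p * t"] mult_right_mono[of 1 "real p" t] rd t by auto
    then show "t \<le> 1" "real p * t \<le> 1" using t8 t(1) by (auto simp: mult_ac)
  qed
  have p\<delta>: "real p * \<delta> \<le> 1"
  proof -
    have "\<delta> \<le> t\<^sup>2 * ip n v v"
      unfolding \<delta>_def using rd ip_self_nonneg[of n v]
        divide_left_mono[of 1 "real n" "t\<^sup>2 * ip n v v"] by simp
    also have "\<dots> \<le> t\<^sup>2 * 1" using v by (intro mult_left_mono) auto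
    also have "\<dots> \<le> t" using t1 t by (simp add: power2_eq_square mult_left_le)
    finally show ?thesis using t1(2) mult_left_mono[of \<delta> t "real p"] by linarith
  qed
  \<comment> \<open>The decay factor of the denominator multiplies the new numerator
    \<open>N'\<close>, so a lower bound for \<open>N'\<close> is needed to express the decrease
    through \<open>N\<close>.\<close>
  have lower: "N / 2 \<le> N'"
  proof -
    have "(Phi p x - real d * (Phi p x + B) * (4 * real p * t)) / B \<le> Phi p (\<lambda>i. x i + t * v i) / B"
      using st(2) Bpos by (intro divide_right_mono) auto
    then have "N - N * (4 * (real d * real p * t)) \<le> N'"
      unfolding BN N'_def using Bpos by (simp add: N_def diff_divide_distrib mult_ac)
    moreover have "N * (4 * (real d * real p * t)) \<le> N * (1 / 2)"
      using t8 N1 by (intro mult_left_mono) auto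
    ultimately show ?thesis by linarith
  qed
  have R: "N' \<le> N + X / B + real d * N * (2 * (2 * real p * t) ^ 3)"
  proof -
    have "Phi p (\<lambda>i. x i + t * v i) \<le> Phi p x + X + B * (real d * N * (2 * (2 * real p * t) ^ 3))"
      using st(1) unfolding BN X_def by (simp add: abs_le_iff mult_ac)
    then have "Phi p (\<lambda>i. x i + t * v i) / B \<le> (Phi p x + X + B * (real d * N * (2 * (2 * real p * t) ^ 3))) / B"
      using Bpos by (intro divide_right_mono) auto
    then show ?thesis using Bpos by (simp add: N'_def N_def add_divide_distrib)
  qed
  have tail: "real d * N * (2 * (2 * real p * t) ^ 3) \<le> N * (real p * \<delta> / 16)"
  proof -
    have "t\<^sup>2 / (real n)\<^sup>2 \<le> \<delta>"
    proof -
      have "t\<^sup>2 * (1 / real n) / real n \<le> t\<^sup>2 * ip n v v / real n"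
        using nv by (intro divide_right_mono mult_left_mono) auto
      then show ?thesis unfolding \<delta>_def by (simp add: power2_eq_square)
    qed
    from mult_left_mono[OF this, of "real p"]
    have "real p * (t\<^sup>2 / (real n)\<^sup>2) / 16 \<le> real p * \<delta> / 16" by simp
    moreover have "16 * real d * real p ^ 3 * t ^ 3 \<le> real p * (t\<^sup>2 / (real n)\<^sup>2) / 16"
    proof -
      have "256 * (real d * (real p)\<^sup>2 * (real n)\<^sup>2 * t) * (real p * t\<^sup>2) \<le> 1 * (real p * t\<^sup>2)"
        using t256 dpp by (intro mult_right_mono) auto
      then show ?thesis using rd by (simp add: field_simps power2_eq_square power3_eq_cube)
    qed
    ultimately have "16 * real d * real p ^ 3 * t ^ 3 \<le> real p * \<delta> / 16" by linarith
    then have "N * (16 * real d * real p ^ 3 * t ^ 3) \<le> N * (real p * \<delta> / 16)"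
      using N1 by (intro mult_left_mono) auto
    then show ?thesis by (simp add: power_mult_distrib mult_ac)
  qed
  have "pot p B (\<lambda>i. x i + t * v i) = N' * (1 / (1 + (sq x + \<delta>)) ^ p)"
    by (simp add: pot_def N'_def sq_step[OF x(2)] \<delta>_def)
  also have "\<dots> \<le> N' * ((1 - real p * \<delta> / 4) / D)"
    unfolding D_def using lower N1 inverse_power_decay[OF sq_nonneg x(1) \<delta>0 p\<delta>]
    by (intro mult_left_mono) auto
  also have "\<dots> = (N' - N' * (real p * \<delta> / 4)) / D" by (simp add: algebra_simps)
  also have "\<dots> \<le> (N + X / B - N * (real p * \<delta> / 16)) / D"
  proof -
    have "N / 2 * (real p * \<delta> / 4) \<le> N' * (real p * \<delta> / 4)"
      using lower \<delta>0 by (intro mult_right_mono) auto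
    then have "N' - N' * (real p * \<delta> / 4) \<le> N + X / B - N * (real p * \<delta> / 16)"
      using R tail by (simp add: algebra_simps)
    then show ?thesis using Dpos by (intro divide_right_mono) auto
  qed
  also have "\<dots> = pot p B x + t * (\<Sum>i<n. v i * gpot p B x i) + t\<^sup>2 * qform (hpot p B x) v"
  proof -
    have g: "(\<Sum>i<n. v i * gpot p B x i) = (\<Sum>i<n. v i * grad1 p x i) / (B * D)"
      by (simp add: gpot_def D_def sum_divide_distrib)
    have "N * (real p * \<delta> / 16) / D = t\<^sup>2 * (real p * N / (16 * real n * D) * ip n v v)"
      by (simp add: \<delta>_def mult_ac)
    then show ?thesis
      unfolding g qform_hpot pot_def D_def[symmetric] N_def[symmetric] X_def
      by (simp add: add_divide_distrib diff_divide_distrib algebra_simps)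
  qed
  finally show ?thesis .
qed

end

section \<open>A direction of negative curvature\<close>

lemma ip_self_eq_sum: "ip d f f = (\<Sum>i<d. (f i)\<^sup>2)"
  by (simp add: ip_def power2_eq_square)

lemma g2_bound:
  assumes "even k" "2 \<le> k"
  shows "\<bar>g2 k x y\<bar> \<le> real k * (\<Sum>b<k - 1. \<bar>x\<bar> ^ (k - 2 - b) * \<bar>y\<bar> ^ b)"
proof -
  have "\<bar>g2 k x y\<bar> \<le> (\<Sum>b<k - 1. \<bar>real (k - 1 - b) * (x ^ (k - 2 - b) * y ^ b)\<bar>)"
    unfolding g2_def by (rule sum_abs)
  also have "\<dots> \<le> (\<Sum>b<k - 1. real k * (\<bar>x\<bar> ^ (k - 2 - b) * \<bar>y\<bar> ^ b))"
    by (intro sum_mono) (auto simp: abs_mult power_abs intro!: mult_right_mono)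
  finally show ?thesis by (simp add: sum_distrib_left)
qed

text \<open>There are fewer than \<open>2 p\<close> monomials, each of weight at most
  \<open>2 p\<close> and of size at most the sum of the two pure powers.\<close>

lemma g2_bound_coarse:
  assumes "0 < p"
  shows "\<bar>g2 (2 * p) x y\<bar> \<le> 4 * (real p)\<^sup>2 * ((x\<^sup>2) ^ (p - 1) + (y\<^sup>2) ^ (p - 1))"
proof -
  let ?k = "2 * p"
  have e: "\<bar>z\<bar> ^ (?k - 2) = (z\<^sup>2) ^ (p - 1)" for z :: real
  proof -
    have "?k - 2 = 2 * (p - 1)" using assms by simp
    then show ?thesis by (simp only: power_mult power2_abs)
  qed
  have "(\<Sum>b<?k - 1. \<bar>x\<bar> ^ (?k - 2 - b) * \<bar>y\<bar> ^ b) \<le> (\<Sum>b<?k - 1. \<bar>x\<bar> ^ (?k - 2) + \<bar>y\<bar> ^ (?k - 2))"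
    by (intro sum_mono power_mult_power_le) auto
  also have "\<dots> \<le> real ?k * ((x\<^sup>2) ^ (p - 1) + (y\<^sup>2) ^ (p - 1))"
    unfolding e by (simp add: mult_right_mono)
  finally have m1: "real ?k * (\<Sum>b<?k - 1. \<bar>x\<bar> ^ (?k - 2 - b) * \<bar>y\<bar> ^ b)
      \<le> real ?k * (real ?k * ((x\<^sup>2) ^ (p - 1) + (y\<^sup>2) ^ (p - 1)))"
    by (intro mult_left_mono) auto
  have "\<bar>g2 ?k x y\<bar> \<le> real ?k * (\<Sum>b<?k - 1. \<bar>x\<bar> ^ (?k - 2 - b) * \<bar>y\<bar> ^ b)"
    using assms by (intro g2_bound) auto
  also have "\<dots> \<le> real ?k * (real ?k * ((x\<^sup>2) ^ (p - 1) + (y\<^sup>2) ^ (p - 1)))" by (rule m1)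
  also have "\<dots> = 4 * (real p)\<^sup>2 * ((x\<^sup>2) ^ (p - 1) + (y\<^sup>2) ^ (p - 1))"
    by (simp add: power2_eq_square)
  finally show ?thesis .
qed

text \<open>If the larger base is at least twice the threshold, every exchange of a factor
  \<open>a\<close> for \<open>m\<close> costs a factor 2 and the sum is geometric; otherwise all
  terms are at most \<open>(2 \<theta>) ^ (k - 2)\<close>.\<close>

lemma mixed_powers_le:
  fixes a m \<theta> :: real
  assumes "0 \<le> m" "m \<le> a" "m \<le> \<theta>"
  shows "(\<Sum>b<k - 1. a ^ (k - 2 - b) * m ^ b) \<le> 2 * a ^ (k - 2) + real k * (2 * \<theta>) ^ (k - 2)"
proof (cases "2 * \<theta> \<le> a")
  case True
  have "a ^ (k - 2 - b) * m ^ b \<le> a ^ (k - 2) * (1 / 2) ^ b" if "b < k - 1" for b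
  proof -
    have "m ^ b \<le> (a / 2) ^ b" using assms True by (intro power_mono) auto
    then have "a ^ (k - 2 - b) * m ^ b \<le> a ^ (k - 2 - b) * (a / 2) ^ b"
      using assms by (intro mult_left_mono) auto
    also have "\<dots> = a ^ (k - 2 - b + b) * (1 / 2) ^ b"
      by (simp add: power_add power_divide)
    finally show ?thesis using that by simp
  qed
  then have "(\<Sum>b<k - 1. a ^ (k - 2 - b) * m ^ b) \<le> (\<Sum>b<k - 1. a ^ (k - 2) * (1 / 2) ^ b)"
    by (intro sum_mono) auto
  also have "\<dots> = a ^ (k - 2) * (\<Sum>b<k - 1. (1 / 2) ^ b)" by (simp add: sum_distrib_left)
  also have "\<dots> \<le> a ^ (k - 2) * 2"
    using assms by (intro mult_left_mono) (auto simp: geometric_sum)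
  finally show ?thesis using assms by (simp add: add_increasing2)
next
  case False
  have "a ^ (k - 2 - b) * m ^ b \<le> (2 * \<theta>) ^ (k - 2)" if "b < k - 1" for b
  proof -
    have "a ^ (k - 2 - b) * m ^ b \<le> (2 * \<theta>) ^ (k - 2 - b) * (2 * \<theta>) ^ b"
      using assms False by (intro mult_mono power_mono) auto
    also have "\<dots> = (2 * \<theta>) ^ (k - 2 - b + b)" by (simp only: power_add)
    also have "k - 2 - b + b = k - 2" using that by simp
    finally show ?thesis .
  qed
  then have "(\<Sum>b<k - 1. a ^ (k - 2 - b) * m ^ b) \<le> (\<Sum>b<k - 1. (2 * \<theta>) ^ (k - 2))"
    by (intro sum_mono) auto
  also have "\<dots> \<le> real k * (2 * \<theta>) ^ (k - 2)"
    using assms by (auto intro!: mult_right_mono)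
  finally show ?thesis using assms by (simp add: add_increasing)
qed

text \<open>Here one factor \<open>p\<close> is saved over the coarse bound: when one of the two
  eigenvalues is below the threshold, the mixed monomials together amount to a constant multiple of
  the pure powers, up to a term that depends only on the threshold.\<close>

lemma g2_bound_fine:
  assumes "0 < p" "0 \<le> \<theta>" "\<bar>x\<bar> \<le> \<theta> \<or> \<bar>y\<bar> \<le> \<theta>"
  shows "\<bar>g2 (2 * p) x y\<bar> \<le> 4 * real p * ((x\<^sup>2) ^ (p - 1) + (y\<^sup>2) ^ (p - 1)) + 4 * (real p)\<^sup>2 * (4 * \<theta>\<^sup>2) ^ (p - 1)"
proof -
  let ?k = "2 * p"
  have k: "?k - 2 = 2 * (p - 1)" using assms by simp
  have e: "\<bar>z\<bar> ^ (?k - 2) = (z\<^sup>2) ^ (p - 1)" for z :: real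
    by (simp only: k power_mult power2_abs)
  have e2: "(2 * \<theta>) ^ (?k - 2) = (4 * \<theta>\<^sup>2) ^ (p - 1)"
    by (simp only: k power_mult) (simp add: power2_eq_square)
  \<comment> \<open>Reversing the order of summation exchanges the roles of the two eigenvalues, so
    the smaller one can always be taken as \<open>m\<close> in
    \<open>mixed_powers_le\<close>.\<close>
  have sw: "(\<Sum>b<?k - 1. \<bar>x\<bar> ^ (?k - 2 - b) * \<bar>y\<bar> ^ b) = (\<Sum>b<?k - 1. \<bar>y\<bar> ^ (?k - 2 - b) * \<bar>x\<bar> ^ b)"
  proof -
    have "(\<Sum>b<?k - 1. \<bar>x\<bar> ^ (?k - 2 - b) * \<bar>y\<bar> ^ b)
        = (\<Sum>b<?k - 1. \<bar>x\<bar> ^ (?k - 2 - (?k - 1 - Suc b)) * \<bar>y\<bar> ^ (?k - 1 - Suc b))"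
      by (rule sum.nat_diff_reindex[symmetric])
    also have "\<dots> = (\<Sum>b<?k - 1. \<bar>y\<bar> ^ (?k - 2 - b) * \<bar>x\<bar> ^ b)"
    proof (intro sum.cong refl)
      fix b assume "b \<in> {..<?k - 1}"
      then have "?k - 2 - (?k - 1 - Suc b) = b" "?k - 1 - Suc b = ?k - 2 - b" by auto
      then show "\<bar>x\<bar> ^ (?k - 2 - (?k - 1 - Suc b)) * \<bar>y\<bar> ^ (?k - 1 - Suc b) = \<bar>y\<bar> ^ (?k - 2 - b) * \<bar>x\<bar> ^ b"
        by (simp only: mult.commute)
    qed
    finally show ?thesis .
  qed
  have "(\<Sum>b<?k - 1. \<bar>x\<bar> ^ (?k - 2 - b) * \<bar>y\<bar> ^ b)
      \<le> 2 * ((x\<^sup>2) ^ (p - 1) + (y\<^sup>2) ^ (p - 1)) + real ?k * (4 * \<theta>\<^sup>2) ^ (p - 1)"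
  proof (cases "\<bar>y\<bar> \<le> \<bar>x\<bar>")
    case True
    then have "(\<Sum>b<?k - 1. \<bar>x\<bar> ^ (?k - 2 - b) * \<bar>y\<bar> ^ b) \<le> 2 * (x\<^sup>2) ^ (p - 1) + real ?k * (4 * \<theta>\<^sup>2) ^ (p - 1)"
      using mixed_powers_le[of "\<bar>y\<bar>" "\<bar>x\<bar>" \<theta> ?k] assms unfolding e e2 by auto
    also have "\<dots> \<le> 2 * ((x\<^sup>2) ^ (p - 1) + (y\<^sup>2) ^ (p - 1)) + real ?k * (4 * \<theta>\<^sup>2) ^ (p - 1)"
      by simp
    finally show ?thesis .
  next
    case False
    then have "(\<Sum>b<?k - 1. \<bar>x\<bar> ^ (?k - 2 - b) * \<bar>y\<bar> ^ b) \<le> 2 * (y\<^sup>2) ^ (p - 1) + real ?k * (4 * \<theta>\<^sup>2) ^ (p - 1)"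
      using mixed_powers_le[of "\<bar>x\<bar>" "\<bar>y\<bar>" \<theta> ?k] assms unfolding sw e e2 by auto
    also have "\<dots> \<le> 2 * ((x\<^sup>2) ^ (p - 1) + (y\<^sup>2) ^ (p - 1)) + real ?k * (4 * \<theta>\<^sup>2) ^ (p - 1)"
      by simp
    finally show ?thesis .
  qed
  then have m1: "real ?k * (\<Sum>b<?k - 1. \<bar>x\<bar> ^ (?k - 2 - b) * \<bar>y\<bar> ^ b)
      \<le> real ?k * (2 * ((x\<^sup>2) ^ (p - 1) + (y\<^sup>2) ^ (p - 1)) + real ?k * (4 * \<theta>\<^sup>2) ^ (p - 1))"
    by (intro mult_left_mono) auto
  have "\<bar>g2 ?k x y\<bar> \<le> real ?k * (\<Sum>b<?k - 1. \<bar>x\<bar> ^ (?k - 2 - b) * \<bar>y\<bar> ^ b)"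
    using assms by (intro g2_bound) auto
  also have "\<dots> \<le> real ?k * (2 * ((x\<^sup>2) ^ (p - 1) + (y\<^sup>2) ^ (p - 1)) + real ?k * (4 * \<theta>\<^sup>2) ^ (p - 1))" by (rule m1)
  also have "\<dots> = 4 * real p * ((x\<^sup>2) ^ (p - 1) + (y\<^sup>2) ^ (p - 1)) + 4 * (real p)\<^sup>2 * (4 * \<theta>\<^sup>2) ^ (p - 1)"
    by (simp add: power2_eq_square algebra_simps)
  finally show ?thesis .
qed

section \<open>Traces of the Hessian over orthonormal families\<close>

context matrix_family
begin

text \<open>In the basis \<open>u\<close>, row sums are the diagonal entries of the sum of squares,
  hence at most \<sigma>, and the total is \<open>T\<close>. These are the only facts about the
  family that the averaged Hessian needs.\<close>

definition weight2 :: "(nat \<Rightarrow> nat \<Rightarrow> real) \<Rightarrow> nat \<Rightarrow> nat \<Rightarrow> real" where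
  "weight2 u j k = (\<Sum>i<n. (hat d u (A i) j k)\<^sup>2)"

lemma hat_A_ip: "hat d u (A i) j k = ip d (u j) (\<lambda>m. ip d (A i m) (u k))"
  by (simp add: hat_def ip_def sum_distrib_left mult_ac)

lemma weight2_sym: "weight2 u j k = weight2 u k j"
  unfolding weight2_def by (intro sum.cong refl) (use hat_symmetric[OF A_sym] in auto)

lemma weight2_row_eq:
  assumes u: "orthonormal d d u"
  shows "(\<Sum>k<d. weight2 u k j) = (\<Sum>i<n. ip d (\<lambda>m. ip d (A i m) (u j)) (\<lambda>m. ip d (A i m) (u j)))"
  unfolding weight2_def hat_A_ip by (subst sum.swap) (simp add: parseval[OF u])

lemma weight2_row_le:
  assumes u: "orthonormal d d u" and "j < d"
  shows "(\<Sum>k<d. weight2 u k j) \<le> \<sigma>"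
proof -
  have "ip d (u j) (u j) = 1" using assms by (simp add: orthonormal_def)
  then show ?thesis using squares_le[of "u j"] by (simp add: weight2_row_eq[OF u])
qed

lemma weight2_total:
  assumes u: "orthonormal d d u"
  shows "(\<Sum>j<d. \<Sum>k<d. weight2 u k j) = T"
proof -
  have "(\<Sum>j<d. \<Sum>k<d. weight2 u k j) = (\<Sum>j<d. \<Sum>i<n. \<Sum>m<d. (ip d (A i m) (u j))\<^sup>2)"
    by (simp only: weight2_row_eq[OF u] ip_self_eq_sum)
  also have "\<dots> = (\<Sum>i<n. \<Sum>j<d. \<Sum>m<d. (ip d (A i m) (u j))\<^sup>2)" by (rule sum.swap)
  also have "\<dots> = (\<Sum>i<n. \<Sum>m<d. \<Sum>j<d. (ip d (A i m) (u j))\<^sup>2)"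
    by (rule sum.cong, rule refl, rule sum.swap)
  also have "\<dots> = T"
    unfolding T_eq ip_commute[of d "A _ _" "u _"] by (simp add: parseval[OF u])
  finally show ?thesis .
qed

lemma weight2_nonneg: "0 \<le> weight2 u j k"
  by (simp add: weight2_def sum_nonneg)

text \<open>An entry of \<open>comb v\<close> in the eigenbasis is a linear functional of
  \<open>v\<close>, so Bessel's inequality bounds its squares, summed over the orthonormal
  \<open>w\<close>, by \<open>weight2\<close>. Entries that vanish for all \<open>w m\<close>
  contribute nothing, and \<open>g2\<close> has to be controlled only at the others.\<close>

lemma pert_trace_sum_le:
  assumes e: "eigenbasis d (comb x) u l" and w: "orthonormal n r w" and c: "0 \<le> c" "0 \<le> h"
    and g: "\<And>j k. j < d \<Longrightarrow> k < d \<Longrightarrow> (\<forall>m<r. hat d u (comb (w m)) j k = 0) \<or>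
       \<bar>g2 (2 * p) (l j) (l k)\<bar> \<le> c * ((l j ^ 2) ^ (p - 1) + (l k ^ 2) ^ (p - 1)) + h"
  shows "(\<Sum>m<r. qform (hess2 p x) (w m))
       \<le> 2 * c * (\<Sum>j<d. (l j ^ 2) ^ (p - 1) * (\<Sum>k<d. weight2 u k j)) + h * T"
proof -
  have u: "orthonormal d d u" using e by (simp add: eigenbasis_def)
  let ?q = "\<lambda>j. (l j ^ 2) ^ (p - 1)" and ?H = "\<lambda>m j k. hat d u (comb (w m)) j k"
  have "(\<Sum>m<r. qform (hess2 p x) (w m)) = (\<Sum>m<r. \<Sum>j<d. \<Sum>k<d. g2 (2 * p) (l j) (l k) * (?H m j k)\<^sup>2)"
    unfolding hess2_form tr_pert_2[OF e] power2_eq_square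
    by (intro sum.cong refl) (metis hat_comb_sym)
  also have "\<dots> = (\<Sum>j<d. \<Sum>m<r. \<Sum>k<d. g2 (2 * p) (l j) (l k) * (?H m j k)\<^sup>2)" by (rule sum.swap)
  also have "\<dots> = (\<Sum>j<d. \<Sum>k<d. \<Sum>m<r. g2 (2 * p) (l j) (l k) * (?H m j k)\<^sup>2)"
    by (rule sum.cong, rule refl, rule sum.swap)
  also have "\<dots> \<le> (\<Sum>j<d. \<Sum>k<d. (c * (?q j + ?q k) + h) * weight2 u k j)"
  proof (intro sum_mono)
    fix j k assume jk: "j \<in> {..<d}" "k \<in> {..<d}"
    have b: "(\<Sum>m<r. (?H m j k)\<^sup>2) \<le> weight2 u k j"
      using bessel[OF w, of "\<lambda>i. hat d u (A i) j k"]
      unfolding weight2_sym[of u k j] by (simp add: hat_comb weight2_def ip_def[of n "\<lambda>i. hat d u (A i) j k" "\<lambda>i. hat d u (A i) j k"] power2_eq_square)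
    have K: "0 \<le> c * (?q j + ?q k) + h" using c by simp
    show "(\<Sum>m<r. g2 (2 * p) (l j) (l k) * (?H m j k)\<^sup>2) \<le> (c * (?q j + ?q k) + h) * weight2 u k j"
    proof (cases "\<forall>m<r. ?H m j k = 0")
      case True
      then show ?thesis using K weight2_nonneg by simp
    next
      case False
      then have "g2 (2 * p) (l j) (l k) \<le> c * (?q j + ?q k) + h" using g[of j k] jk by auto
      then have "(\<Sum>m<r. g2 (2 * p) (l j) (l k) * (?H m j k)\<^sup>2) \<le> (\<Sum>m<r. (c * (?q j + ?q k) + h) * (?H m j k)\<^sup>2)"
        by (intro sum_mono mult_right_mono) auto
      also have "\<dots> \<le> (c * (?q j + ?q k) + h) * weight2 u k j"
        unfolding sum_distrib_left[symmetric] using b K by (intro mult_left_mono) auto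
      finally show ?thesis .
    qed
  qed
  also have "\<dots> = (\<Sum>j<d. \<Sum>k<d. c * (?q j * weight2 u k j)) + (\<Sum>j<d. \<Sum>k<d. c * (?q k * weight2 u k j))
      + (\<Sum>j<d. \<Sum>k<d. h * weight2 u k j)"
    by (simp add: algebra_simps sum.distrib)
  also have "(\<Sum>j<d. \<Sum>k<d. c * (?q k * weight2 u k j)) = (\<Sum>j<d. \<Sum>k<d. c * (?q j * weight2 u k j))"
    by (subst sum.swap) (simp add: weight2_sym)
  also have "(\<Sum>j<d. \<Sum>k<d. h * weight2 u k j) = h * T"
    by (simp add: weight2_total[OF u, symmetric] sum_distrib_left)
  finally show ?thesis by (simp add: sum_distrib_left mult.assoc)
qed

text \<open>For a squared eigenvalue \<open>a\<close> and its row weight \<open>y\<close>,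
  \<open>a^(p-1) * (K y) \<le> a^p + (K y)^p\<close>. Replacing all but one factor \<open>y\<close>
  of the last power by \<sigma> and summing produces \<open>T / \<sigma>\<close> instead of the
  dimension.\<close>

lemma weighted_moment_le:
  assumes e: "eigenbasis d (comb x) u l" and p: "0 < p" and K: "0 \<le> K"
  shows "K * (\<Sum>j<d. (l j ^ 2) ^ (p - 1) * (\<Sum>k<d. weight2 u k j)) \<le> Phi p x + (K * \<sigma>) ^ p * (T / \<sigma>)"
proof -
  have u: "orthonormal d d u" using e by (simp add: eigenbasis_def)
  define y where "y = (\<lambda>j. \<Sum>k<d. weight2 u k j)"
  have y: "0 \<le> y j" for j unfolding y_def by (intro sum_nonneg weight2_nonneg)
  have "K * ((l j ^ 2) ^ (p - 1) * y j) \<le> (l j ^ 2) ^ p + (K * \<sigma>) ^ p / \<sigma> * y j" if "j < d" for j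
  proof -
    have y\<sigma>: "y j \<le> \<sigma>" unfolding y_def using weight2_row_le[OF u that] .
    have "(l j ^ 2) ^ (p - 1) * (K * y j) ^ 1 \<le> (l j ^ 2) ^ p + (K * y j) ^ p"
      using p y K by (intro power_mult_power_le) auto
    also have "(K * y j) ^ p = (K * y j) ^ (p - 1) * (K * y j)"
      using p by (metis power_minus_mult)
    also have "\<dots> \<le> (K * \<sigma>) ^ (p - 1) * (K * y j)"
      using y y\<sigma> K by (intro mult_right_mono power_mono mult_left_mono) auto
    also have "\<dots> = (K * \<sigma>) ^ p / \<sigma> * y j"
      using p sigma_pos by (cases p) auto
    finally show ?thesis by (simp add: mult_ac)
  qed
  then have "(\<Sum>j<d. K * ((l j ^ 2) ^ (p - 1) * y j)) \<le> (\<Sum>j<d. (l j ^ 2) ^ p + (K * \<sigma>) ^ p / \<sigma> * y j)"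
    by (intro sum_mono) auto
  also have "\<dots> = Phi p x + (K * \<sigma>) ^ p / \<sigma> * T"
    unfolding sum.distrib sum_distrib_left[symmetric] Phi_eq[OF e] y_def weight2_total[OF u] ..
  finally show ?thesis by (simp add: y_def sum_distrib_left)
qed


text \<open>More than \<open>n / 4\<close> unit vectors each collect the diagonal loss
  \<open>p N / (16 n D)\<close>, in total more than \<open>p N / (64 D)\<close>; this is the origin
  of the factor \<open>1 / 64\<close> in the hypothesis.\<close>

lemma hpot_trace_neg:
  assumes w: "orthonormal n r w" and r: "n < 4 * r" and p: "0 < p" and B: "0 < B"
    and le: "(\<Sum>m<r. qform (hess2 p x) (w m)) \<le> real p / 64 * (B + Phi p x)"
  shows "(\<Sum>m<r. qform (hpot p B x) (w m)) < 0"
proof -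
  define N D where "N = 1 + Phi p x / B" and "D = (1 + sq x) ^ p"
  have D: "0 < D" unfolding D_def using sq_nonneg[of x] by simp
  have N: "1 \<le> N" unfolding N_def using Phi_nonneg B by simp
  have "(\<Sum>m<r. qform (hpot p B x) (w m))
      = (\<Sum>m<r. qform (hess2 p x) (w m) / (B * D) - real p * N / (16 * real n * D))"
    unfolding qform_hpot D_def[symmetric] N_def[symmetric]
    using w by (intro sum.cong refl) (simp add: orthonormal_def)
  also have "\<dots> = (\<Sum>m<r. qform (hess2 p x) (w m)) / (B * D) - real r * (real p * N / (16 * real n * D))"
    by (simp add: sum_subtractf sum_divide_distrib)
  also have "\<dots> < 0"
  proof -
    have "(\<Sum>m<r. qform (hess2 p x) (w m)) / (B * D) \<le> (real p / 64 * (B + Phi p x)) / (B * D)"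
      using le B D by (intro divide_right_mono) auto
    also have "B + Phi p x = B * N" using B by (simp add: N_def field_simps)
    also have "real p / 64 * (B * N) / (B * D) = (real p * N / (16 * D)) * (1 / 4)"
      using B by simp
    also have "\<dots> < (real p * N / (16 * D)) * (real r / real n)"
      using r p N D n_pos by (intro mult_strict_left_mono) (auto simp: field_simps)
    also have "\<dots> = real r * (real p * N / (16 * real n * D))" by (simp add: mult_ac)
    finally show ?thesis by simp
  qed
  finally show ?thesis .
qed

text \<open>The coarse bound yields the factor \<open>8 q^2 = q / 64 * (512 q)\<close>, so
  \<open>weighted_moment_le\<close> is applied with \<open>K = 512 q\<close>, and its error term is
  \<open>Bq\<close>.\<close>

definition Bq :: "nat \<Rightarrow> real" where
  "Bq q = (512 * real q * \<sigma>) ^ q * (T / \<sigma>)"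

text \<open>With the threshold \<open>16384 q \<sigma>\<close> for squared eigenvalues, the fine
  bound contains powers of \<open>4 * 16384 q \<sigma> = 65536 q \<sigma>\<close>; doubling this
  base absorbs an extra factor \<open>d \<le> 2 ^ (d - 1)\<close>.\<close>

definition Bd :: "nat \<Rightarrow> real" where
  "Bd q = (131072 * real q * \<sigma>) ^ d * (T / \<sigma>)"

definition Psi :: "nat \<Rightarrow> (nat \<Rightarrow> real) \<Rightarrow> real" where
  "Psi q x = pot q (Bq q) x + pot d (Bd q) x"

definition Hess :: "nat \<Rightarrow> (nat \<Rightarrow> real) \<Rightarrow> nat \<Rightarrow> nat \<Rightarrow> real" where
  "Hess q x i l = hpot q (Bq q) x i l + hpot d (Bd q) x i l"

lemma sigma_le_power:
  assumes "4 \<le> K" "0 < p"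
  shows "\<sigma> ^ p \<le> (K * \<sigma>) ^ p * (T / \<sigma>)"
proof -
  have "1 \<le> 4 * (T / \<sigma>)" using sigma_le sigma_pos by (simp add: field_simps)
  also have "\<dots> \<le> K ^ p * (T / \<sigma>)"
  proof (rule mult_right_mono)
    have "4 \<le> K ^ 1" using assms by simp
    also have "\<dots> \<le> K ^ p" using assms by (intro power_increasing) auto
    finally show "4 \<le> K ^ p" .
  qed (use T_pos sigma_pos in simp)
  finally have "\<sigma> ^ p * 1 \<le> \<sigma> ^ p * (K ^ p * (T / \<sigma>))"
    using sigma_pos by (intro mult_left_mono) auto
  then show ?thesis by (simp add: power_mult_distrib mult_ac)
qed

lemma Bq_ge: "0 < q \<Longrightarrow> \<sigma> ^ q \<le> Bq q"
  unfolding Bq_def by (rule sigma_le_power) auto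

lemma Bd_ge: "0 < q \<Longrightarrow> \<sigma> ^ d \<le> Bd q"
  unfolding Bd_def using d_pos by (intro sigma_le_power) auto

lemma Bq_pos: "0 < q \<Longrightarrow> 0 < Bq q" and Bd_pos: "0 < q \<Longrightarrow> 0 < Bd q"
  using sigma_pos T_pos by (auto simp: Bq_def Bd_def)

lemma pot_nonneg: "0 < B \<Longrightarrow> 0 \<le> pot p B x"
  using Phi_nonneg sq_nonneg[of x] by (auto simp: pot_def intro!: divide_nonneg_nonneg add_nonneg_nonneg)

lemma Phi_le_of_pot:
  assumes "pot p B x \<le> 2" "sq x \<le> 1" "0 < B"
  shows "Phi p x \<le> 2 * 2 ^ p * B"
proof -
  have D: "0 < (1 + sq x) ^ p" using sq_nonneg[of x] by simp
  then have "1 + Phi p x / B \<le> 2 * (1 + sq x) ^ p"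
    using assms(1) unfolding pot_def by (simp add: divide_le_eq)
  also have "(1 + sq x) ^ p \<le> 2 ^ p" using assms sq_nonneg[of x] by (intro power_mono) auto
  finally have "Phi p x / B \<le> 2 * 2 ^ p" by simp
  then show ?thesis using assms by (simp add: divide_le_eq)
qed

text \<open>Markov's inequality for the power sum: the count times
  \<open>(16384 q \<sigma>) ^ q\<close> is at most
  \<open>2 * sqrt n * (2048 q \<sigma>) ^ q\<close>. The threshold is 8 times the base on the right,
  so the count is at most \<open>sqrt n / 4\<close> even for \<open>q = 1\<close>. Its square, the
  number of entries in the block, is thus at most \<open>n / 16\<close>.\<close>

lemma large_eigenvalues_few:
  assumes e: "eigenbasis d (comb x) u l" and q: "0 < q" "T \<le> sqrt (real n) * \<sigma> * 2 ^ q"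
    and Phi: "Phi q x \<le> 2 * 2 ^ q * Bq q"
  shows "16 * (card {j. j < d \<and> 16384 * real q * \<sigma> < l j ^ 2})\<^sup>2 \<le> n"
proof -
  let ?J = "{j. j < d \<and> 16384 * real q * \<sigma> < l j ^ 2}" and ?b = "16384 * real q * \<sigma>"
  have b: "0 < ?b" using q sigma_pos by simp
  have pull: "(a * real q * \<sigma>) ^ q = c ^ q * (b * real q * \<sigma>) ^ q" if "a = c * b" for a b c
    unfolding that power_mult_distrib by (simp only: mult_ac)
  have "real (card ?J) * ?b ^ q = (\<Sum>j\<in>?J. ?b ^ q)" by simp
  also have "\<dots> \<le> (\<Sum>j\<in>?J. (l j ^ 2) ^ q)" using b by (intro sum_mono power_mono) auto
  also have "\<dots> \<le> (\<Sum>j<d. (l j ^ 2) ^ q)" by (intro sum_mono2) auto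
  also have "\<dots> \<le> 2 * 2 ^ q * Bq q" using Phi by (simp add: Phi_eq[OF e])
  also have "\<dots> = 2 * (1024 * real q * \<sigma>) ^ q * (T / \<sigma>)"
    by (simp add: Bq_def pull[of 1024 2 512])
  also have "T / \<sigma> \<le> sqrt (real n) * 2 ^ q" using q sigma_pos by (simp add: divide_le_eq mult_ac)
  finally have "real (card ?J) * ?b ^ q \<le> 2 * (1024 * real q * \<sigma>) ^ q * (sqrt (real n) * 2 ^ q)"
    using sigma_pos by (simp add: mult_left_mono)
  also have "\<dots> = 2 * sqrt (real n) * (2048 * real q * \<sigma>) ^ q"
    by (simp add: pull[of 2048 2 1024])
  finally have 1: "real (card ?J) * ?b ^ q \<le> 2 * sqrt (real n) * (2048 * real q * \<sigma>) ^ q" .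
  have "?b ^ q = 8 ^ q * (2048 * real q * \<sigma>) ^ q"
    by (rule pull) simp
  with 1 have "(real (card ?J) * 8 ^ q) * (2048 * real q * \<sigma>) ^ q \<le> (2 * sqrt (real n)) * (2048 * real q * \<sigma>) ^ q"
    by (simp only: mult.assoc)
  moreover have "0 < (2048 * real q * \<sigma>) ^ q" using q sigma_pos by simp
  ultimately have "real (card ?J) * 8 ^ q \<le> 2 * sqrt (real n)"
    by (simp only: mult_le_cancel_right_pos)
  moreover have "real (card ?J) * 8 ^ 1 \<le> real (card ?J) * 8 ^ q"
    using q by (intro mult_left_mono power_increasing) auto
  ultimately have "4 * real (card ?J) \<le> sqrt (real n)" by simp
  then have "(4 * real (card ?J))\<^sup>2 \<le> (sqrt (real n))\<^sup>2" by (intro power_mono) auto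
  then have "real (16 * (card ?J)\<^sup>2) \<le> real n" by (simp add: power_mult_distrib)
  then show ?thesis by linarith
qed

lemma two_power_bound: "real p \<le> 2 ^ (p - 1) \<or> p = 0"
proof (cases p)
  case (Suc m)
  have "Suc m \<le> 2 ^ m" by (induction m) auto
  then have "real (Suc m) \<le> real (2 ^ m)" by (simp only: of_nat_le_iff)
  then show ?thesis using Suc by simp
qed simp

theorem negative_direction:
  assumes n: "16 \<le> n" and q: "0 < q" "T \<le> sqrt (real n) * \<sigma> * 2 ^ q"
    and F: "F \<subseteq> {..<n}" "n < 2 * card F" and x: "sq x \<le> 1" "Psi q x \<le> 2"
  shows "\<exists>v. (\<forall>i<n. i \<notin> F \<longrightarrow> v i = 0) \<and> ip n x v = 0 \<and> qform (Hess q x) v < 0"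
proof -
  obtain u l where e: "eigenbasis d (comb x) u l" using comb_eigenbasis by blast
  have u: "orthonormal d d u" using e by (simp add: eigenbasis_def)
  define \<theta> where "\<theta> = sqrt (16384 * real q * \<sigma>)"
  have \<theta>: "0 \<le> \<theta>" "\<theta>\<^sup>2 = 16384 * real q * \<sigma>" using sigma_pos by (auto simp: \<theta>_def)
  define J where "J = {j. j < d \<and> 16384 * real q * \<sigma> < l j ^ 2}"
  have "pot q (Bq q) x \<le> 2"
    using x(2) pot_nonneg[OF Bd_pos[OF q(1)], of d x] by (simp add: Psi_def)
  then have "Phi q x \<le> 2 * 2 ^ q * Bq q" by (rule Phi_le_of_pot[OF _ x(1) Bq_pos[OF q(1)]])
  then have J: "16 * (card J)\<^sup>2 \<le> n" unfolding J_def by (rule large_eigenvalues_few[OF e q])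
  have finJ: "finite J" by (simp add: J_def)
  define E where "E = (\<lambda>i k. if k = i then 1 else 0 :: real) ` ({..<n} - F)"
  define C where "C = insert x (E \<union> (\<lambda>(j, k) i. hat d u (A i) j k) ` (J \<times> J))"
  \<comment> \<open>Just above a quarter of \<open>n\<close>, as \<open>hpot_trace_neg\<close>
    demands. Fewer than \<open>n / 2\<close> conditions fix coordinates, one is orthogonality to
    \<open>x\<close>, and at most \<open>n / 16\<close> concern the block; for
    \<open>n \<ge> 16\<close> at least \<open>r\<close> dimensions remain.\<close>
  define r where "r = n div 4 + 1"
  have finF: "finite F" using F finite_subset by blast
  have "card E \<le> card ({..<n} - F)"
    unfolding E_def by (rule card_image_le) simp
  then have cE: "card E \<le> n - card F"
    using F finF by (simp add: card_Diff_subset)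
  let ?H = "(\<lambda>(j, k) i. hat d u (A i) j k) ` (J \<times> J)"
  have cH: "card ?H \<le> (card J)\<^sup>2"
    using card_image_le[of "J \<times> J"] finJ by (simp add: card_cartesian_product power2_eq_square)
  have finE: "finite E" by (simp add: E_def)
  have finC: "finite C" using finE finJ by (simp add: C_def)
  have "card C \<le> 1 + card (E \<union> ?H)"
    unfolding C_def using finE finJ by (simp add: card_insert_if)
  also have "\<dots> \<le> 1 + ((n - card F) + (card J)\<^sup>2)"
    using card_Un_le[of E ?H] cE cH by linarith
  finally have cC: "card C \<le> 1 + ((n - card F) + (card J)\<^sup>2)" .
  have "4 * (n div 4) \<le> n" by simp
  moreover have "card F \<le> n" using F(1) card_mono[of "{..<n}" F] by simp
  ultimately have "card C + r \<le> n" using cC J F(2) n unfolding r_def by linarith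
  from orthonormal_complement[OF finC this]
  obtain w where w0: "orthonormal n r w \<and> (\<forall>m<r. \<forall>c\<in>C. ip n c (w m) = 0)" by (rule exE)
  then have w: "orthonormal n r w" "\<And>m c. m < r \<Longrightarrow> c \<in> C \<Longrightarrow> ip n c (w m) = 0" by simp_all
  have wF: "w m i = 0" if "m < r" "i < n" "i \<notin> F" for m i
  proof -
    have "(\<lambda>k. if k = i then 1 else 0) \<in> C" using that by (auto simp: C_def E_def)
    then have "ip n (\<lambda>k. if k = i then 1 else 0) (w m) = 0" using that(1) by (intro w(2))
    then show ?thesis using that by (simp add: ip_def mult_delta_left)
  qed
  have wx: "ip n x (w m) = 0" if "m < r" for m
    using w(2)[OF that] by (simp add: C_def)
  have wJ: "hat d u (comb (w m)) j k = 0" if "m < r" "j \<in> J" "k \<in> J" for m j k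
  proof -
    have "(\<lambda>i. hat d u (A i) j k) \<in> C" using that by (auto simp: C_def)
    then show ?thesis unfolding hat_comb using that(1) by (intro w(2))
  qed
  define Y where "Y = (\<lambda>p. \<Sum>j<d. (l j ^ 2) ^ (p - 1) * (\<Sum>k<d. weight2 u k j))"
  have r4: "n < 4 * r" unfolding r_def by presburger
  have neg1: "(\<Sum>m<r. qform (hpot q (Bq q) x) (w m)) < 0"
  proof (rule hpot_trace_neg[OF w(1) r4 q(1) Bq_pos[OF q(1)]])
    have "(\<Sum>m<r. qform (hess2 q x) (w m)) \<le> 2 * (4 * (real q)\<^sup>2) * Y q + 0 * T"
      unfolding Y_def using g2_bound_coarse[OF q(1)]
      by (intro pert_trace_sum_le[OF e w(1)]) auto
    also have "\<dots> = real q / 64 * (512 * real q * Y q)" by (simp add: power2_eq_square)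
    also have "\<dots> \<le> real q / 64 * (Phi q x + (512 * real q * \<sigma>) ^ q * (T / \<sigma>))"
      using weighted_moment_le[OF e q(1), of "512 * real q"] unfolding Y_def
      by (intro mult_left_mono) auto
    finally show "(\<Sum>m<r. qform (hess2 q x) (w m)) \<le> real q / 64 * (Bq q + Phi q x)"
      by (simp add: Bq_def add.commute)
  qed
  have neg2: "(\<Sum>m<r. qform (hpot d (Bd q) x) (w m)) < 0"
  proof (rule hpot_trace_neg[OF w(1) r4 d_pos Bd_pos[OF q(1)]])
    define h where "h = 4 * (real d)\<^sup>2 * (4 * \<theta>\<^sup>2) ^ (d - 1)"
    have h: "0 \<le> h" by (simp add: h_def)
    have "(\<Sum>m<r. qform (hess2 d x) (w m)) \<le> 2 * (4 * real d) * Y d + h * T"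
      unfolding Y_def
    proof (rule pert_trace_sum_le[OF e w(1) _ h])
      fix j k assume jk: "j < d" "k < d"
      show "(\<forall>m<r. hat d u (comb (w m)) j k = 0) \<or>
        \<bar>g2 (2 * d) (l j) (l k)\<bar> \<le> 4 * real d * ((l j ^ 2) ^ (d - 1) + (l k ^ 2) ^ (d - 1)) + h"
      proof (cases "j \<in> J \<and> k \<in> J")
        case True
        then show ?thesis using wJ by blast
      next
        case False
        then have "l j ^ 2 \<le> \<theta>\<^sup>2 \<or> l k ^ 2 \<le> \<theta>\<^sup>2" using jk \<theta> by (auto simp: J_def)
        then have "\<bar>l j\<bar> \<le> \<theta> \<or> \<bar>l k\<bar> \<le> \<theta>" using \<theta>(1) by (simp add: abs_le_square_iff[symmetric])
        then show ?thesis unfolding h_def using g2_bound_fine[OF d_pos \<theta>(1)] by blast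
      qed
    qed simp
    also have "\<dots> = real d / 64 * (512 * Y d + 256 * real d * (65536 * real q * \<sigma>) ^ (d - 1) * T)"
    proof -
      have *: "4 * \<theta>\<^sup>2 = 65536 * real q * \<sigma>" by (simp add: \<theta>(2))
      show ?thesis unfolding h_def * by (simp add: power2_eq_square distrib_left)
    qed
    \<comment> \<open>One half of \<open>Bd\<close> absorbs the error term of
      \<open>weighted_moment_le\<close> for \<open>K = 512\<close>, the other half the threshold
      term of the fine bound.\<close>
    also have "\<dots> \<le> real d / 64 * ((Phi d x + Bd q / 2) + Bd q / 2)"
    proof (intro mult_left_mono add_mono)
      have K: "2 * 512 \<le> 131072 * real q" "1 \<le> real q" using q by auto
      have dd: "2 * 512 ^ d \<le> (131072 * real q) ^ d"
      proof -
        have "2 * 512 ^ d \<le> 2 ^ d * (512 :: real) ^ d"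
          using d_pos power_increasing[of 1 d "2 :: real"] by simp
        also have "\<dots> = (2 * 512) ^ d" by (rule power_mult_distrib[symmetric])
        also have "\<dots> \<le> (131072 * real q) ^ d" using K by (intro power_mono) auto
        finally show ?thesis .
      qed
      have "(512 * \<sigma>) ^ d * (T / \<sigma>) \<le> Bd q / 2"
      proof -
        have "(2 * 512 ^ d) * (\<sigma> ^ d * (T / \<sigma>)) \<le> (131072 * real q) ^ d * (\<sigma> ^ d * (T / \<sigma>))"
          using dd sigma_pos T_pos by (intro mult_right_mono) auto
        then have "2 * ((512 * \<sigma>) ^ d * (T / \<sigma>)) \<le> (131072 * real q * \<sigma>) ^ d * (T / \<sigma>)"
          by (simp only: power_mult_distrib mult.assoc)
        moreover have "a \<le> b / 2" if "2 * a \<le> b" for a b :: real using that by simp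
        ultimately show ?thesis unfolding Bd_def by blast
      qed
      then show "512 * Y d \<le> Phi d x + Bd q / 2"
        using weighted_moment_le[OF e d_pos, of 512] unfolding Y_def by linarith
      obtain d' where d': "d = Suc d'" using d_pos by (cases d) auto
      have "256 * real d * 65536 ^ d' \<le> (131072 :: real) ^ d / 2"
      proof -
        have "real d \<le> 2 ^ d'" using two_power_bound[of d] d' by simp
        then have "256 * real d * 65536 ^ d' \<le> 256 * 2 ^ d' * (65536 :: real) ^ d'"
          by (intro mult_right_mono mult_left_mono) auto
        also have "\<dots> = 256 * 131072 ^ d'"
          by (simp flip: power_mult_distrib)
        also have "\<dots> \<le> (131072 :: real) ^ d / 2" by (simp add: d')
        finally show ?thesis .
      qed
      then have "(256 * real d * 65536 ^ d') * (real q * \<sigma>) ^ d' * T \<le> (131072 ^ d / 2) * (real q * \<sigma>) ^ d' * T"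
        using sigma_pos T_pos by (intro mult_right_mono) auto
      also have "\<dots> \<le> (131072 ^ d / 2) * (real q * (real q * \<sigma>) ^ d') * T"
      proof (intro mult_right_mono mult_left_mono)
        show "(real q * \<sigma>) ^ d' \<le> real q * (real q * \<sigma>) ^ d'"
          using K sigma_pos mult_right_mono[of 1 "real q" "(real q * \<sigma>) ^ d'"] by simp
      qed (use T_pos in auto)
      also have "\<dots> = Bd q / 2"
        using sigma_pos unfolding Bd_def by (simp add: d' power_mult_distrib)
      finally show "256 * real d * (65536 * real q * \<sigma>) ^ (d - 1) * T \<le> Bd q / 2"
        by (simp add: d' power_mult_distrib mult_ac)
    qed simp
    finally show "(\<Sum>m<r. qform (hess2 d x) (w m)) \<le> real d / 64 * (Bd q + Phi d x)"
      by (simp add: add.commute)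
  qed
  have qadd: "qform (Hess q x) v = qform (hpot q (Bq q) x) v + qform (hpot d (Bd q) x) v" for v
    by (simp add: qform_def Hess_def algebra_simps sum.distrib)
  have "(\<Sum>m<r. qform (Hess q x) (w m)) < 0"
    unfolding qadd sum.distrib using neg1 neg2 by simp
  then obtain m where "m < r" "qform (Hess q x) (w m) < 0"
    by (metis lessThan_iff linorder_not_le sum_nonneg)
  then show ?thesis using wF wx by blast
qed

end

section \<open>The walk\<close>

definition bil :: "nat \<Rightarrow> (nat \<Rightarrow> nat \<Rightarrow> real) \<Rightarrow> (nat \<Rightarrow> real) \<Rightarrow> (nat \<Rightarrow> real) \<Rightarrow> real" where
  "bil n G u v = (\<Sum>i<n. \<Sum>l<n. u i * G i l * v l)"

lemma bil_commute:
  assumes "\<And>i l. i < n \<Longrightarrow> l < n \<Longrightarrow> G i l = G l i"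
  shows "bil n G u v = bil n G v u"
proof -
  have "bil n G u v = (\<Sum>l<n. \<Sum>i<n. u i * G i l * v l)"
    unfolding bil_def by (rule sum.swap)
  also have "\<dots> = bil n G v u"
    unfolding bil_def by (intro sum.cong refl) (use assms in auto)
  finally show ?thesis .
qed

lemma bil_cong:
  assumes "\<And>i. i < n \<Longrightarrow> u i = u' i" "\<And>i. i < n \<Longrightarrow> v i = v' i"
  shows "bil n G u v = bil n G u' v'"
  unfolding bil_def using assms by (intro sum.cong refl) auto

lemma bil_sum_right:
  "bil n G u (\<lambda>l. \<Sum>j\<in>J. c j * w j l) = (\<Sum>j\<in>J. c j * bil n G u (w j))"
proof -
  have "bil n G u (\<lambda>l. \<Sum>j\<in>J. c j * w j l) = (\<Sum>i<n. \<Sum>l<n. \<Sum>j\<in>J. c j * (u i * G i l * w j l))"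
    by (simp add: bil_def sum_distrib_left mult_ac)
  also have "\<dots> = (\<Sum>i<n. \<Sum>j\<in>J. \<Sum>l<n. c j * (u i * G i l * w j l))"
    by (rule sum.cong, rule refl, rule sum.swap)
  also have "\<dots> = (\<Sum>j\<in>J. \<Sum>i<n. \<Sum>l<n. c j * (u i * G i l * w j l))" by (rule sum.swap)
  finally show ?thesis by (simp add: bil_def sum_distrib_left)
qed

lemma bil_diff_right: "bil n G u (\<lambda>l. v l - w l) = bil n G u v - bil n G u w"
  by (simp add: bil_def right_diff_distrib sum_subtractf)

lemma bil_zero_left: "(\<And>i. i < n \<Longrightarrow> u i = 0) \<Longrightarrow> bil n G u v = 0"
  by (simp add: bil_def)

text \<open>Vectors \<open>w k\<close> that vanish are harmless, since division by 0 makes their coefficients 0.\<close>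

lemma gram_schmidt_nonpositive:
  assumes sym: "\<And>i l. i < n \<Longrightarrow> l < n \<Longrightarrow> G i l = G l i"
    and w: "\<And>k l. k < n \<Longrightarrow> l < n \<Longrightarrow> w k l = b k l - (\<Sum>j<k. cf k j * w j l)"
    and cf: "\<And>k j. k < n \<Longrightarrow> j < k \<Longrightarrow> cf k j = bil n G (w j) (b k) / bil n G (w j) (w j)"
    and v: "\<And>l. l < n \<Longrightarrow> v l = (\<Sum>k<n. a k * b k l)" and neg: "bil n G v v < 0"
  shows "\<exists>k<n. bil n G (w k) (w k) \<le> 0 \<and> (\<exists>l<n. w k l \<noteq> 0)"
proof (rule ccontr)
  assume *: "\<not> ?thesis"
  have pos: "(\<forall>l<n. w k l = 0) \<or> 0 < bil n G (w k) (w k)" if "k < n" for k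
    using * that by force
  have comm: "bil n G u v = bil n G v u" for u v by (rule bil_commute[OF sym])
  have nonneg: "0 \<le> bil n G (w k) (w k)" if "k < n" for k
    using pos[OF that] bil_zero_left[of n "w k"] by force
  \<comment> \<open>Orthogonality rests on the contrary assumption: every divisor is then positive
    unless its vector is 0. Otherwise the recursion could divide by the zero form of a nonzero
    vector.\<close>
  have orth: "\<forall>j<k. bil n G (w j) (w k) = 0" if "k < n" for k
    using that
  proof (induction k rule: less_induct)
    case (less k)
    have off: "bil n G (w j) (w i) = 0" if "i < k" "j < k" "i \<noteq> j" for i j
    proof (cases "i < j")
      case True
      then have "bil n G (w i) (w j) = 0" using less that by auto
      then show ?thesis by (simp add: comm[of "w j" "w i"])
    next
      case False
      then show ?thesis using less that by auto
    qed
    show ?case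
    proof (intro allI impI)
      fix j assume j: "j < k"
      have "bil n G (w j) (w k) = bil n G (w j) (\<lambda>l. b k l - (\<Sum>i<k. cf k i * w i l))"
        by (rule bil_cong) (simp, rule w[OF less.prems])
      also have "\<dots> = bil n G (w j) (b k) - (\<Sum>i<k. cf k i * bil n G (w j) (w i))"
        by (simp add: bil_diff_right bil_sum_right)
      also have "(\<Sum>i<k. cf k i * bil n G (w j) (w i)) = (\<Sum>i<k. if i = j then cf k j * bil n G (w j) (w j) else 0)"
        using off j by (intro sum.cong refl) auto
      also have "\<dots> = cf k j * bil n G (w j) (w j)" using j by simp
      also have "bil n G (w j) (b k) - \<dots> = 0"
      proof (cases "\<forall>l<n. w j l = 0")
        case True
        then show ?thesis by (simp add: bil_zero_left)
      next
        case False
        then have "0 < bil n G (w j) (w j)" using pos[of j] j less.prems by auto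
        then show ?thesis using cf[OF less.prems j] by simp
      qed
      finally show "bil n G (w j) (w k) = 0" .
    qed
  qed
  have orth': "bil n G (w i) (w j) = 0" if "i < n" "j < n" "i \<noteq> j" for i j
  proof (cases "i < j")
    case True
    then show ?thesis using orth that by auto
  next
    case False
    then have "bil n G (w j) (w i) = 0" using orth that by auto
    then show ?thesis by (simp add: comm[of "w i" "w j"])
  qed
  \<comment> \<open>The coefficients of \<open>v\<close> in the family \<open>w\<close>, obtained
    through the unitriangular matrix that expresses each \<open>b k\<close> by the
    \<open>w j\<close>. In these coordinates the form is diagonal with nonnegative entries, which
    contradicts \<open>neg\<close>.\<close>
  define c where "c = (\<lambda>j. \<Sum>k<n. a k * (if j = k then 1 else if j < k then cf k j else 0))"
  have b: "b k l = (\<Sum>j<n. (if j = k then 1 else if j < k then cf k j else 0) * w j l)"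
    if "k < n" "l < n" for k l
  proof -
    have "(\<Sum>j<n. (if j = k then 1 else if j < k then cf k j else 0) * w j l)
        = (\<Sum>j<n. (if j = k then w k l else 0) + (if j \<in> {..<k} then cf k j * w j l else 0))"
      by (intro sum.cong refl) auto
    also have "\<dots> = w k l + (\<Sum>j\<in>{..<n} \<inter> {..<k}. cf k j * w j l)"
      using that by (simp add: sum.distrib sum.inter_restrict)
    also have "{..<n} \<inter> {..<k} = {..<k}" using that by auto
    finally show ?thesis using w[OF that] by simp
  qed
  have vc: "v l = (\<Sum>j<n. c j * w j l)" if "l < n" for l
  proof -
    have "v l = (\<Sum>k<n. \<Sum>j<n. a k * ((if j = k then 1 else if j < k then cf k j else 0) * w j l))"
      unfolding v[OF that] using b that by (simp add: sum_distrib_left)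
    also have "\<dots> = (\<Sum>j<n. \<Sum>k<n. a k * ((if j = k then 1 else if j < k then cf k j else 0) * w j l))"
      by (rule sum.swap)
    finally show ?thesis by (simp add: c_def sum_distrib_right mult.assoc)
  qed
  have wv: "bil n G (w j) v = c j * bil n G (w j) (w j)" if "j < n" for j
  proof -
    have "bil n G (w j) v = (\<Sum>i<n. c i * bil n G (w j) (w i))"
      unfolding bil_sum_right[symmetric] using vc by (intro bil_cong) auto
    also have "\<dots> = (\<Sum>i<n. if i = j then c j * bil n G (w j) (w j) else 0)"
      using orth' that by (intro sum.cong refl) auto
    finally show ?thesis using that by simp
  qed
  have "bil n G v v = bil n G v (\<lambda>l. \<Sum>j<n. c j * w j l)" using vc by (intro bil_cong) auto
  also have "\<dots> = (\<Sum>j<n. c j * bil n G (w j) v)"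
    unfolding bil_sum_right comm[of v] ..
  also have "\<dots> = (\<Sum>j<n. (c j)\<^sup>2 * bil n G (w j) (w j))"
    using wv by (simp add: power2_eq_square mult.assoc)
  also have "\<dots> \<ge> 0" using nonneg by (intro sum_nonneg) auto
  finally show False using neg by simp
qed

section \<open>Coordinates inside the cube and the directions orthogonal to the current
  point\<close>

definition alive :: "nat \<Rightarrow> (nat \<Rightarrow> real) \<Rightarrow> nat set" where
  "alive n x = {i. i < n \<and> (x i)\<^sup>2 < 1}"

definition active :: "nat \<Rightarrow> (nat \<Rightarrow> real) \<Rightarrow> bool" where
  "active n x \<longleftrightarrow> n < 2 * card (alive n x)"

text \<open>Row \<open>i\<close> is the projection of the \<open>i\<close>-th unit vector to the
  directions that live on the alive coordinates and are orthogonal to \<open>x\<close>. The rows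
  span this space but may be dependent; rows of frozen coordinates are 0. If \<open>x\<close>
  vanishes on the alive coordinates, division by 0 leaves the unit vectors themselves.\<close>

definition basis_vec :: "nat \<Rightarrow> (nat \<Rightarrow> real) \<Rightarrow> nat \<Rightarrow> nat \<Rightarrow> real" where
  "basis_vec n x i l = (if i \<in> alive n x \<and> l \<in> alive n x
     then (if i = l then 1 else 0) - x i * x l / (\<Sum>m\<in>alive n x. (x m)\<^sup>2) else 0)"

lemma finite_alive: "finite (alive n x)"
  by (simp add: alive_def)

lemma sum_alive:
  assumes "\<And>i. i < n \<Longrightarrow> i \<notin> alive n x \<Longrightarrow> f i = 0"
  shows "(\<Sum>i<n. f i) = (\<Sum>i\<in>alive n x. f i)"
  by (rule sum.mono_neutral_right) (use assms in \<open>auto simp: alive_def\<close>)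

lemma ip_basis_vec: "ip n x (basis_vec n x i) = 0"
proof (cases "i \<in> alive n x")
  case True
  let ?s = "\<Sum>m\<in>alive n x. (x m)\<^sup>2"
  have "ip n x (basis_vec n x i) = (\<Sum>l\<in>alive n x. x l * ((if i = l then 1 else 0) - x i * x l / ?s))"
    unfolding ip_def by (subst sum_alive[of n x]) (auto simp: basis_vec_def True)
  also have "\<dots> = (\<Sum>l\<in>alive n x. if i = l then x i else 0) - (\<Sum>l\<in>alive n x. x i * ((x l)\<^sup>2 / ?s))"
    unfolding sum_subtractf[symmetric]
    by (intro sum.cong refl) (auto simp: right_diff_distrib power2_eq_square)
  also have "\<dots> = x i - x i * (?s / ?s)"
    unfolding sum_distrib_left[symmetric] sum_divide_distrib[symmetric] using True finite_alive by simp
  also have "\<dots> = 0"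
  proof (cases "?s = 0")
    case True
    then have "x i = 0"
      using \<open>i \<in> alive n x\<close> finite_alive by (auto simp: sum_nonneg_eq_0_iff)
    then show ?thesis by simp
  qed simp
  finally show ?thesis .
qed (simp add: basis_vec_def ip_def)

text \<open>An admissible \<open>v\<close> is fixed by the projection, so its own coordinates serve
  as coefficients.\<close>

lemma basis_vec_span:
  assumes "\<And>i. i < n \<Longrightarrow> i \<notin> alive n x \<Longrightarrow> v i = 0" "ip n x v = 0" "l < n"
  shows "v l = (\<Sum>i<n. v i * basis_vec n x i l)"
proof (cases "l \<in> alive n x")
  case True
  let ?s = "\<Sum>m\<in>alive n x. (x m)\<^sup>2"
  have "(\<Sum>i<n. v i * basis_vec n x i l) = (\<Sum>i\<in>alive n x. v i * basis_vec n x i l)"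
    by (rule sum_alive) (simp add: basis_vec_def)
  also have "\<dots> = (\<Sum>i\<in>alive n x. (if i = l then v l else 0) - (x i * v i) * (x l / ?s))"
    using True by (intro sum.cong refl) (auto simp: basis_vec_def right_diff_distrib)
  also have "\<dots> = v l - (\<Sum>i\<in>alive n x. x i * v i) * (x l / ?s)"
    unfolding sum_subtractf sum_distrib_right using True finite_alive by simp
  also have "(\<Sum>i\<in>alive n x. x i * v i) = ip n x v"
    unfolding ip_def by (rule sum_alive[symmetric]) (simp add: assms)
  finally show ?thesis using assms by simp
qed (use assms in \<open>simp add: basis_vec_def\<close>)

definition step_bound :: "nat \<Rightarrow> nat \<Rightarrow> real" where
  "step_bound n d = 1 / (256 * real d ^ 3 * (real n)\<^sup>2)"

section \<open>Steps inside the cube: potential, progress and termination\<close>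

context matrix_family
begin

definition Grad :: "nat \<Rightarrow> (nat \<Rightarrow> real) \<Rightarrow> nat \<Rightarrow> real" where
  "Grad q x i = gpot q (Bq q) x i + gpot d (Bd q) x i"

text \<open>The specification of one iteration as a relation, so that the termination argument does
  not depend on which admissible direction the program selects.\<close>

definition cube_step :: "nat \<Rightarrow> (nat \<Rightarrow> real) \<Rightarrow> (nat \<Rightarrow> real) \<Rightarrow> bool" where
  "cube_step q x x' \<longleftrightarrow> (if active n x then
     \<exists>v t. (\<forall>i<n. i \<notin> alive n x \<longrightarrow> v i = 0) \<and> ip n x v = 0 \<and> (\<Sum>i<n. \<bar>v i\<bar>) = 1 \<and>
       bil n (Hess q x) v v \<le> 0 \<and> (\<Sum>i<n. v i * Grad q x i) \<le> 0 \<and>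
       0 \<le> t \<and> t \<le> step_bound n d \<and> (\<forall>i<n. x' i = x i + t * v i) \<and> (\<forall>i<n. \<bar>x' i\<bar> \<le> 1) \<and>
       (t = step_bound n d \<or> (\<exists>i\<in>alive n x. \<bar>x' i\<bar> = 1))
     else (\<forall>i<n. x' i = x i))"

lemma hess2_sym:
  assumes "i < n" "m < n"
  shows "hess2 p x i m = hess2 p x m i"
proof -
  obtain u l where e: "eigenbasis d (comb x) u l" using comb_eigenbasis by blast
  show ?thesis
    unfolding hess2_eigen[OF e] by (intro sum.cong refl) (use hat_symmetric[OF A_sym] assms in \<open>simp add: mult.commute\<close>)
qed

lemma Hess_sym: "i < n \<Longrightarrow> l < n \<Longrightarrow> Hess q x i l = Hess q x l i"
  unfolding Hess_def hpot_def using hess2_sym by simp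

lemma comb_cong: "(\<And>i. i < n \<Longrightarrow> x i = y i) \<Longrightarrow> comb x = comb y"
  by (simp add: comb_def)

lemma sq_cong: "(\<And>i. i < n \<Longrightarrow> x i = y i) \<Longrightarrow> sq x = sq y"
  by (simp add: sq_def)

lemma Psi_cong: "(\<And>i. i < n \<Longrightarrow> x i = y i) \<Longrightarrow> Psi q x = Psi q y"
  using comb_cong[of x y] sq_cong[of x y] by (simp add: Psi_def pot_def Phi_def)

lemma Psi_zero:
  assumes "0 < q" "\<And>i. i < n \<Longrightarrow> x i = 0"
  shows "Psi q x = 2"
proof -
  have c: "comb x = (\<lambda>j k. 0)" using assms by (simp add: comb_def)
  have "Phi p x = 0" if "0 < p" for p
  proof -
    obtain m where "2 * p = Suc m" using \<open>0 < p\<close> by (cases "2 * p") auto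
    then show ?thesis by (simp add: Phi_def c mm_def tr_def)
  qed
  moreover have "sq x = 0" using assms by (simp add: sq_def)
  ultimately show ?thesis using assms d_pos by (simp add: Psi_def pot_def)
qed

lemma sq_le_1:
  assumes "\<And>i. i < n \<Longrightarrow> \<bar>x i\<bar> \<le> 1"
  shows "sq x \<le> 1"
proof -
  have "(\<Sum>i<n. (x i)\<^sup>2) \<le> (\<Sum>i<n. 1)"
    using assms by (intro sum_mono) (auto simp: abs_square_le_1)
  then show ?thesis using n_pos by (simp add: sq_def)
qed

text \<open>The l1 norm replaces the Euclidean one because normalising by it takes no square root;
  it determines the squared length up to a factor \<open>n\<close>.\<close>

lemma unit_l1:
  assumes "(\<Sum>i<n. \<bar>v i\<bar>) = 1"
  shows "ip n v v \<le> 1" "1 \<le> real n * ip n v v"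
proof -
  have "\<bar>v i\<bar> \<le> 1" if "i < n" for i
    using member_le_sum[of i "{..<n}" "\<lambda>i. \<bar>v i\<bar>"] that assms by auto
  then have "\<bar>v i\<bar> * \<bar>v i\<bar> \<le> \<bar>v i\<bar> * 1" if "i < n" for i
    using that by (intro mult_left_mono) auto
  then have "ip n v v \<le> (\<Sum>i<n. \<bar>v i\<bar>)"
    unfolding ip_def by (intro sum_mono) (simp add: abs_mult_self_eq)
  then show "ip n v v \<le> 1" using assms by simp
  have "(\<Sum>i<n. \<bar>v i\<bar>)\<^sup>2 \<le> (\<Sum>i<n. \<bar>v i\<bar>\<^sup>2) * real (card {..<n})"
    by (rule sum_squared_le_sum_of_squares)
  then show "1 \<le> real n * ip n v v"
    using assms by (simp add: ip_self_eq_sum mult.commute)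
qed

lemma cube_step_potential:
  assumes q: "0 < q" "q \<le> d" and x: "\<And>i. i < n \<Longrightarrow> \<bar>x i\<bar> \<le> 1" and s: "cube_step q x x'"
  shows "Psi q x' \<le> Psi q x"
proof (cases "active n x")
  case True
  then obtain v t where v: "ip n x v = 0" "(\<Sum>i<n. \<bar>v i\<bar>) = 1"
      "bil n (Hess q x) v v \<le> 0" "(\<Sum>i<n. v i * Grad q x i) \<le> 0"
      "0 \<le> t" "t \<le> step_bound n d" "\<And>i. i < n \<Longrightarrow> x' i = x i + t * v i"
    using s unfolding cube_step_def by auto
  have "Psi q x' = Psi q (\<lambda>i. x i + t * v i)" using v by (intro Psi_cong) auto
  also have "\<dots> \<le> (pot q (Bq q) x + t * (\<Sum>i<n. v i * gpot q (Bq q) x i) + t\<^sup>2 * qform (hpot q (Bq q) x) v)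
      + (pot d (Bd q) x + t * (\<Sum>i<n. v i * gpot d (Bd q) x i) + t\<^sup>2 * qform (hpot d (Bd q) x) v)"
    unfolding Psi_def
    using q d_pos v unit_l1[OF v(2)] sq_le_1[OF x] Bq_ge[OF q(1)] Bd_ge[OF q(1)]
    by (intro add_mono pot_step) (auto simp: step_bound_def)
  also have "\<dots> = Psi q x + t * (\<Sum>i<n. v i * Grad q x i) + t\<^sup>2 * bil n (Hess q x) v v"
    by (simp add: Psi_def Grad_def Hess_def bil_def qform_def algebra_simps sum.distrib)
  also have "\<dots> \<le> Psi q x"
    using mult_nonneg_nonpos[OF v(5,4)] mult_nonneg_nonpos[of "t\<^sup>2", OF _ v(3)] by simp
  finally show ?thesis .
next
  case False
  then show ?thesis using s Psi_cong[of x' x] by (simp add: cube_step_def)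
qed

text \<open>A full step raises the squared length of \<open>x\<close> by at least
  \<open>\<tau>^2 / n\<close>, which the weight \<open>n / \<tau>^2\<close> turns into 1. A
  shortened step never lowers it and freezes a coordinate; frozen coordinates stay frozen because
  \<open>v\<close> vanishes there.\<close>

lemma cube_step_progress:
  assumes x: "\<And>i. i < n \<Longrightarrow> \<bar>x i\<bar> \<le> 1" and s: "cube_step q x x'" and a: "active n x"
  shows "(\<Sum>i<n. (x i)\<^sup>2) * (real n / (step_bound n d)\<^sup>2) + real (n - card (alive n x)) + 1
       \<le> (\<Sum>i<n. (x' i)\<^sup>2) * (real n / (step_bound n d)\<^sup>2) + real (n - card (alive n x'))"
proof -
  let ?\<tau> = "step_bound n d"
  obtain v t where v: "\<And>i. i < n \<Longrightarrow> i \<notin> alive n x \<Longrightarrow> v i = 0" "ip n x v = 0" "(\<Sum>i<n. \<bar>v i\<bar>) = 1"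
      "0 \<le> t" "\<And>i. i < n \<Longrightarrow> x' i = x i + t * v i" "t = ?\<tau> \<or> (\<exists>i\<in>alive n x. \<bar>x' i\<bar> = 1)"
    using s a unfolding cube_step_def by auto
  have \<tau>: "0 < ?\<tau>" using n_pos d_pos by (simp add: step_bound_def)
  have "(\<Sum>i<n. (x' i)\<^sup>2) = (\<Sum>i<n. (x i)\<^sup>2 + 2 * t * (x i * v i) + t\<^sup>2 * (v i * v i))"
    using v by (intro sum.cong refl) (simp add: power2_eq_square algebra_simps)
  also have "\<dots> = (\<Sum>i<n. (x i)\<^sup>2) + 2 * t * ip n x v + t\<^sup>2 * ip n v v"
    by (simp add: sum.distrib ip_def sum_distrib_left)
  finally have eq: "(\<Sum>i<n. (x' i)\<^sup>2) = (\<Sum>i<n. (x i)\<^sup>2) + t\<^sup>2 * ip n v v" using v by simp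
  have eq2: "(\<Sum>i<n. (x' i)\<^sup>2) * (real n / ?\<tau>\<^sup>2)
      = (\<Sum>i<n. (x i)\<^sup>2) * (real n / ?\<tau>\<^sup>2) + (t\<^sup>2 / ?\<tau>\<^sup>2) * (real n * ip n v v)"
    unfolding eq by (simp add: distrib_right add_divide_distrib)
  have nonneg: "0 \<le> (t\<^sup>2 / ?\<tau>\<^sup>2) * (real n * ip n v v)"
    using ip_self_nonneg by (intro mult_nonneg_nonneg) auto
  have sub: "alive n x' \<subseteq> alive n x"
  proof
    fix i assume i: "i \<in> alive n x'"
    show "i \<in> alive n x"
    proof (rule ccontr)
      assume "i \<notin> alive n x"
      then have "x' i = x i" using i v by (auto simp: alive_def)
      then show False using i \<open>i \<notin> alive n x\<close> by (simp add: alive_def)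
    qed
  qed
  have cle: "card (alive n x) \<le> n"
    using card_mono[of "{..<n}" "alive n x"] by (auto simp: alive_def)
  show ?thesis
  proof (cases "t = ?\<tau>")
    case True
    have "card (alive n x') \<le> card (alive n x)" using sub finite_alive by (rule card_mono[rotated])
    moreover have "1 \<le> (t\<^sup>2 / ?\<tau>\<^sup>2) * (real n * ip n v v)" using True \<tau> unit_l1[OF v(3)] by simp
    ultimately show ?thesis unfolding eq2 using cle by simp
  next
    case False
    then obtain i where "i \<in> alive n x" "\<bar>x' i\<bar> = 1" using v by blast
    then have "i \<in> alive n x - alive n x'" by (auto simp: alive_def abs_square_eq_1[symmetric] power2_eq_1_iff abs_eq_iff)
    then have "card (alive n x') < card (alive n x)" using sub finite_alive by (intro psubset_card_mono) auto
    then show ?thesis unfolding eq2 using cle nonneg by linarith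
  qed
qed

theorem cube_walk_terminates:
  assumes q: "0 < q" "q \<le> d" and X0: "\<And>i. i < n \<Longrightarrow> X 0 i = 0"
    and step: "\<And>k. (\<And>i. i < n \<Longrightarrow> \<bar>X k i\<bar> \<le> 1) \<Longrightarrow> Psi q (X k) \<le> 2 \<Longrightarrow> cube_step q (X k) (X (Suc k))"
    and K: "(n + d + 2) ^ 29 \<le> K"
  shows "(\<forall>i<n. \<bar>X K i\<bar> \<le> 1) \<and> Psi q (X K) \<le> 2 \<and> \<not> active n (X K)"
proof -
  have inv: "(\<forall>i<n. \<bar>X k i\<bar> \<le> 1) \<and> Psi q (X k) \<le> 2" for k
  proof (induction k)
    case 0
    then show ?case using X0 Psi_zero[OF q(1)] by simp
  next
    case (Suc k)
    then have s: "cube_step q (X k) (X (Suc k))" using step by blast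
    have "\<forall>i<n. \<bar>X (Suc k) i\<bar> \<le> 1"
      using s Suc unfolding cube_step_def by (auto split: if_splits)
    then show ?case using cube_step_potential[OF q _ s] Suc by force
  qed
  then have s: "cube_step q (X k) (X (Suc k))" for k using step by blast
  let ?c = "real n / (step_bound n d)\<^sup>2"
  define m where "m = (\<lambda>k. (\<Sum>i<n. (X k i)\<^sup>2) * ?c + real (n - card (alive n (X k))))"
  have c: "0 \<le> ?c" by simp
  have grow: "real k \<le> m k" if "\<And>j. j < k \<Longrightarrow> active n (X j)" for k
    using that
  proof (induction k)
    case 0
    have "0 \<le> m 0" unfolding m_def using c by (intro add_nonneg_nonneg mult_nonneg_nonneg sum_nonneg) auto
    then show ?case by simp
  next
    case (Suc k)
    then have "real k \<le> m k" "active n (X k)" by auto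
    then show ?case using cube_step_progress[OF _ s, of k] inv[of k] unfolding m_def by force
  qed
  have mle: "m k \<le> real n * ?c + real n" for k
  proof -
    have "(\<Sum>i<n. (X k i)\<^sup>2) \<le> (\<Sum>i<n. 1)"
      using inv[of k] by (intro sum_mono) (auto simp: abs_square_le_1)
    then have "(\<Sum>i<n. (X k i)\<^sup>2) * ?c \<le> real n * ?c" using c by (intro mult_right_mono) auto
    then show ?thesis unfolding m_def by simp
  qed
  \<comment> \<open>The progress measure is at most \<open>n^2 / \<tau>^2 + n\<close>, and
    \<open>n^2 / \<tau>^2 = 2^16 n^6 d^6\<close>. With 2, \<open>n\<close> and \<open>d\<close> all
    at most \<open>N = n + d + 2\<close> this gives the exponent 28; one more power covers the
    summand \<open>n\<close> and strictness.\<close>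
  have small: "real n * ?c + real n < real ((n + d + 2) ^ 29)"
  proof -
    define N where "N = real (n + d + 2)"
    have N: "2 \<le> N" "real n \<le> N" "real d \<le> N" by (auto simp: N_def)
    have "?c = real n * (256 * real d ^ 3 * (real n)\<^sup>2)\<^sup>2"
      by (simp add: step_bound_def power_divide)
    then have "real n * ?c = 2 ^ 16 * real n ^ 6 * real d ^ 6"
      by (simp add: power_mult_distrib power2_eq_square eval_nat_numeral mult_ac)
    also have "\<dots> \<le> N ^ 16 * N ^ 6 * N ^ 6"
      using N by (intro mult_mono power_mono) auto
    also have "\<dots> = N ^ 28" by (simp flip: power_add)
    finally have 1: "real n * ?c \<le> N ^ 28" .
    have "N ^ 1 < N ^ 28" using N by (intro power_strict_increasing) auto
    then have "real n * ?c + real n < 2 * N ^ 28" using 1 N by simp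
    also have "\<dots> \<le> N * N ^ 28" using N by (intro mult_right_mono) auto
    also have "\<dots> = N ^ 29" by (simp flip: power_Suc)
    also have "\<dots> = real ((n + d + 2) ^ 29)" unfolding N_def by (rule of_nat_power[symmetric])
    finally show ?thesis .
  qed
  have "\<exists>j<K. \<not> active n (X j)"
  proof (rule ccontr)
    assume "\<not> ?thesis"
    then have "real K \<le> m K" using grow by blast
    moreover have "real ((n + d + 2) ^ 29) \<le> real K" using K by (simp only: of_nat_le_iff)
    ultimately show False using mle[of K] small by linarith
  qed
  then obtain j where j: "j < K" "\<not> active n (X j)" by blast
  \<comment> \<open>The number of iterations is fixed in advance, so the walk has to stand still
    once it has finished.\<close>
  have "\<not> active n (X k)" if "j \<le> k" for k
    using that
  proof (induction k rule: dec_induct)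
    case base
    then show ?case using j by simp
  next
    case (step k)
    then have "\<forall>i<n. X (Suc k) i = X k i" using s[of k] by (simp add: cube_step_def)
    then have "alive n (X (Suc k)) = alive n (X k)" by (auto simp: alive_def)
    then show ?case using step by (simp add: active_def)
  qed
  then show ?thesis using inv j by auto
qed

lemma T_le: "T \<le> real d * \<sigma>"
proof -
  obtain u l where e: "eigenbasis d (comb (\<lambda>i. 0)) u l" using comb_eigenbasis by blast
  have u: "orthonormal d d u" using e by (simp add: eigenbasis_def)
  have "T \<le> (\<Sum>j<d. \<sigma>)"
    unfolding weight2_total[OF u, symmetric] by (intro sum_mono weight2_row_le[OF u]) auto
  then show ?thesis by simp
qed

text \<open>After \<open>d\<close>-th roots the factors \<open>2\<close>, \<open>2 ^ d\<close> and
  \<open>T / \<sigma> \<le> d \<le> 2 ^ d\<close> cost at most 2 each, so no dimension survives; the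
  base becomes \<open>8 * 131072 q \<sigma>\<close>.\<close>

theorem comb_opbound:
  assumes q: "0 < q" and x: "\<And>i. i < n \<Longrightarrow> \<bar>x i\<bar> \<le> 1" "Psi q x \<le> 2"
  shows "opbound d (comb x) (sqrt (1048576 * real q * \<sigma>))"
proof -
  obtain \<mu> where \<mu>: "opbound d (comb x) \<mu>" "(\<mu>\<^sup>2) ^ d \<le> Phi d x" using opbound_Phi by blast
  have "pot d (Bd q) x \<le> 2"
    using x(2) pot_nonneg[OF Bq_pos[OF q], of q x] by (simp add: Psi_def)
  then have "Phi d x \<le> 2 * 2 ^ d * Bd q" by (rule Phi_le_of_pot[OF _ sq_le_1[OF x(1)] Bd_pos[OF q]])
  also have "Bd q \<le> (131072 * real q * \<sigma>) ^ d * 2 ^ d"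
  proof -
    have "T / \<sigma> \<le> real d" using T_le sigma_pos by (simp add: divide_le_eq)
    also have "real d \<le> 2 ^ d" using of_nat_less_two_power[of d, where 'a = real] by simp
    finally show ?thesis unfolding Bd_def using sigma_pos by (intro mult_left_mono) auto
  qed
  also have "2 * 2 ^ d * ((131072 * real q * \<sigma>) ^ d * 2 ^ d) \<le> 2 ^ d * 2 ^ d * ((131072 * real q * \<sigma>) ^ d * 2 ^ d)"
    using d_pos power_increasing[of 1 d "2 :: real"] sigma_pos by (intro mult_right_mono) auto
  also have "\<dots> = (2 * 2 * (131072 * real q * \<sigma>) * 2) ^ d" by (simp only: power_mult_distrib mult_ac)
  also have "2 * 2 * (131072 * real q * \<sigma>) * 2 = 1048576 * real q * \<sigma>" by simp
  finally have "(\<mu>\<^sup>2) ^ d \<le> (1048576 * real q * \<sigma>) ^ d" using \<mu> by simp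
  then have "\<mu>\<^sup>2 \<le> 1048576 * real q * \<sigma>"
    using power_mono_iff[of "\<mu>\<^sup>2" "1048576 * real q * \<sigma>" d] d_pos sigma_pos by simp
  then have le: "\<mu> \<le> sqrt (1048576 * real q * \<sigma>)" by (rule real_le_rsqrt)
  show ?thesis
    unfolding opbound_def
  proof (intro conjI allI)
    fix y
    have "L2_set (\<lambda>j. \<Sum>k<d. comb x j k * y k) {..<d} \<le> \<mu> * L2_set y {..<d}"
      using \<mu>(1) by (simp add: opbound_def)
    also have "\<dots> \<le> sqrt (1048576 * real q * \<sigma>) * L2_set y {..<d}"
      using le by (intro mult_right_mono) auto
    finally show "L2_set (\<lambda>j. \<Sum>k<d. comb x j k * y k) {..<d} \<le> \<dots>" .
  qed (use sigma_pos in simp)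
qed

end

section \<open>Deterministic execution\<close>

text \<open>Every step is required to be a point mass, so a derivation describes the only possible
  run and counts its steps exactly.\<close>

inductive exec :: "nat \<Rightarrow> com \<Rightarrow> store \<Rightarrow> store \<Rightarrow> bool" where
  exec_Skip: "exec 0 Skip s s"
| exec_step: "step p s = return_pmf (p', s') \<Longrightarrow> p \<noteq> Skip \<Longrightarrow> exec t p' s' s'' \<Longrightarrow> exec (Suc t) p s s''"

lemma run_Skip: "run T Skip s = return_pmf (Skip, s)"
  by (induction T) (auto simp: bind_return_pmf)

lemma exec_run: "exec t p s s' \<Longrightarrow> t \<le> T \<Longrightarrow> run T p s = return_pmf (Skip, s')"
proof (induction arbitrary: T rule: exec.induct)
  case (exec_Skip s)
  show ?case by (rule run_Skip)
next
  case (exec_step p s p' s' t s'')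
  then obtain T' where "T = Suc T'" "t \<le> T'" by (cases T) auto
  then show ?case using exec_step by (simp add: bind_return_pmf)
qed

lemma exec_1: "step p s = return_pmf (Skip, s') \<Longrightarrow> p \<noteq> Skip \<Longrightarrow> exec 1 p s s'"
  using exec_step[OF _ _ exec_Skip] by simp

lemma exec_NAssign: "exec 1 (NAssign a is e) s (nstore a (map (\<lambda>i. nval i s) is) (nval e s) s)"
  by (rule exec_1) auto

lemma exec_RAssign: "exec 1 (RAssign a is e) s (rstore a (map (\<lambda>i. nval i s) is) (rval e s) s)"
  by (rule exec_1) auto

text \<open>The additional step discards the finished \<open>Skip\<close> on the left.\<close>

lemma exec_Seq: "exec t p s s1 \<Longrightarrow> exec u q s1 s2 \<Longrightarrow> exec (t + u + 1) (Seq p q) s s2"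
proof (induction rule: exec.induct)
  case (exec_Skip s)
  then show ?case using exec.exec_step[of "Seq Skip q" s q s u s2] by simp
next
  case (exec_step p s p' s' t s'')
  then have "exec (t + u + 1) (Seq p' q) s' s2" by simp
  moreover have "step (Seq p q) s = return_pmf (Seq p' q, s')" using exec_step by simp
  ultimately show ?case using exec.exec_step[of "Seq p q" s "Seq p' q" s' "t + u + 1" s2] by simp
qed

lemma exec_If: "exec t (if bval b s then p else q) s s' \<Longrightarrow> exec (t + 1) (If b p q) s s'"
  using exec_step[of "If b p q" s "if bval b s then p else q" s t s'] by simp

lemma exec_While_False: "\<not> bval b s \<Longrightarrow> exec 1 (While b p) s s"
  by (rule exec_1) auto

lemma exec_While_True:
  assumes "bval b s" "exec t p s s1" "exec u (While b p) s1 s2"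
  shows "exec (t + u + 2) (While b p) s s2"
  using exec_step[of "While b p" s "Seq p (While b p)" s "t + u + 1" s2] exec_Seq[OF assms(2,3)] assms(1)
  by simp

definition for_com :: "string \<Rightarrow> nat \<Rightarrow> nexp \<Rightarrow> com \<Rightarrow> com" where
  "for_com c m b p = Seq (NAssign c [NConst m] (NConst 0))
     (While (NLess (NGet c [NConst m]) b)
        (Seq p (NAssign c [NConst m] (NAdd (NGet c [NConst m]) (NConst 1)))))"

text \<open>An iteration costs the body plus four steps: unfolding the loop, the increment and two
  sequence transitions. The final 3 are the initial assignment, its sequence transition and the
  failing test. The invariant fixes the counter and the bound, and the body has to hand the counter
  back unchanged.\<close>

lemma exec_for:
  assumes inv: "\<And>i s. I i s \<Longrightarrow> fst s c [m] = i \<and> nval b s = B"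
    and body: "\<And>i s. i < B \<Longrightarrow> I i s \<Longrightarrow>
      \<exists>t s'. t \<le> K \<and> exec t p s s' \<and> fst s' c [m] = i \<and> I (Suc i) (nstore c [m] (Suc i) s')"
    and init: "I 0 (nstore c [m] 0 s)"
  shows "\<exists>t s'. t \<le> B * (K + 4) + 3 \<and> exec t (for_com c m b p) s s' \<and> I B s'"
proof -
  let ?W = "While (NLess (NGet c [NConst m]) b) (Seq p (NAssign c [NConst m] (NAdd (NGet c [NConst m]) (NConst 1))))"
  have loop: "\<exists>t s'. t \<le> k * (K + 4) + 1 \<and> exec t ?W s s' \<and> I B s'" if "I i s" "i + k = B" for i k s
    using that
  proof (induction k arbitrary: i s)
    case 0
    then show ?case using inv[of i s] exec_While_False[of "NLess (NGet c [NConst m]) b" s] by (intro exI[of _ 1] exI[of _ s]) auto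
  next
    case (Suc k)
    then have "i < B" by simp
    from body[OF this Suc.prems(1)] obtain t s1 where
      s1: "t \<le> K" "exec t p s s1" "fst s1 c [m] = i" "I (Suc i) (nstore c [m] (Suc i) s1)" by blast
    from Suc.IH[OF s1(4)] Suc.prems obtain u s2 where
      s2: "u \<le> k * (K + 4) + 1" "exec u ?W (nstore c [m] (Suc i) s1) s2" "I B s2" by auto
    have "exec (t + 1 + 1) (Seq p (NAssign c [NConst m] (NAdd (NGet c [NConst m]) (NConst 1)))) s (nstore c [m] (Suc i) s1)"
      using exec_Seq[OF s1(2) exec_NAssign[of c "[NConst m]" "NAdd (NGet c [NConst m]) (NConst 1)" s1]] s1(3) by simp
    moreover have "bval (NLess (NGet c [NConst m]) b) s"
      using inv[OF Suc.prems(1)] \<open>i < B\<close> by simp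
    ultimately have "exec (t + 1 + 1 + u + 2) ?W s s2" using s2(2) exec_While_True by blast
    then show ?case using s1 s2 by (intro exI[of _ "t + 1 + 1 + u + 2"] exI[of _ s2]) simp
  qed
  from loop[OF init] obtain t s' where s': "t \<le> B * (K + 4) + 1" "exec t ?W (nstore c [m] 0 s) s'" "I B s'" by auto
  have "exec (1 + t + 1) (for_com c m b p) s s'"
  proof -
    have "exec 1 (NAssign c [NConst m] (NConst 0)) s (nstore c [m] 0 s)"
      using exec_NAssign[of c "[NConst m]" "NConst 0" s] by simp
    from exec_Seq[OF this s'(2)] show ?thesis unfolding for_com_def .
  qed
  then show ?thesis using s' by (intro exI[of _ "1 + t + 1"] exI[of _ s']) simp
qed

section \<open>A language of bounded loops\<close>

text \<open>
  \<open>IV j\<close> refers to the counter of the \<open>j\<close>-th enclosing binder, counted from the outermost one.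
  Loop bounds depend on \<open>n\<close> and \<open>d\<close> only, which makes every statement polynomial-time.
\<close>

datatype ix = IC nat | IN | ID | IQ | IV nat | IAdd ix ix | ISub ix ix

datatype bnd = BC nat | BN | BD | BAdd bnd bnd

datatype xexp =
    XNat ix
  | XArr string "ix list"
  | XAdd xexp xexp
  | XSub xexp xexp
  | XMul xexp xexp
  | XDiv xexp xexp
  | XSum bnd xexp
  | XProd bnd xexp
  | XIf xexp xexp xexp xexp

text \<open>
  \<open>Tab a ps bs e\<close> assigns \<open>e\<close> to all cells of \<open>a\<close> whose index starts with \<open>ps\<close> and continues
  within the bounds \<open>bs\<close>; \<open>e\<close> must not read \<open>a\<close>.
\<close>

datatype stmt =
    Tab string "ix list" "bnd list" xexp
  | SetQ ix
  | For bnd stmt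
  | Cond xexp xexp stmt
  | Then stmt stmt  (infixr \<open>;;\<close> 60)

type_synonym arrays = "string \<Rightarrow> nat list \<Rightarrow> real"

fun ixv :: "nat \<Rightarrow> nat \<Rightarrow> nat list \<Rightarrow> nat \<Rightarrow> ix \<Rightarrow> nat" where
  "ixv n d env q (IC c) = c"
| "ixv n d env q IN = n"
| "ixv n d env q ID = d"
| "ixv n d env q IQ = q"
| "ixv n d env q (IV j) = (if j < length env then env ! j else 0)"
| "ixv n d env q (IAdd a b) = ixv n d env q a + ixv n d env q b"
| "ixv n d env q (ISub a b) = ixv n d env q a - ixv n d env q b"

fun bndv :: "nat \<Rightarrow> nat \<Rightarrow> bnd \<Rightarrow> nat" where
  "bndv n d (BC c) = c"
| "bndv n d BN = n"
| "bndv n d BD = d"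
| "bndv n d (BAdd a b) = bndv n d a + bndv n d b"

fun xval :: "nat \<Rightarrow> nat \<Rightarrow> nat list \<Rightarrow> nat \<Rightarrow> arrays \<Rightarrow> xexp \<Rightarrow> real" where
  "xval n d env q \<rho> (XNat i) = real (ixv n d env q i)"
| "xval n d env q \<rho> (XArr a is) = \<rho> a (map (ixv n d env q) is)"
| "xval n d env q \<rho> (XAdd e f) = xval n d env q \<rho> e + xval n d env q \<rho> f"
| "xval n d env q \<rho> (XSub e f) = xval n d env q \<rho> e - xval n d env q \<rho> f"
| "xval n d env q \<rho> (XMul e f) = xval n d env q \<rho> e * xval n d env q \<rho> f"
| "xval n d env q \<rho> (XDiv e f) = xval n d env q \<rho> e / xval n d env q \<rho> f"
| "xval n d env q \<rho> (XSum b e) = (\<Sum>i<bndv n d b. xval n d (env @ [i]) q \<rho> e)"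
| "xval n d env q \<rho> (XProd b e) = (\<Prod>i<bndv n d b. xval n d (env @ [i]) q \<rho> e)"
| "xval n d env q \<rho> (XIf e f g h) =
     (if xval n d env q \<rho> e < xval n d env q \<rho> f then xval n d env q \<rho> g else xval n d env q \<rho> h)"

fun in_box :: "nat list \<Rightarrow> nat list \<Rightarrow> bool" where
  "in_box [] [] \<longleftrightarrow> True"
| "in_box (b # bs) (i # is) \<longleftrightarrow> i < b \<and> in_box bs is"
| "in_box _ _ \<longleftrightarrow> False"

fun in_slice :: "nat list \<Rightarrow> nat list \<Rightarrow> nat list \<Rightarrow> bool" where
  "in_slice [] bs is \<longleftrightarrow> in_box bs is"
| "in_slice (p # ps) bs (i # is) \<longleftrightarrow> i = p \<and> in_slice ps bs is"
| "in_slice (p # ps) bs [] \<longleftrightarrow> False"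

primrec iter_upto :: "(nat \<Rightarrow> 'a \<Rightarrow> 'a) \<Rightarrow> nat \<Rightarrow> 'a \<Rightarrow> 'a" where
  "iter_upto f 0 x = x"
| "iter_upto f (Suc i) x = f i (iter_upto f i x)"

text \<open>A table is assigned simultaneously; the compiled loops write its cells one after another
  and agree with this because the expression does not read the array being written. The environment
  of an entry is that of the statement followed by the indices after the prefix.\<close>

fun sem :: "nat \<Rightarrow> nat \<Rightarrow> nat list \<Rightarrow> stmt \<Rightarrow> nat \<times> arrays \<Rightarrow> nat \<times> arrays" where
  "sem n d env (Tab a ps bs e) (q, \<rho>) = (q, \<rho>(a := \<lambda>is.
     if in_slice (map (ixv n d env q) ps) (map (bndv n d) bs) is
     then xval n d (env @ drop (length ps) is) q \<rho> e else \<rho> a is))"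
| "sem n d env (SetQ i) (q, \<rho>) = (ixv n d env q i, \<rho>)"
| "sem n d env (For b s) st = iter_upto (\<lambda>i. sem n d (env @ [i]) s) (bndv n d b) st"
| "sem n d env (Cond e f s) (q, \<rho>) =
     (if xval n d env q \<rho> e < xval n d env q \<rho> f then sem n d env s (q, \<rho>) else (q, \<rho>))"
| "sem n d env (s ;; s') st = sem n d env s' (sem n d env s st)"

fun reads :: "xexp \<Rightarrow> string set" where
  "reads (XNat i) = {}"
| "reads (XArr a is) = {a}"
| "reads (XAdd e f) = reads e \<union> reads f"
| "reads (XSub e f) = reads e \<union> reads f"
| "reads (XMul e f) = reads e \<union> reads f"
| "reads (XDiv e f) = reads e \<union> reads f"
| "reads (XSum b e) = reads e"
| "reads (XProd b e) = reads e"
| "reads (XIf e f g h) = reads e \<union> reads f \<union> reads g \<union> reads h"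

text \<open>The array \<open>#\<close> holds temporary values and loop counters of compiled programs.\<close>

fun wf_stmt :: "stmt \<Rightarrow> bool" where
  "wf_stmt (Tab a ps bs e) \<longleftrightarrow> a \<noteq> ''#'' \<and> a \<notin> reads e \<and> ''#'' \<notin> reads e"
| "wf_stmt (SetQ i) \<longleftrightarrow> True"
| "wf_stmt (For b s) \<longleftrightarrow> wf_stmt s"
| "wf_stmt (Cond e f s) \<longleftrightarrow> ''#'' \<notin> reads e \<and> ''#'' \<notin> reads f \<and> wf_stmt s"
| "wf_stmt (s ;; s') \<longleftrightarrow> wf_stmt s \<and> wf_stmt s'"

fun writes :: "stmt \<Rightarrow> string set" where
  "writes (Tab a ps bs e) = {a}"
| "writes (SetQ i) = {}"
| "writes (For b s) = writes s"
| "writes (Cond e f s) = writes s"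
| "writes (s ;; s') = writes s \<union> writes s'"

fun sets_q :: "stmt \<Rightarrow> bool" where
  "sets_q (Tab a ps bs e) \<longleftrightarrow> False"
| "sets_q (SetQ i) \<longleftrightarrow> True"
| "sets_q (For b s) \<longleftrightarrow> sets_q s"
| "sets_q (Cond e f s) \<longleftrightarrow> sets_q s"
| "sets_q (s ;; s') \<longleftrightarrow> sets_q s \<or> sets_q s'"

section \<open>Invariants and frame properties of the loop language\<close>

lemma iter_upto_invariant:
  assumes "P 0 x" "\<And>i y. i < m \<Longrightarrow> P i y \<Longrightarrow> P (Suc i) (f i y)"
  shows "P m (iter_upto f m x)"
proof -
  have "k \<le> m \<Longrightarrow> P k (iter_upto f k x)" for k
    by (induction k) (use assms in auto)
  then show ?thesis by simp
qed

lemma sem_frame: "a \<notin> writes s \<Longrightarrow> snd (sem n d env s st) a = snd st a"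
proof (induction n d env s st rule: sem.induct)
  case (3 n d env b s st)
  have "snd (iter_upto (\<lambda>i. sem n d (env @ [i]) s) (bndv n d b) st) a = snd st a"
    by (rule iter_upto_invariant[of "\<lambda>_ y. snd y a = snd st a"]) (use 3 in auto)
  then show ?case by simp
qed auto

lemma sem_frame_q: "\<not> sets_q s \<Longrightarrow> fst (sem n d env s st) = fst st"
proof (induction n d env s st rule: sem.induct)
  case (3 n d env b s st)
  have "fst (iter_upto (\<lambda>i. sem n d (env @ [i]) s) (bndv n d b) st) = fst st"
    by (rule iter_upto_invariant[of "\<lambda>_ y. fst y = fst st"]) (use 3 in auto)
  then show ?case by simp
qed auto

lemma xval_upd: "a \<notin> reads e \<Longrightarrow> xval n d env q (\<rho>(a := f)) e = xval n d env q \<rho> e"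
  by (induction e arbitrary: env) auto

section \<open>Compilation\<close>

fun cix :: "nat \<Rightarrow> ix \<Rightarrow> nexp" where
  "cix m (IC c) = NConst c"
| "cix m IN = NGet ''n'' []"
| "cix m ID = NGet ''d'' []"
| "cix m IQ = NGet ''q'' []"
| "cix m (IV j) = (if j < m then NGet ''#'' [NConst j] else NConst 0)"
| "cix m (IAdd a b) = NAdd (cix m a) (cix m b)"
| "cix m (ISub a b) = NSub (cix m a) (cix m b)"

fun cbnd :: "bnd \<Rightarrow> nexp" where
  "cbnd (BC c) = NConst c"
| "cbnd BN = NGet ''n'' []"
| "cbnd BD = NGet ''d'' []"
| "cbnd (BAdd a b) = NAdd (cbnd a) (cbnd b)"

abbreviation tmp :: "nat \<Rightarrow> rexp" where
  "tmp k \<equiv> RGet ''#'' [NConst k]"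

abbreviation set_tmp :: "nat \<Rightarrow> rexp \<Rightarrow> com" where
  "set_tmp k e \<equiv> RAssign ''#'' [NConst k] e"

text \<open>\<open>m\<close> is the number of enclosing binders, whose counters occupy the first
  \<open>m\<close> natural cells of \<open>#\<close>. The real cells of \<open>#\<close> form an
  evaluation stack: the value is left in cell \<open>k\<close>, and the cells below \<open>k\<close>
  are preserved.\<close>

fun cexp :: "nat \<Rightarrow> nat \<Rightarrow> xexp \<Rightarrow> com" where
  "cexp m k (XNat i) = set_tmp k (RNat (cix m i))"
| "cexp m k (XArr a is) = set_tmp k (RGet a (map (cix m) is))"
| "cexp m k (XAdd e f) = Seq (cexp m k e) (Seq (cexp m (Suc k) f) (set_tmp k (RAdd (tmp k) (tmp (Suc k)))))"
| "cexp m k (XSub e f) = Seq (cexp m k e) (Seq (cexp m (Suc k) f) (set_tmp k (RSub (tmp k) (tmp (Suc k)))))"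
| "cexp m k (XMul e f) = Seq (cexp m k e) (Seq (cexp m (Suc k) f) (set_tmp k (RMul (tmp k) (tmp (Suc k)))))"
| "cexp m k (XDiv e f) = Seq (cexp m k e) (Seq (cexp m (Suc k) f) (set_tmp k (RDiv (tmp k) (tmp (Suc k)))))"
| "cexp m k (XSum b e) = Seq (set_tmp k (RNat (NConst 0))) (for_com ''#'' m (cbnd b)
     (Seq (cexp (Suc m) (Suc k) e) (set_tmp k (RAdd (tmp k) (tmp (Suc k))))))"
| "cexp m k (XProd b e) = Seq (set_tmp k (RNat (NConst 1))) (for_com ''#'' m (cbnd b)
     (Seq (cexp (Suc m) (Suc k) e) (set_tmp k (RMul (tmp k) (tmp (Suc k))))))"
| "cexp m k (XIf e f g h) = Seq (cexp m k e) (Seq (cexp m (Suc k) f)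
     (If (RLess (tmp k) (tmp (Suc k))) (cexp m k g) (cexp m k h)))"

fun bmax :: "bnd \<Rightarrow> nat \<Rightarrow> nat" where
  "bmax (BC c) N = c"
| "bmax BN N = N"
| "bmax BD N = N"
| "bmax (BAdd a b) N = bmax a N + bmax b N"

fun xcost :: "xexp \<Rightarrow> nat \<Rightarrow> nat" where
  "xcost (XNat i) N = 1"
| "xcost (XArr a is) N = 1"
| "xcost (XAdd e f) N = xcost e N + xcost f N + 3"
| "xcost (XSub e f) N = xcost e N + xcost f N + 3"
| "xcost (XMul e f) N = xcost e N + xcost f N + 3"
| "xcost (XDiv e f) N = xcost e N + xcost f N + 3"
| "xcost (XSum b e) N = bmax b N * (xcost e N + 6) + 5"
| "xcost (XProd b e) N = bmax b N * (xcost e N + 6) + 5"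
| "xcost (XIf e f g h) N = xcost e N + xcost f N + xcost g N + xcost h N + 3"

text \<open>\<open>rc\<close> is the content of the natural array \<open>@\<close>, which holds the
  counters of the outer repetition; statements have to leave it alone. The real array
  \<open>#\<close> is exempt because it is scratch space.\<close>

definition matches :: "nat \<Rightarrow> nat \<Rightarrow> (nat list \<Rightarrow> nat) \<Rightarrow> nat list \<Rightarrow> nat \<Rightarrow> arrays \<Rightarrow> store \<Rightarrow> bool" where
  "matches n d rc env q \<rho> s \<longleftrightarrow>
     fst s ''n'' [] = n \<and> fst s ''d'' [] = d \<and> fst s ''q'' [] = q \<and> fst s ''@'' = rc \<and>
     (\<forall>j<length env. fst s ''#'' [j] = env ! j) \<and> (\<forall>a. a \<noteq> ''#'' \<longrightarrow> snd s a = \<rho> a)"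

lemma nval_cix: "matches n d rc env q \<rho> s \<Longrightarrow> nval (cix (length env) i) s = ixv n d env q i"
  by (induction i) (auto simp: matches_def)

lemma nval_cbnd: "matches n d rc env q \<rho> s \<Longrightarrow> nval (cbnd b) s = bndv n d b"
  by (induction b) (auto simp: matches_def)

lemma bndv_le_bmax: "bndv n d b \<le> bmax b (n + d)"
  by (induction b) auto

lemma matches_set_tmp: "matches n d rc env q \<rho> (rstore ''#'' is r s) \<longleftrightarrow> matches n d rc env q \<rho> s"
  by (auto simp: matches_def rstore_def)

lemma matches_counter:
  "matches n d rc env q \<rho> s \<Longrightarrow> matches n d rc (env @ [i]) q \<rho> (nstore ''#'' [length env] i s)"
  by (auto simp: matches_def nstore_def nth_append less_Suc_eq)

lemma matches_pop: "matches n d rc (env @ es) q \<rho> s \<Longrightarrow> matches n d rc env q \<rho> s"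
  by (auto simp: matches_def nth_append)

lemma matches_snoc: "matches n d rc (env @ [i]) q \<rho> s \<Longrightarrow> fst s ''#'' [length env] = i"
  by (auto simp: matches_def)

definition computes :: "nat \<Rightarrow> nat \<Rightarrow> (nat list \<Rightarrow> nat) \<Rightarrow> nat list \<Rightarrow> nat \<Rightarrow> arrays \<Rightarrow> nat \<Rightarrow> nat \<Rightarrow> com \<Rightarrow> real \<Rightarrow> store \<Rightarrow> bool" where
  "computes n d rc env q \<rho> k K p r s \<longleftrightarrow> (\<exists>t s'. t \<le> K \<and> exec t p s s' \<and> matches n d rc env q \<rho> s' \<and>
     snd s' ''#'' [k] = r \<and> (\<forall>j<k. snd s' ''#'' [j] = snd s ''#'' [j]))"

lemma computes_binary:
  assumes op: "\<And>s. rval (op (tmp k) (tmp (Suc k))) s = f (rval (tmp k) s) (rval (tmp (Suc k)) s)"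
    and 1: "computes n d rc env q \<rho> k K p r s"
    and 2: "\<And>s. matches n d rc env q \<rho> s \<Longrightarrow> computes n d rc env q \<rho> (Suc k) K' p' r' s"
  shows "computes n d rc env q \<rho> k (K + K' + 3) (Seq p (Seq p' (set_tmp k (op (tmp k) (tmp (Suc k)))))) (f r r') s"
proof -
  obtain t s1 where s1: "t \<le> K" "exec t p s s1" "matches n d rc env q \<rho> s1" "snd s1 ''#'' [k] = r"
    "\<forall>j<k. snd s1 ''#'' [j] = snd s ''#'' [j]" using 1 unfolding computes_def by blast
  obtain u s2 where s2: "u \<le> K'" "exec u p' s1 s2" "matches n d rc env q \<rho> s2" "snd s2 ''#'' [Suc k] = r'"
    "\<forall>j<Suc k. snd s2 ''#'' [j] = snd s1 ''#'' [j]" using 2[OF s1(3)] unfolding computes_def by blast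
  let ?s = "rstore ''#'' [k] (f r r') s2"
  have "exec 1 (set_tmp k (op (tmp k) (tmp (Suc k)))) s2 ?s"
    using exec_RAssign[of "''#''" "[NConst k]" "op (tmp k) (tmp (Suc k))" s2] s1 s2 by (simp add: op)
  then have "exec (t + (u + 1 + 1) + 1) (Seq p (Seq p' (set_tmp k (op (tmp k) (tmp (Suc k)))))) s ?s"
    using s1 s2 by (intro exec_Seq)
  moreover have "matches n d rc env q \<rho> ?s" using s2 by (simp add: matches_set_tmp)
  moreover have "snd ?s ''#'' [k] = f r r'" "\<forall>j<k. snd ?s ''#'' [j] = snd s ''#'' [j]"
    using s1 s2 by (auto simp: rstore_def)
  ultimately show ?thesis unfolding computes_def
    using s1(1) s2(1) by (intro exI[of _ "t + (u + 1 + 1) + 1"] exI[of _ ?s]) simp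
qed

text \<open>Sums and products are compiled alike. \<open>F\<close> is the sequence of partial
  results, starting from the neutral element, which is loaded as the constant
  \<open>c\<close>.\<close>

lemma computes_big:
  assumes op: "\<And>s. rval (op (tmp k) (tmp (Suc k))) s = f (rval (tmp k) s) (rval (tmp (Suc k)) s)"
    and F: "F 0 = real c" "\<And>i. F (Suc i) = f (F i) (g i)"
    and m: "matches n d rc env q \<rho> s"
    and body: "\<And>i s. matches n d rc (env @ [i]) q \<rho> s \<Longrightarrow> computes n d rc (env @ [i]) q \<rho> (Suc k) K p (g i) s"
  shows "computes n d rc env q \<rho> k (bmax b (n + d) * (K + 6) + 5)
     (Seq (set_tmp k (RNat (NConst c))) (for_com ''#'' (length env) (cbnd b)
       (Seq p (set_tmp k (op (tmp k) (tmp (Suc k))))))) (F (bndv n d b)) s"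
proof -
  let ?s0 = "rstore ''#'' [k] (real c) s"
  let ?p = "Seq p (set_tmp k (op (tmp k) (tmp (Suc k))))"
  define I where "I = (\<lambda>i s'. matches n d rc (env @ [i]) q \<rho> s' \<and> snd s' ''#'' [k] = F i \<and>
      (\<forall>j<k. snd s' ''#'' [j] = snd s ''#'' [j]))"
  have m0: "matches n d rc env q \<rho> ?s0" using m by (simp add: matches_set_tmp)
  have "\<exists>t s'. t \<le> bndv n d b * ((K + 2) + 4) + 3 \<and> exec t (for_com ''#'' (length env) (cbnd b) ?p) ?s0 s' \<and> I (bndv n d b) s'"
  proof (rule exec_for)
    fix i s' assume "I i s'"
    then show "fst s' ''#'' [length env] = i \<and> nval (cbnd b) s' = bndv n d b"
      using matches_snoc nval_cbnd unfolding I_def by blast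
  next
    fix i s1 assume i: "I i s1"
    then have m1: "matches n d rc (env @ [i]) q \<rho> s1" by (simp add: I_def)
    obtain t s2 where s2: "t \<le> K" "exec t p s1 s2" "matches n d rc (env @ [i]) q \<rho> s2" "snd s2 ''#'' [Suc k] = g i"
      "\<forall>j<Suc k. snd s2 ''#'' [j] = snd s1 ''#'' [j]" using body[OF m1] unfolding computes_def by blast
    let ?s = "rstore ''#'' [k] (F (Suc i)) s2"
    have "exec 1 (set_tmp k (op (tmp k) (tmp (Suc k)))) s2 ?s"
      using exec_RAssign[of "''#''" "[NConst k]" "op (tmp k) (tmp (Suc k))" s2] s2 i by (simp add: op F I_def)
    then have "exec (t + 1 + 1) ?p s1 ?s" using s2 by (intro exec_Seq)
    moreover have m2: "matches n d rc (env @ [i]) q \<rho> ?s" using s2 by (simp add: matches_set_tmp)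
    moreover have "I (Suc i) (nstore ''#'' [length env] (Suc i) ?s)"
      unfolding I_def using matches_counter[OF matches_pop[OF m2]] s2 i by (auto simp: I_def nstore_def rstore_def)
    ultimately show "\<exists>t s'. t \<le> K + 2 \<and> exec t ?p s1 s' \<and> fst s' ''#'' [length env] = i \<and>
        I (Suc i) (nstore ''#'' [length env] (Suc i) s')"
      using s2(1) matches_snoc[OF m2] by (intro exI[of _ "t + 1 + 1"] exI[of _ ?s]) simp
  next
    show "I 0 (nstore ''#'' [length env] 0 ?s0)"
      unfolding I_def using matches_counter[OF m0] F by (auto simp: nstore_def rstore_def)
  qed
  then obtain t s' where s': "t \<le> bndv n d b * ((K + 2) + 4) + 3"
    "exec t (for_com ''#'' (length env) (cbnd b) ?p) ?s0 s'" "I (bndv n d b) s'" by blast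
  have "exec 1 (set_tmp k (RNat (NConst c))) s ?s0"
    using exec_RAssign[of "''#''" "[NConst k]" "RNat (NConst c)" s] by simp
  from exec_Seq[OF this s'(2)]
  have "exec (1 + t + 1) (Seq (set_tmp k (RNat (NConst c))) (for_com ''#'' (length env) (cbnd b) ?p)) s s'" .
  moreover have "1 + t + 1 \<le> bmax b (n + d) * (K + 6) + 5"
  proof -
    have "bndv n d b * (K + 6) \<le> bmax b (n + d) * (K + 6)" using bndv_le_bmax by (rule mult_le_mono1)
    moreover have "K + 2 + 4 = K + 6" by simp
    ultimately show ?thesis using s'(1)[unfolded \<open>K + 2 + 4 = K + 6\<close>] by linarith
  qed
  ultimately show ?thesis
    unfolding computes_def using s'(3) matches_pop unfolding I_def by blast
qed

theorem cexp_correct: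
  assumes "''#'' \<notin> reads e" "matches n d rc env q \<rho> s"
  shows "computes n d rc env q \<rho> k (xcost e (n + d)) (cexp (length env) k e) (xval n d env q \<rho> e) s"
  using assms
proof (induction e arbitrary: env k s)
  case (XNat i)
  then show ?case
    using exec_RAssign[of "''#''" "[NConst k]" "RNat (cix (length env) i)" s]
    unfolding computes_def
    by (intro exI[of _ 1] exI[of _ "rstore ''#'' [k] (real (ixv n d env q i)) s"])
      (auto simp: nval_cix matches_set_tmp, auto simp: rstore_def)
next
  case (XArr a "is")
  have *: "map (\<lambda>e. nval e s) (map (cix (length env)) is) = map (ixv n d env q) is"
    using nval_cix[OF XArr(2)] by simp
  have "rval (RGet a (map (cix (length env)) is)) s = \<rho> a (map (ixv n d env q) is)"
    using XArr * by (auto simp: matches_def simp del: map_map)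
  then show ?case
    using exec_RAssign[of "''#''" "[NConst k]" "RGet a (map (cix (length env)) is)" s] XArr
    unfolding computes_def
    by (intro exI[of _ 1] exI[of _ "rstore ''#'' [k] (\<rho> a (map (ixv n d env q) is)) s"])
      (auto simp: matches_set_tmp simp del: rval.simps, auto simp: rstore_def)
next
  case (XAdd e f)
  then show ?case using computes_binary[of RAdd k "(+)" n d rc env q \<rho> "xcost e (n + d)"] by simp
next
  case (XSub e f)
  then show ?case using computes_binary[of RSub k "(-)" n d rc env q \<rho> "xcost e (n + d)"] by simp
next
  case (XMul e f)
  then show ?case using computes_binary[of RMul k "(*)" n d rc env q \<rho> "xcost e (n + d)"] by simp
next
  case (XDiv e f)
  then show ?case using computes_binary[of RDiv k "(/)" n d rc env q \<rho> "xcost e (n + d)"] by simp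
next
  case (XSum b e)
  have "computes n d rc env q \<rho> k (bmax b (n + d) * (xcost e (n + d) + 6) + 5)
     (Seq (set_tmp k (RNat (NConst 0))) (for_com ''#'' (length env) (cbnd b)
       (Seq (cexp (Suc (length env)) (Suc k) e) (set_tmp k (RAdd (tmp k) (tmp (Suc k)))))))
     ((\<lambda>m. \<Sum>i<m. xval n d (env @ [i]) q \<rho> e) (bndv n d b)) s"
  proof (rule computes_big[where f = "(+)" and g = "\<lambda>i. xval n d (env @ [i]) q \<rho> e"])
    fix i s' assume "matches n d rc (env @ [i]) q \<rho> s'"
    then show "computes n d rc (env @ [i]) q \<rho> (Suc k) (xcost e (n + d)) (cexp (Suc (length env)) (Suc k) e)
        (xval n d (env @ [i]) q \<rho> e) s'"
      using XSum.IH[of "env @ [i]" s' "Suc k"] XSum.prems by simp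
  qed (use XSum in auto)
  then show ?case by simp
next
  case (XProd b e)
  have "computes n d rc env q \<rho> k (bmax b (n + d) * (xcost e (n + d) + 6) + 5)
     (Seq (set_tmp k (RNat (NConst 1))) (for_com ''#'' (length env) (cbnd b)
       (Seq (cexp (Suc (length env)) (Suc k) e) (set_tmp k (RMul (tmp k) (tmp (Suc k)))))))
     ((\<lambda>m. \<Prod>i<m. xval n d (env @ [i]) q \<rho> e) (bndv n d b)) s"
  proof (rule computes_big[where f = "(*)" and g = "\<lambda>i. xval n d (env @ [i]) q \<rho> e"])
    fix i s' assume "matches n d rc (env @ [i]) q \<rho> s'"
    then show "computes n d rc (env @ [i]) q \<rho> (Suc k) (xcost e (n + d)) (cexp (Suc (length env)) (Suc k) e)
        (xval n d (env @ [i]) q \<rho> e) s'"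
      using XProd.IH[of "env @ [i]" s' "Suc k"] XProd.prems by simp
  qed (use XProd in auto)
  then show ?case by simp
next
  case (XIf e f g h)
  let ?N = "n + d" and ?v = "xval n d env q \<rho>" and ?c = "cexp (length env)"
  obtain t s1 where s1: "t \<le> xcost e ?N" "exec t (?c k e) s s1" "matches n d rc env q \<rho> s1" "snd s1 ''#'' [k] = ?v e"
    "\<forall>j<k. snd s1 ''#'' [j] = snd s ''#'' [j]" using XIf.IH(1)[of env s k] XIf.prems unfolding computes_def by auto
  obtain u s2 where s2: "u \<le> xcost f ?N" "exec u (?c (Suc k) f) s1 s2" "matches n d rc env q \<rho> s2" "snd s2 ''#'' [Suc k] = ?v f"
    "\<forall>j<Suc k. snd s2 ''#'' [j] = snd s1 ''#'' [j]" using XIf.IH(2)[of env s1 "Suc k"] XIf.prems s1 unfolding computes_def by auto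
  let ?b = "RLess (tmp k) (tmp (Suc k))"
  have b: "bval ?b s2 \<longleftrightarrow> ?v e < ?v f" using s1 s2 by simp
  define r where "r = (if ?v e < ?v f then g else h)"
  have "computes n d rc env q \<rho> k (xcost r ?N) (?c k r) (?v r) s2"
    unfolding r_def using XIf.IH(3)[of env s2 k] XIf.IH(4)[of env s2 k] XIf.prems s2(3) by auto
  then obtain w s3 where s3: "w \<le> xcost r ?N" "exec w (?c k r) s2 s3" "matches n d rc env q \<rho> s3" "snd s3 ''#'' [k] = ?v r"
    "\<forall>j<k. snd s3 ''#'' [j] = snd s2 ''#'' [j]" unfolding computes_def by blast
  have "exec w (if bval ?b s2 then ?c k g else ?c k h) s2 s3"
    using s3(2) unfolding b r_def by (cases "?v e < ?v f") auto
  from exec_Seq[OF s1(2) exec_Seq[OF s2(2) exec_If[OF this]]]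
  have "exec (t + (u + (w + 1) + 1) + 1) (?c k (XIf e f g h)) s s3" by simp
  moreover have "xcost r ?N \<le> xcost g ?N + xcost h ?N" by (simp add: r_def)
  ultimately show ?case
    unfolding computes_def using s1 s2 s3
    by (intro exI[of _ "t + (u + (w + 1) + 1) + 1"] exI[of _ s3]) (auto simp: r_def)
qed

text \<open>\<open>m0\<close> counters are open outside the table, and \<open>m\<close> including
  the table loops opened so far; the cells from \<open>m0\<close> up to \<open>m\<close> therefore
  hold the indices that follow the prefix \<open>ps\<close>.\<close>

fun ctab :: "string \<Rightarrow> nexp list \<Rightarrow> nat \<Rightarrow> nat \<Rightarrow> bnd list \<Rightarrow> xexp \<Rightarrow> com" where
  "ctab a ps m0 m [] e = Seq (cexp m 0 e) (RAssign a (ps @ map (\<lambda>j. NGet ''#'' [NConst j]) [m0..<m]) (tmp 0))"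
| "ctab a ps m0 m (b # bs) e = for_com ''#'' m (cbnd b) (ctab a ps m0 (Suc m) bs e)"

fun cstmt :: "nat \<Rightarrow> stmt \<Rightarrow> com" where
  "cstmt m (Tab a ps bs e) = ctab a (map (cix m) ps) m m bs e"
| "cstmt m (SetQ i) = NAssign ''q'' [] (cix m i)"
| "cstmt m (For b s) = for_com ''#'' m (cbnd b) (cstmt (Suc m) s)"
| "cstmt m (Cond e f s) = Seq (cexp m 0 e) (Seq (cexp m 1 f) (If (RLess (tmp 0) (tmp 1)) (cstmt m s) Skip))"
| "cstmt m (s ;; s') = Seq (cstmt m s) (cstmt m s')"

fun tab_cost :: "bnd list \<Rightarrow> nat \<Rightarrow> nat \<Rightarrow> nat" where
  "tab_cost [] c N = c + 2"
| "tab_cost (b # bs) c N = bmax b N * (tab_cost bs c N + 4) + 3"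

fun scost :: "stmt \<Rightarrow> nat \<Rightarrow> nat" where
  "scost (Tab a ps bs e) N = tab_cost bs (xcost e N) N"
| "scost (SetQ i) N = 1"
| "scost (For b s) N = bmax b N * (scost s N + 4) + 3"
| "scost (Cond e f s) N = xcost e N + xcost f N + scost s N + 3"
| "scost (s ;; s') N = scost s N + scost s' N + 1"

definition reaches :: "nat \<Rightarrow> nat \<Rightarrow> (nat list \<Rightarrow> nat) \<Rightarrow> nat list \<Rightarrow> nat \<times> arrays \<Rightarrow> nat \<Rightarrow> com \<Rightarrow> store \<Rightarrow> bool" where
  "reaches n d rc env st K p s \<longleftrightarrow> (\<exists>t s'. t \<le> K \<and> exec t p s s' \<and> matches n d rc env (fst st) (snd st) s')"

lemma reaches_for:
  assumes m: "matches n d rc env (fst (S 0)) (snd (S 0)) s"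
    and body: "\<And>i s. i < bndv n d b \<Longrightarrow> matches n d rc (env @ [i]) (fst (S i)) (snd (S i)) s \<Longrightarrow> reaches n d rc (env @ [i]) (S (Suc i)) K p s"
  shows "reaches n d rc env (S (bndv n d b)) (bmax b (n + d) * (K + 4) + 3) (for_com ''#'' (length env) (cbnd b) p) s"
proof -
  let ?I = "\<lambda>i s. matches n d rc (env @ [i]) (fst (S i)) (snd (S i)) s"
  have "\<exists>t s'. t \<le> bndv n d b * (K + 4) + 3 \<and> exec t (for_com ''#'' (length env) (cbnd b) p) s s' \<and> ?I (bndv n d b) s'"
  proof (rule exec_for)
    fix i s assume "?I i s"
    then show "fst s ''#'' [length env] = i \<and> nval (cbnd b) s = bndv n d b"
      using matches_snoc nval_cbnd by blast
  next
    fix i s assume "i < bndv n d b" "?I i s"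
    from body[OF this] obtain t s' where s': "t \<le> K" "exec t p s s'" "matches n d rc (env @ [i]) (fst (S (Suc i))) (snd (S (Suc i))) s'"
      unfolding reaches_def by blast
    then show "\<exists>t s'. t \<le> K \<and> exec t p s s' \<and> fst s' ''#'' [length env] = i \<and> ?I (Suc i) (nstore ''#'' [length env] (Suc i) s')"
      using matches_snoc[OF s'(3)] matches_counter[OF matches_pop[OF s'(3)]] by blast
  next
    show "?I 0 (nstore ''#'' [length env] 0 s)" by (rule matches_counter[OF m])
  qed
  moreover have "bndv n d b * (K + 4) \<le> bmax b (n + d) * (K + 4)" using bndv_le_bmax by (rule mult_le_mono1)
  ultimately show ?thesis unfolding reaches_def
    by (meson add_le_mono1 le_trans matches_pop)
qed

lemma in_slice_iff: "in_slice ps bs is \<longleftrightarrow> (\<exists>r. is = ps @ r \<and> in_box bs r)"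
proof (induction ps arbitrary: "is")
  case (Cons p ps)
  then show ?case by (cases "is") auto
qed simp

lemma in_box_Cons: "in_box (b # bs) is \<longleftrightarrow> (\<exists>i r. is = i # r \<and> i < b \<and> in_box bs r)"
  by (cases "is") auto

text \<open>\<open>U S\<close> is the state in which exactly the cells in \<open>S\<close> have been
  written. Since \<open>e\<close> does not read \<open>a\<close>, its value in any such state is the
  value in the initial one, and the induction on the remaining bounds enlarges \<open>S\<close> by a
  slice at a time.\<close>

lemma ctab_correct:
  fixes \<rho> :: arrays
  assumes e: "a \<noteq> ''#''" "a \<notin> reads e" "''#'' \<notin> reads e"
    and ps: "\<And>s es \<rho>'. matches n d rc (env @ es) q \<rho>' s \<Longrightarrow> map (\<lambda>i. nval i s) ps = p"
  defines "U \<equiv> \<lambda>S. \<rho>(a := \<lambda>is. if is \<in> S then xval n d (env @ drop (length p) is) q \<rho> e else \<rho> a is)"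
  shows "matches n d rc (env @ pre) q (U S) s \<Longrightarrow>
    reaches n d rc (env @ pre) (q, U (S \<union> {p @ pre @ r | r. in_box (map (bndv n d) bs) r}))
      (tab_cost bs (xcost e (n + d)) (n + d)) (ctab a ps (length env) (length (env @ pre)) bs e) s"
proof (induction bs arbitrary: pre S s)
  case Nil
  have "computes n d rc (env @ pre) q (U S) 0 (xcost e (n + d)) (cexp (length (env @ pre)) 0 e) (xval n d (env @ pre) q (U S) e) s"
    by (rule cexp_correct[OF e(3) Nil])
  moreover have v: "xval n d (env @ pre) q (U S) e = xval n d (env @ pre) q \<rho> e"
    unfolding U_def by (rule xval_upd[OF e(2)])
  ultimately obtain t s1 where s1: "t \<le> xcost e (n + d)" "exec t (cexp (length (env @ pre)) 0 e) s s1"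
    "matches n d rc (env @ pre) q (U S) s1" "snd s1 ''#'' [0] = xval n d (env @ pre) q \<rho> e"
    unfolding computes_def by auto
  let ?is = "ps @ map (\<lambda>j. NGet ''#'' [NConst j]) [length env..<length (env @ pre)]"
  have "map ((\<lambda>i. nval i s1) \<circ> (\<lambda>j. NGet ''#'' [NConst j])) [length env..<length (env @ pre)] = pre"
    using s1(3) by (intro nth_equalityI) (auto simp: matches_def nth_append)
  then have "map (\<lambda>i. nval i s1) ?is = p @ pre" using ps[OF s1(3)] by simp
  then have "exec 1 (RAssign a ?is (tmp 0)) s1 (rstore a (p @ pre) (xval n d (env @ pre) q \<rho> e) s1)"
    using exec_RAssign[of a ?is "tmp 0" s1] s1(4) by simp
  from exec_Seq[OF s1(2) this]
  have "exec (t + 1 + 1) (ctab a ps (length env) (length (env @ pre)) [] e) s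
      (rstore a (p @ pre) (xval n d (env @ pre) q \<rho> e) s1)" by simp
  moreover have "{p @ pre @ r | r. in_box (map (bndv n d) []) r} = {p @ pre}"
    by (auto elim: in_box.elims)
  moreover have "matches n d rc (env @ pre) q (U (S \<union> {p @ pre})) (rstore a (p @ pre) (xval n d (env @ pre) q \<rho> e) s1)"
    using s1(3) e(1) by (auto simp: matches_def rstore_def U_def fun_eq_iff)
  ultimately show ?case unfolding reaches_def using s1(1)
    by (intro exI[of _ "t + 1 + 1"] exI[of _ "rstore a (p @ pre) (xval n d (env @ pre) q \<rho> e) s1"]) simp
next
  case (Cons b bs)
  let ?B = "\<lambda>i. {p @ pre @ (i' # r) | i' r. i' < i \<and> in_box (map (bndv n d) bs) r}"
  have 0: "?B 0 = {}" by simp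
  have "reaches n d rc (env @ pre) ((\<lambda>i. (q, U (S \<union> ?B i))) (bndv n d b))
     (bmax b (n + d) * (tab_cost bs (xcost e (n + d)) (n + d) + 4) + 3)
     (for_com ''#'' (length (env @ pre)) (cbnd b) (ctab a ps (length env) (length (env @ pre @ [0])) bs e)) s"
  proof (rule reaches_for)
    show "matches n d rc (env @ pre) (fst (q, U (S \<union> ?B 0))) (snd (q, U (S \<union> ?B 0))) s"
      using Cons.prems unfolding 0 by simp
  next
    fix i s assume "matches n d rc ((env @ pre) @ [i]) (fst (q, U (S \<union> ?B i))) (snd (q, U (S \<union> ?B i))) s"
    then have "matches n d rc (env @ (pre @ [i])) q (U (S \<union> ?B i)) s" by simp
    from Cons.IH[OF this]
    have "reaches n d rc (env @ pre @ [i]) (q, U (S \<union> ?B i \<union> {p @ (pre @ [i]) @ r | r. in_box (map (bndv n d) bs) r}))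
      (tab_cost bs (xcost e (n + d)) (n + d)) (ctab a ps (length env) (length (env @ pre @ [i])) bs e) s" by simp
    moreover have "S \<union> ?B i \<union> {p @ (pre @ [i]) @ r | r. in_box (map (bndv n d) bs) r} = S \<union> ?B (Suc i)"
      by (auto simp: less_Suc_eq)
    ultimately show "reaches n d rc ((env @ pre) @ [i]) (q, U (S \<union> ?B (Suc i)))
      (tab_cost bs (xcost e (n + d)) (n + d)) (ctab a ps (length env) (length (env @ pre @ [0])) bs e) s" by simp
  qed
  moreover have "?B (bndv n d b) = {p @ pre @ r | r. in_box (map (bndv n d) (b # bs)) r}"
    by (auto simp: in_box_Cons)
  ultimately show ?case by simp
qed

theorem cstmt_correct:
  assumes "wf_stmt s" "matches n d rc env (fst st) (snd st) \<sigma>"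
  shows "reaches n d rc env (sem n d env s st) (scost s (n + d)) (cstmt (length env) s) \<sigma>"
  using assms
proof (induction s arbitrary: env st \<sigma>)
  case (Tab a ps bs e)
  obtain q \<rho> where st: "st = (q, \<rho>)" by (cases st)
  let ?p = "map (ixv n d env q) ps"
  have ps: "map (\<lambda>i. nval i s) (map (cix (length env)) ps) = ?p" if "matches n d rc (env @ es) q \<rho>' s" for s es \<rho>'
    using nval_cix[OF matches_pop[OF that]] by simp
  have "matches n d rc (env @ []) q (\<rho>(a := \<lambda>is. if is \<in> {} then xval n d (env @ drop (length ?p) is) q \<rho> e else \<rho> a is)) \<sigma>"
    using Tab.prems(2) st by simp
  from ctab_correct[OF _ _ _ ps this] Tab.prems
  have "reaches n d rc env (q, \<rho>(a := \<lambda>is. if is \<in> {?p @ r | r. in_box (map (bndv n d) bs) r} then xval n d (env @ drop (length ?p) is) q \<rho> e else \<rho> a is))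
      (tab_cost bs (xcost e (n + d)) (n + d)) (ctab a (map (cix (length env)) ps) (length env) (length env) bs e) \<sigma>"
    by simp
  moreover have "(is \<in> {?p @ r | r. in_box (map (bndv n d) bs) r}) = in_slice ?p (map (bndv n d) bs) is" for "is"
    by (auto simp: in_slice_iff)
  ultimately show ?case by (simp add: st cong: if_cong)
next
  case (SetQ i)
  obtain q \<rho> where st: "st = (q, \<rho>)" by (cases st)
  have "exec 1 (NAssign ''q'' [] (cix (length env) i)) \<sigma> (nstore ''q'' [] (ixv n d env q i) \<sigma>)"
    using exec_NAssign[of "''q''" "[]" "cix (length env) i" \<sigma>] nval_cix[of n d rc env q \<rho> \<sigma>] SetQ st by simp
  moreover have "matches n d rc env (ixv n d env q i) \<rho> (nstore ''q'' [] (ixv n d env q i) \<sigma>)"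
    using SetQ st by (auto simp: matches_def nstore_def)
  ultimately show ?case unfolding reaches_def st
    by (intro exI[of _ 1] exI[of _ "nstore ''q'' [] (ixv n d env q i) \<sigma>"]) simp
next
  case (For b s)
  have "reaches n d rc env ((\<lambda>k. iter_upto (\<lambda>i. sem n d (env @ [i]) s) k st) (bndv n d b))
     (bmax b (n + d) * (scost s (n + d) + 4) + 3) (for_com ''#'' (length env) (cbnd b) (cstmt (Suc (length env)) s)) \<sigma>"
  proof (rule reaches_for)
    fix i \<sigma>' assume "matches n d rc (env @ [i]) (fst (iter_upto (\<lambda>i. sem n d (env @ [i]) s) i st)) (snd (iter_upto (\<lambda>i. sem n d (env @ [i]) s) i st)) \<sigma>'"
    then show "reaches n d rc (env @ [i]) (iter_upto (\<lambda>i. sem n d (env @ [i]) s) (Suc i) st) (scost s (n + d)) (cstmt (Suc (length env)) s) \<sigma>'"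
      using For.IH[of "env @ [i]"] For.prems by simp
  qed (use For.prems in simp)
  then show ?case by simp
next
  case (Cond e f s)
  obtain q \<rho> where st: "st = (q, \<rho>)" by (cases st)
  let ?N = "n + d" and ?v = "xval n d env q \<rho>" and ?c = "cexp (length env)"
  have m: "matches n d rc env q \<rho> \<sigma>" using Cond.prems st by simp
  obtain t s1 where s1: "t \<le> xcost e ?N" "exec t (?c 0 e) \<sigma> s1" "matches n d rc env q \<rho> s1" "snd s1 ''#'' [0] = ?v e"
    using cexp_correct[OF _ m, of e 0] Cond.prems unfolding computes_def by auto
  obtain u s2 where s2: "u \<le> xcost f ?N" "exec u (?c 1 f) s1 s2" "matches n d rc env q \<rho> s2" "snd s2 ''#'' [1] = ?v f"
    "snd s2 ''#'' [0] = snd s1 ''#'' [0]"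
    using cexp_correct[OF _ s1(3), of f 1] Cond.prems unfolding computes_def by auto
  let ?b = "RLess (tmp 0) (tmp 1)"
  have b: "bval ?b s2 \<longleftrightarrow> ?v e < ?v f" using s1 s2 by simp
  have "reaches n d rc env (sem n d env (Cond e f s) st) (scost s ?N) (if bval ?b s2 then cstmt (length env) s else Skip) s2"
  proof (cases "?v e < ?v f")
    case True
    then show ?thesis using Cond.IH[of env st s2] Cond.prems s2(3) b by (simp add: st)
  next
    case False
    then show ?thesis using s2(3) b exec_Skip[of s2] unfolding reaches_def
      by (intro exI[of _ 0] exI[of _ s2]) (simp add: st)
  qed
  then obtain w s3 where s3: "w \<le> scost s ?N" "exec w (if bval ?b s2 then cstmt (length env) s else Skip) s2 s3"
    "matches n d rc env (fst (sem n d env (Cond e f s) st)) (snd (sem n d env (Cond e f s) st)) s3"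
    unfolding reaches_def by blast
  from exec_Seq[OF s1(2) exec_Seq[OF s2(2) exec_If[OF s3(2)]]]
  have "exec (t + (u + (w + 1) + 1) + 1) (cstmt (length env) (Cond e f s)) \<sigma> s3" by simp
  moreover have "t + (u + (w + 1) + 1) + 1 \<le> scost (Cond e f s) ?N" using s1(1) s2(1) s3(1) by simp
  ultimately show ?case unfolding reaches_def using s3(3) by blast
next
  case (Then s s')
  have "reaches n d rc env (sem n d env s st) (scost s (n + d)) (cstmt (length env) s) \<sigma>"
    using Then.IH(1)[OF _ Then.prems(2)] Then.prems(1) by simp
  then obtain t \<sigma>1 where 1: "t \<le> scost s (n + d)" "exec t (cstmt (length env) s) \<sigma> \<sigma>1"
    "matches n d rc env (fst (sem n d env s st)) (snd (sem n d env s st)) \<sigma>1"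
    unfolding reaches_def by blast
  have "reaches n d rc env (sem n d env s' (sem n d env s st)) (scost s' (n + d)) (cstmt (length env) s') \<sigma>1"
    using Then.IH(2)[OF _ 1(3)] Then.prems(1) by simp
  then obtain u \<sigma>2 where 2: "u \<le> scost s' (n + d)" "exec u (cstmt (length env) s') \<sigma>1 \<sigma>2"
    "matches n d rc env (fst (sem n d env s' (sem n d env s st))) (snd (sem n d env s' (sem n d env s st))) \<sigma>2"
    unfolding reaches_def by blast
  have "t + u + 1 \<le> scost (s ;; s') (n + d)" using 1(1) 2(1) by simp
  moreover have "exec (t + u + 1) (cstmt (length env) (s ;; s')) \<sigma> \<sigma>2" using exec_Seq[OF 1(2) 2(2)] by simp
  ultimately show ?case unfolding reaches_def sem.simps using 2(3) by blast
qed

text \<open>Loop bounds are linear in \<open>n\<close> and \<open>d\<close>, so polynomially many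
  repetitions require nested loops. Their counters live in the separate array \<open>@\<close>,
  because the body is compiled for an empty environment and may overwrite \<open>#\<close>.\<close>

primrec crepeat :: "nat \<Rightarrow> com \<Rightarrow> com" where
  "crepeat 0 p = p"
| "crepeat (Suc k) p = for_com ''@'' k (cbnd (BAdd BN (BAdd BD (BC 2)))) (crepeat k p)"

primrec repeat_cost :: "nat \<Rightarrow> nat \<Rightarrow> nat \<Rightarrow> nat" where
  "repeat_cost 0 c N = c"
| "repeat_cost (Suc k) c N = (N + 2) * (repeat_cost k c N + 4) + 3"

text \<open>The loops of \<open>crepeat k p\<close> touch only the cells of \<open>@\<close> below
  \<open>k\<close>, so the counters of all loops further out survive.\<close>

lemma crepeat_correct:
  assumes body: "\<And>rc st s. matches n d rc [] (fst st) (snd st) s \<Longrightarrow> reaches n d rc [] (f st) c p s"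
  shows "matches n d rc [] (fst st) (snd st) s \<Longrightarrow>
    \<exists>t s' rc'. t \<le> repeat_cost k c (n + d) \<and> exec t (crepeat k p) s s' \<and> (\<forall>j\<ge>k. rc' [j] = rc [j]) \<and>
      matches n d rc' [] (fst ((f ^^ ((n + d + 2) ^ k)) st)) (snd ((f ^^ ((n + d + 2) ^ k)) st)) s'"
proof (induction k arbitrary: rc st s)
  case 0
  then show ?case using body[OF 0] unfolding reaches_def by auto
next
  case (Suc k)
  let ?N = "n + d + 2" and ?b = "cbnd (BAdd BN (BAdd BD (BC 2)))"
  define S where "S = (\<lambda>i. (f ^^ (i * ?N ^ k)) st)"
  let ?I = "\<lambda>i s. fst s ''@'' [k] = i \<and> (\<exists>rc'. (\<forall>j\<ge>Suc k. rc' [j] = rc [j]) \<and> matches n d rc' [] (fst (S i)) (snd (S i)) s)"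
  have upd: "matches n d (rc'([k] := i)) [] q \<rho> (nstore ''@'' [k] i s)" if "matches n d rc' [] q \<rho> s" for rc' q \<rho> s i
    using that by (auto simp: matches_def nstore_def)
  have "\<exists>t s'. t \<le> ?N * (repeat_cost k c (n + d) + 4) + 3 \<and> exec t (for_com ''@'' k ?b (crepeat k p)) s s' \<and> ?I ?N s'"
  proof (rule exec_for)
    fix i s assume "?I i s"
    then show "fst s ''@'' [k] = i \<and> nval ?b s = ?N" by (auto simp: matches_def)
  next
    fix i s assume "?I i s"
    then obtain rc1 where rc1: "fst s ''@'' [k] = i" "\<forall>j\<ge>Suc k. rc1 [j] = rc [j]" "matches n d rc1 [] (fst (S i)) (snd (S i)) s" by blast
    from Suc.IH[OF rc1(3)] obtain t s' rc2 where s': "t \<le> repeat_cost k c (n + d)" "exec t (crepeat k p) s s'"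
      "\<forall>j\<ge>k. rc2 [j] = rc1 [j]" "matches n d rc2 [] (fst ((f ^^ (?N ^ k)) (S i))) (snd ((f ^^ (?N ^ k)) (S i))) s'" by blast
    have SS: "(f ^^ (?N ^ k)) (S i) = S (Suc i)"
      by (simp add: S_def funpow_add)
    have "fst s' ''@'' [k] = i" using s'(3,4) rc1 by (auto simp: matches_def)
    moreover have "?I (Suc i) (nstore ''@'' [k] (Suc i) s')"
      using upd[OF s'(4), of "Suc i"] s'(3) rc1(2) unfolding SS
      by (intro conjI exI[of _ "rc2([k] := Suc i)"]) (auto simp: nstore_def)
    ultimately show "\<exists>t s'. t \<le> repeat_cost k c (n + d) \<and> exec t (crepeat k p) s s' \<and> fst s' ''@'' [k] = i \<and>
        ?I (Suc i) (nstore ''@'' [k] (Suc i) s')"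
      using s'(1,2) by blast
  next
    show "?I 0 (nstore ''@'' [k] 0 s)"
      using upd[OF Suc.prems, of 0] by (intro conjI exI[of _ "rc([k] := 0)"]) (auto simp: nstore_def S_def)
  qed
  then show ?case by (auto simp: S_def)
qed

section \<open>Polynomial bounds on running times\<close>

definition poly_bounded :: "(nat \<Rightarrow> nat) \<Rightarrow> bool" where
  "poly_bounded f \<longleftrightarrow> (\<exists>p :: nat poly. \<forall>N. f N \<le> poly p N)"

lemma poly_bounded_const: "poly_bounded (\<lambda>N. c)"
  unfolding poly_bounded_def by (intro exI[of _ "[:c:]"]) simp

lemma poly_bounded_id: "poly_bounded (\<lambda>N. N)"
  unfolding poly_bounded_def by (intro exI[of _ "[:0, 1:]"]) simp

lemma poly_bounded_add: "poly_bounded f \<Longrightarrow> poly_bounded g \<Longrightarrow> poly_bounded (\<lambda>N. f N + g N)"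
  unfolding poly_bounded_def by (metis add_mono poly_add)

lemma poly_bounded_mult: "poly_bounded f \<Longrightarrow> poly_bounded g \<Longrightarrow> poly_bounded (\<lambda>N. f N * g N)"
  unfolding poly_bounded_def by (metis mult_le_mono poly_mult)

lemma poly_bounded_Suc: "poly_bounded f \<Longrightarrow> poly_bounded (\<lambda>N. Suc (f N))"
  using poly_bounded_add[OF poly_bounded_const[of 1], of f] by simp

lemmas poly_bounded_intros = poly_bounded_Suc poly_bounded_const poly_bounded_id poly_bounded_add poly_bounded_mult

lemma poly_bounded_bmax: "poly_bounded (bmax b)"
  by (induction b) (auto simp: poly_bounded_intros)

lemma poly_bounded_xcost: "poly_bounded (xcost e)"
  by (induction e) (auto intro!: poly_bounded_intros poly_bounded_bmax)

lemma poly_bounded_tab_cost: "poly_bounded c \<Longrightarrow> poly_bounded (\<lambda>N. tab_cost bs (c N) N)"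
  by (induction bs) (auto intro!: poly_bounded_intros poly_bounded_bmax)

lemma poly_bounded_scost: "poly_bounded (scost s)"
  by (induction s) (auto intro!: poly_bounded_intros poly_bounded_bmax poly_bounded_tab_cost poly_bounded_xcost)

lemma poly_bounded_repeat_cost: "poly_bounded c \<Longrightarrow> poly_bounded (\<lambda>N. repeat_cost k (c N) N)"
  by (induction k) (auto intro!: poly_bounded_intros)

definition repeat_program :: "stmt \<Rightarrow> nat \<Rightarrow> stmt \<Rightarrow> com" where
  "repeat_program s k s' = Seq (cstmt 0 s) (crepeat k (cstmt 0 s'))"

definition repeat_result :: "stmt \<Rightarrow> nat \<Rightarrow> stmt \<Rightarrow> nat \<Rightarrow> nat \<Rightarrow> (nat \<Rightarrow> real Matrix.mat) \<Rightarrow> arrays" where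
  "repeat_result s k s' n d A =
     snd ((sem n d [] s' ^^ ((n + d + 2) ^ k)) (sem n d [] s (0, snd (input_store n d A))))"

theorem repeat_program_correct:
  assumes "wf_stmt s" "wf_stmt s'"
  shows "\<exists>q :: nat poly. \<forall>n d A. \<exists>\<sigma>. (\<forall>T \<ge> poly q (n + d).
      run T (repeat_program s k s') (input_store n d A) = return_pmf (Skip, \<sigma>)) \<and>
      (\<forall>a. a \<noteq> ''#'' \<longrightarrow> snd \<sigma> a = repeat_result s k s' n d A a)"
proof -
  have "poly_bounded (\<lambda>N. scost s N + repeat_cost k (scost s' N) N + 1)"
    by (intro poly_bounded_intros poly_bounded_scost poly_bounded_repeat_cost)
  then obtain q :: "nat poly" where q: "\<And>N. scost s N + repeat_cost k (scost s' N) N + 1 \<le> poly q N"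
    unfolding poly_bounded_def by blast
  show ?thesis
  proof (intro exI[of _ q] allI)
    fix n d A
    let ?s0 = "input_store n d A"
    have "matches n d (\<lambda>_. 0) [] (fst (0, snd ?s0)) (snd (0 :: nat, snd ?s0)) ?s0"
      by (auto simp: matches_def input_store_def)
    from cstmt_correct[OF assms(1) this] obtain t \<sigma>1 where 1: "t \<le> scost s (n + d)" "exec t (cstmt 0 s) ?s0 \<sigma>1"
      "matches n d (\<lambda>_. 0) [] (fst (sem n d [] s (0, snd ?s0))) (snd (sem n d [] s (0, snd ?s0))) \<sigma>1"
      unfolding reaches_def by auto
    have "reaches n d rc [] (sem n d [] s' st) (scost s' (n + d)) (cstmt 0 s') \<sigma>"
      if "matches n d rc [] (fst st) (snd st) \<sigma>" for rc st \<sigma>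
      using cstmt_correct[OF assms(2) that] by simp
    from crepeat_correct[of n d "sem n d [] s'", OF this 1(3), of k] obtain u \<sigma>2 rc' where
      2: "u \<le> repeat_cost k (scost s' (n + d)) (n + d)" "exec u (crepeat k (cstmt 0 s')) \<sigma>1 \<sigma>2"
      "matches n d rc' [] (fst ((sem n d [] s' ^^ ((n + d + 2) ^ k)) (sem n d [] s (0, snd ?s0))))
        (repeat_result s k s' n d A) \<sigma>2"
      unfolding repeat_result_def by blast
    have "t + u + 1 \<le> poly q (n + d)" using 1(1) 2(1) q[of "n + d"] by linarith
    then have "run T (repeat_program s k s') ?s0 = return_pmf (Skip, \<sigma>2)" if "poly q (n + d) \<le> T" for T
      unfolding repeat_program_def using exec_run[OF exec_Seq[OF 1(2) 2(2)]] that by simp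
    moreover have "\<forall>a. a \<noteq> ''#'' \<longrightarrow> snd \<sigma>2 a = repeat_result s k s' n d A a"
      using 2(3) by (simp add: matches_def)
    ultimately show "\<exists>\<sigma>. (\<forall>T \<ge> poly q (n + d). run T (repeat_program s k s') ?s0 = return_pmf (Skip, \<sigma>)) \<and>
      (\<forall>a. a \<noteq> ''#'' \<longrightarrow> snd \<sigma> a = repeat_result s k s' n d A a)" by blast
  qed
qed

section \<open>Evaluation of guarded sums and products\<close>

declare if_weak_cong [cong del]

lemma mpow_cong:
  assumes "\<And>j k. j < d \<Longrightarrow> k < d \<Longrightarrow> X j k = Y j k" "j < d" "k < d"
  shows "mpow d X a j k = mpow d Y a j k"
  using assms(2,3)
proof (induction a arbitrary: j k)
  case (Suc a)
  then show ?case using assms(1) by (simp add: mm_def)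
qed simp

lemma tr_mm: "tr d (mm d X Y) = (\<Sum>j<d. \<Sum>k<d. X j k * Y k j)"
  by (simp add: tr_def mm_def)

text \<open>A loop bound cannot be the computed number \<open>q\<close>, so powers with exponent
  \<open>q\<close> are written as products over all \<open>i < d\<close> with the surplus factors
  replaced by 1.\<close>

lemma prod_if_less: "q \<le> d \<Longrightarrow> (\<Prod>i<d. if i < q then c else 1) = (c :: real) ^ q"
proof -
  assume "q \<le> d"
  have "(\<Prod>i<d. if i < q then c else 1) = (\<Prod>i\<in>{..<q}. c)"
    by (rule prod.mono_neutral_cong_right) (use \<open>q \<le> d\<close> in auto)
  then show ?thesis by simp
qed

lemma sum_if_less: "m \<le> (k :: nat) \<Longrightarrow> (\<Sum>b<k. if b < m then f b else 0) = (\<Sum>b<m. f b :: real)"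
proof -
  assume "m \<le> k"
  then show ?thesis by (intro sum.mono_neutral_cong_right) auto
qed

section \<open>The program\<close>

abbreviation num :: "nat \<Rightarrow> xexp" where
  "num c \<equiv> XNat (IC c)"

text \<open>Equality is expressed by two strict comparisons, the only test that the language
  offers.\<close>

definition xdelta :: "ix \<Rightarrow> ix \<Rightarrow> xexp" where
  "xdelta i j = XIf (XNat i) (XNat j) (num 0) (XIf (XNat j) (XNat i) (num 0) (num 1))"

lemma xval_xdelta [simp]:
  "xval n d env q \<rho> (xdelta i j) = (if ixv n d env q i = ixv n d env q j then 1 else 0)"
  by (simp add: xdelta_def)

lemma reads_xdelta [simp]: "reads (xdelta i j) = {}"
  by (simp add: xdelta_def)

text \<open>The buffer \<open>W\<close> is there because a table entry may not read the array that
  is being written.\<close>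

definition pow_stmt :: "string \<Rightarrow> string \<Rightarrow> bnd \<Rightarrow> stmt" where
  "pow_stmt m p b = Tab p [IC 0] [BD, BD] (xdelta (IV 0) (IV 1)) ;;
     For b (Tab ''W'' [] [BD, BD] (XSum BD (XMul (XArr m [IV 1, IV 3]) (XArr p [IV 0, IV 3, IV 2]))) ;;
            Tab p [IAdd (IV 0) (IC 1)] [BD, BD] (XArr ''W'' [IV 1, IV 2]))"

lemma pow_stmt_correct:
  assumes "m \<noteq> p" "m \<noteq> ''W''" "p \<noteq> ''W''" and "a \<le> bndv n d b" "j < d" "k < d"
  shows "snd (sem n d [] (pow_stmt m p b) (q, \<rho>)) p [a, j, k] = mpow d (\<lambda>j k. \<rho> m [j, k]) a j k"
proof -
  let ?M = "\<lambda>j k. \<rho> m [j, k]"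
  let ?P = "\<lambda>i (st :: nat \<times> arrays). (\<forall>a\<le>i. \<forall>j<d. \<forall>k<d. snd st p [a, j, k] = mpow d ?M a j k) \<and> snd st m = \<rho> m"
  let ?c = "Tab ''W'' [] [BD, BD] (XSum BD (XMul (XArr m [IV 1, IV 3]) (XArr p [IV 0, IV 3, IV 2]))) ;;
            Tab p [IAdd (IV 0) (IC 1)] [BD, BD] (XArr ''W'' [IV 1, IV 2])"
  have "?P (bndv n d b) (iter_upto (\<lambda>i. sem n d ([] @ [i]) ?c) (bndv n d b)
      (sem n d [] (Tab p [IC 0] [BD, BD] (xdelta (IV 0) (IV 1))) (q, \<rho>)))"
  proof (rule iter_upto_invariant[where P = ?P])
    show "?P 0 (sem n d [] (Tab p [IC 0] [BD, BD] (xdelta (IV 0) (IV 1))) (q, \<rho>))"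
      using assms by (simp add: idm_def)
  next
    fix i st assume i: "?P i st"
    obtain q' \<rho>' where st: "st = (q', \<rho>')" by (cases st)
    show "?P (Suc i) (sem n d ([] @ [i]) ?c st)"
      using i assms by (auto simp: st le_Suc_eq mm_def)
  qed
  then show ?thesis using assms by (simp add: pow_stmt_def)
qed

definition xsq :: "ix \<Rightarrow> xexp" where
  "xsq i = XMul (XArr ''x'' [i]) (XArr ''x'' [i])"

definition xalive :: "ix \<Rightarrow> xexp \<Rightarrow> xexp" where
  "xalive i e = XIf (xsq i) (num 1) e (num 0)"

lemma xval_xsq [simp]: "xval n d env q \<rho> (xsq i) = (\<rho> ''x'' [ixv n d env q i])\<^sup>2"
  by (simp add: xsq_def power2_eq_square)

lemma xval_xalive [simp]: "xval n d env q \<rho> (xalive i e) =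
    (if (\<rho> ''x'' [ixv n d env q i])\<^sup>2 < 1 then xval n d env q \<rho> e else 0)"
  by (simp add: xalive_def)

lemma reads_xsq [simp]: "reads (xsq i) = {''x''}"
  by (simp add: xsq_def)

lemma reads_xalive [simp]: "reads (xalive i e) = {''x''} \<union> reads e"
  by (simp add: xalive_def)

definition xtwice :: "ix \<Rightarrow> ix" where
  "xtwice p = IAdd p p"

lemma ixv_xtwice [simp]: "ixv n d env q (xtwice p) = 2 * ixv n d env q p"
  by (simp add: xtwice_def)

text \<open>Meant to stand below exactly two binders, the row and the column. \<open>PA\<close>
  holds the products of powers of \<open>M\<close> with the input matrices. The guard cuts the range
  \<open>b < 2 d\<close> down to \<open>b < 2 p - 1\<close>, since \<open>p\<close> may be the
  computed \<open>q\<close>.\<close>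

definition xhess :: "ix \<Rightarrow> xexp" where
  "xhess p = XSum (BAdd BD BD) (XIf (XNat (IAdd (IV 2) (IC 1))) (XNat (xtwice p))
     (XMul (XNat (ISub (ISub (xtwice p) (IC 1)) (IV 2)))
        (XSum BD (XSum BD (XMul (XArr ''PA'' [IV 0, ISub (ISub (xtwice p) (IC 2)) (IV 2), IV 3, IV 4])
                                (XArr ''PA'' [IV 1, IV 2, IV 4, IV 3])))))
     (num 0))"

definition xhpot :: "ix \<Rightarrow> string \<Rightarrow> string \<Rightarrow> string \<Rightarrow> xexp" where
  "xhpot p B N D = XSub (XDiv (xhess p) (XMul (XArr B []) (XArr D [])))
     (XMul (xdelta (IV 0) (IV 1))
        (XDiv (XMul (XNat p) (XArr N [])) (XMul (XMul (num 16) (XNat IN)) (XArr D []))))"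

definition xgpot :: "ix \<Rightarrow> string \<Rightarrow> string \<Rightarrow> xexp" where
  "xgpot p B D = XDiv (XMul (XNat (xtwice p)) (XSum BD (XArr ''PA'' [IV 0, ISub (xtwice p) (IC 1), IV 1, IV 1])))
     (XMul (XArr B []) (XArr D []))"

lemma reads_xhpot [simp]: "reads (xhpot p B N D) = {''PA'', B, N, D}"
  by (auto simp: xhpot_def xhess_def)

lemma reads_xgpot [simp]: "reads (xgpot p B D) = {''PA'', B, D}"
  by (auto simp: xgpot_def)

text \<open>A whole row of coefficients is filled. Those whose index is not below the current one
  involve stale data and are masked out in \<open>gs_vector\<close>.\<close>

abbreviation gs_coeff :: stmt where
  "gs_coeff \<equiv> Tab ''cf'' [IV 0] [BN] (XDiv (XSum BN (XSum BN (XMul (XMul (XArr ''w'' [IV 1, IV 2]) (XArr ''G'' [IV 2, IV 3])) (XArr ''b'' [IV 0, IV 3])))) (XArr ''g'' [IV 1]))"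

abbreviation gs_vector :: stmt where
  "gs_vector \<equiv> Tab ''wt'' [] [BN] (XSub (XArr ''b'' [IV 0, IV 1]) (XSum BN (XIf (XNat (IV 2)) (XNat (IV 0)) (XMul (XArr ''cf'' [IV 0, IV 2]) (XArr ''w'' [IV 2, IV 1])) (num 0))))"

abbreviation gs_save :: stmt where
  "gs_save \<equiv> Tab ''w'' [IV 0] [BN] (XArr ''wt'' [IV 1])"

abbreviation gs_form :: stmt where
  "gs_form \<equiv> Tab ''g'' [IV 0] [] (XSum BN (XSum BN (XMul (XMul (XArr ''wt'' [IV 1]) (XArr ''G'' [IV 1, IV 2])) (XArr ''wt'' [IV 2]))))"

abbreviation gs_norm :: stmt where
  "gs_norm \<equiv> Tab ''nz'' [] [] (XSum BN (XIf (XArr ''wt'' [IV 1]) (num 0) (XSub (num 0) (XArr ''wt'' [IV 1])) (XArr ''wt'' [IV 1])))"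

text \<open>A nonzero vector is accepted if \<open>0 < g\<close> fails, and is normalised in the l1
  norm; later acceptable vectors overwrite earlier ones.\<close>

abbreviation gs_select :: stmt where
  "gs_select \<equiv> Cond (num 0) (XArr ''nz'' []) (Cond (XIf (num 0) (XArr ''g'' [IV 0]) (num 1) (num 0)) (num 1) (Tab ''v'' [] [BN] (XDiv (XArr ''wt'' [IV 1]) (XArr ''nz'' []))))"

abbreviation basis_stmt :: stmt where
  "basis_stmt \<equiv> Tab ''xf'' [] [] (XSum BN (xalive (IV 0) (xsq (IV 0)))) ;;
     Tab ''b'' [] [BN, BN] (xalive (IV 0) (xalive (IV 1) (XSub (xdelta (IV 0) (IV 1)) (XDiv (XMul (XArr ''x'' [IV 0]) (XArr ''x'' [IV 1])) (XArr ''xf'' [])))))"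

abbreviation matrix_stmt :: stmt where
  "matrix_stmt \<equiv> Tab ''M'' [] [BD, BD] (XSum BN (XMul (XArr ''x'' [IV 2]) (XArr ''A'' [IV 2, IV 0, IV 1])))"

abbreviation gradient_stmt :: stmt where
  "gradient_stmt \<equiv> Tab ''c'' [] [] (XSum BN (XMul (XArr ''v'' [IV 0]) (XAdd (xgpot IQ ''Bq'' ''Dq'') (xgpot ID ''Bd'' ''Dd''))))"

text \<open>A change of sign does not affect the quadratic form, so it can be used to make the first
  order term nonpositive.\<close>

abbreviation orient_stmt :: stmt where
  "orient_stmt \<equiv> Tab ''u'' [] [BN] (XIf (num 0) (XArr ''c'' []) (XSub (num 0) (XArr ''v'' [IV 0])) (XArr ''v'' [IV 0]))"

abbreviation length_stmt :: stmt where
  "length_stmt \<equiv> Tab ''t'' [] [] (XDiv (num 1) (XMul (XMul (num 256) (XMul (XMul (XNat ID) (XNat ID)) (XNat ID))) (XMul (XNat IN) (XNat IN))))"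

abbreviation clip_stmt :: stmt where
  "clip_stmt \<equiv> Tab ''y'' [] [] (XAdd (XArr ''x'' [IV 0]) (XMul (XArr ''t'' []) (XArr ''u'' [IV 0]))) ;;
     Tab ''r'' [] [] (XIf (num 1) (XArr ''y'' []) (XDiv (XSub (num 1) (XArr ''x'' [IV 0])) (XArr ''u'' [IV 0])) (XIf (XArr ''y'' []) (XSub (num 0) (num 1)) (XDiv (XSub (XSub (num 0) (num 1)) (XArr ''x'' [IV 0])) (XArr ''u'' [IV 0])) (XArr ''t'' []))) ;;
     Tab ''t'' [] [] (XArr ''r'' [])"

abbreviation move_stmt :: stmt where
  "move_stmt \<equiv> Tab ''z'' [] [BN] (XAdd (XArr ''x'' [IV 0]) (XMul (XArr ''t'' []) (XArr ''u'' [IV 0]))) ;;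
     Tab ''x'' [] [BN] (XArr ''z'' [IV 0])"

abbreviation square_stmt :: stmt where
  "square_stmt \<equiv> Tab ''S'' [] [BD, BD] (XSum BN (XSum BD (XMul (XArr ''A'' [IV 2, IV 0, IV 3]) (XArr ''A'' [IV 2, IV 3, IV 1]))))"

abbreviation halve_stmt :: stmt where
  "halve_stmt \<equiv> Tab ''t'' [] [] (XIf (XProd BD (XDiv (XArr ''sigma'' []) (num 2))) (XArr ''r'' []) (XArr ''sigma'' []) (XDiv (XArr ''sigma'' []) (num 2))) ;;
     Tab ''sigma'' [] [] (XArr ''t'' [])"

text \<open>Both sides of \<open>sqrt n * \<sigma> * 2^q < T\<close> are squared, which removes the
  root and turns powers of 2 into powers of 4.\<close>

abbreviation raise_q_stmt :: stmt where
  "raise_q_stmt \<equiv> Cond (XMul (XMul (XNat IN) (XMul (XArr ''sigma'' []) (XArr ''sigma'' []))) (XProd BD (XIf (XNat (IV 1)) (XNat IQ) (num 4) (num 1)))) (XMul (XArr ''T'' []) (XArr ''T'' [])) (SetQ (IAdd IQ (IC 1)))"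

text \<open>Starting from the all-ones vector stops the walk at once. This is the output for
  \<open>n < 16\<close>, where a trivial bound is good enough, and for a family of zero
  matrices.\<close>

abbreviation scale_stmt :: stmt where
  "scale_stmt \<equiv> Tab ''Bq'' [] [] (XMul (XProd BD (XIf (XNat (IV 0)) (XNat IQ) (XMul (XMul (num 512) (XNat IQ)) (XArr ''sigma'' [])) (num 1))) (XDiv (XArr ''T'' []) (XArr ''sigma'' []))) ;;
     Tab ''Bd'' [] [] (XMul (XProd BD (XMul (XMul (num 131072) (XNat IQ)) (XArr ''sigma'' []))) (XDiv (XArr ''T'' []) (XArr ''sigma'' []))) ;;
     Tab ''x'' [] [BN] (XIf (XNat IN) (num 16) (num 1) (XIf (num 0) (XArr ''T'' []) (num 0) (num 1)))"

section \<open>The stages of one step and of the initialisation\<close>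

definition potential_stmt :: stmt where
  "potential_stmt =
     matrix_stmt ;;
     pow_stmt ''M'' ''P'' (BAdd BD BD) ;;
     Tab ''s'' [] [] (XAdd (num 1) (XDiv (XSum BN (xsq (IV 0))) (XNat IN))) ;;
     Tab ''Nq'' [] [] (XAdd (num 1) (XDiv (XSum BD (XArr ''P'' [xtwice IQ, IV 0, IV 0])) (XArr ''Bq'' []))) ;;
     Tab ''Nd'' [] [] (XAdd (num 1) (XDiv (XSum BD (XArr ''P'' [xtwice ID, IV 0, IV 0])) (XArr ''Bd'' []))) ;;
     Tab ''Dq'' [] [] (XProd BD (XIf (XNat (IV 0)) (XNat IQ) (XArr ''s'' []) (num 1))) ;;
     Tab ''Dd'' [] [] (XProd BD (XArr ''s'' [])) ;;
     Tab ''PA'' [] [BN, BAdd BD BD, BD, BD] (XSum BD (XMul (XArr ''P'' [IV 1, IV 2, IV 4]) (XArr ''A'' [IV 0, IV 4, IV 3]))) ;;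
     Tab ''G'' [] [BN, BN] (XAdd (xhpot IQ ''Bq'' ''Nq'' ''Dq'') (xhpot ID ''Bd'' ''Nd'' ''Dd''))"

definition direction_stmt :: stmt where
  "direction_stmt =
     basis_stmt ;;
     For BN (
       gs_coeff ;;
       gs_vector ;;
       gs_save ;;
       gs_form ;;
       gs_norm ;;
       gs_select)"

definition line_stmt :: stmt where
  "line_stmt =
     gradient_stmt ;;
     orient_stmt ;;
     length_stmt ;;
     For BN (
       clip_stmt) ;;
     move_stmt"

definition step_stmt :: stmt where
  "step_stmt = Cond (XNat IN) (XMul (num 2) (XSum BN (xalive (IV 0) (num 1))))
     (potential_stmt ;; direction_stmt ;; line_stmt)"

definition init_stmt :: stmt where
  "init_stmt =
     square_stmt ;;
     pow_stmt ''S'' ''P'' BD ;;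
     Tab ''T'' [] [] (XSum BD (XArr ''S'' [IV 0, IV 0])) ;;
     Tab ''r'' [] [] (XSum BD (XArr ''P'' [ID, IV 0, IV 0])) ;;
     Tab ''sigma'' [] [] (XArr ''T'' []) ;;
     For BD (
       halve_stmt) ;;
     SetQ (IC 1) ;;
     For BD (raise_q_stmt) ;;
     scale_stmt"

lemma wf_init_stmt: "wf_stmt init_stmt"
  by (simp add: init_stmt_def pow_stmt_def)

lemma wf_step_stmt: "wf_stmt step_stmt"
  by (simp add: step_stmt_def potential_stmt_def direction_stmt_def line_stmt_def pow_stmt_def)

section \<open>One step of the program\<close>

lemma sem_seq: "sem n d env (s ;; s') st = sem n d env s' (sem n d env s st)"
  by simp

lemma sem_eqI: "\<not> sets_q s \<Longrightarrow> snd (sem n d env s (q, \<rho>)) = \<rho>' \<Longrightarrow> sem n d env s (q, \<rho>) = (q, \<rho>')"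
  using sem_frame_q[of s n d env "(q, \<rho>)"] by (simp add: prod_eq_iff)

text \<open>Shortening a step keeps the earlier coordinates inside the interval by convexity, since
  the starting point is inside. The last coordinate that shortens the step lands exactly on a
  face.\<close>

lemma line_search:
  fixes x u :: "nat \<Rightarrow> real"
  assumes f: "\<And>i t. f i t = (if 1 < x i + t * u i then (1 - x i) / u i
      else if x i + t * u i < - 1 then (- 1 - x i) / u i else t)"
    and x: "\<And>i. i < m \<Longrightarrow> \<bar>x i\<bar> \<le> 1" and t0: "0 \<le> t0"
  defines "t \<equiv> iter_upto f m t0"
  shows "0 \<le> t \<and> t \<le> t0 \<and> (\<forall>i<m. \<bar>x i + t * u i\<bar> \<le> 1) \<and>
     (t = t0 \<or> (\<exists>i<m. u i \<noteq> 0 \<and> \<bar>x i + t * u i\<bar> = 1))"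
  unfolding t_def
proof (rule iter_upto_invariant[of "\<lambda>k t. 0 \<le> t \<and> t \<le> t0 \<and> (\<forall>i<k. \<bar>x i + t * u i\<bar> \<le> 1) \<and>
     (t = t0 \<or> (\<exists>i<k. u i \<noteq> 0 \<and> \<bar>x i + t * u i\<bar> = 1))"])
  show "0 \<le> t0 \<and> t0 \<le> t0 \<and> (\<forall>i<0. \<bar>x i + t0 * u i\<bar> \<le> 1) \<and>
     (t0 = t0 \<or> (\<exists>i<0. u i \<noteq> 0 \<and> \<bar>x i + t0 * u i\<bar> = 1))" using t0 by simp
next
  fix k t
  assume k: "k < m" and *: "0 \<le> t \<and> t \<le> t0 \<and> (\<forall>i<k. \<bar>x i + t * u i\<bar> \<le> 1) \<and>
     (t = t0 \<or> (\<exists>i<k. u i \<noteq> 0 \<and> \<bar>x i + t * u i\<bar> = 1))"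
  let ?Q = "\<lambda>t'. 0 \<le> t' \<and> t' \<le> t0 \<and> (\<forall>i<Suc k. \<bar>x i + t' * u i\<bar> \<le> 1) \<and>
     (t' = t0 \<or> (\<exists>i<Suc k. u i \<noteq> 0 \<and> \<bar>x i + t' * u i\<bar> = 1))"
  have xk: "\<bar>x k\<bar> \<le> 1" using x k by simp
  have shrink: "\<bar>x i + t' * u i\<bar> \<le> 1" if "i < k" "0 \<le> t'" "t' \<le> t" for i t'
  proof -
    have 1: "\<bar>x i + t * u i\<bar> \<le> 1" "\<bar>x i\<bar> \<le> 1" using * x k that by auto
    show ?thesis
    proof (cases "0 \<le> u i")
      case True
      then have "0 \<le> t' * u i" "t' * u i \<le> t * u i" using that by (auto intro: mult_right_mono)
      then show ?thesis using 1 by linarith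
    next
      case False
      then have "t' * u i \<le> 0" "t * u i \<le> t' * u i"
        using that by (auto simp: mult_nonneg_nonpos mult_right_mono_neg)
      then show ?thesis using 1 by linarith
    qed
  qed
  have hit: "?Q t'" if "u k \<noteq> 0" "0 \<le> t'" "t' \<le> t" "\<bar>x k + t' * u k\<bar> = 1" for t'
    using that * shrink by (auto simp: less_Suc_eq)
  consider "1 < x k + t * u k" | "\<not> 1 < x k + t * u k" "x k + t * u k < - 1"
    | "\<not> 1 < x k + t * u k" "\<not> x k + t * u k < - 1" by blast
  then show "?Q (f k t)"
  proof cases
    case 1
    then have "0 < t * u k" using xk by linarith
    then have u: "0 < u k" using * by (simp add: zero_less_mult_iff)
    have "?Q ((1 - x k) / u k)"
    proof (rule hit)
      show "(1 - x k) / u k \<le> t" using u 1 by (simp add: divide_le_eq)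
      show "\<bar>x k + (1 - x k) / u k * u k\<bar> = 1" using u by simp
    qed (use u xk in auto)
    then show ?thesis using 1 by (simp add: f)
  next
    case 2
    then have "t * u k < 0" using xk by linarith
    then have u: "u k < 0" using * by (simp add: mult_less_0_iff)
    have "?Q ((- 1 - x k) / u k)"
    proof (rule hit)
      show "(- 1 - x k) / u k \<le> t" using u 2 by (simp add: divide_le_eq)
      show "\<bar>x k + (- 1 - x k) / u k * u k\<bar> = 1" using u by simp
      show "0 \<le> (- 1 - x k) / u k" using u xk by (simp add: divide_nonpos_neg)
    qed (use u in auto)
    then show ?thesis using 2 by (simp add: f)
  next
    case 3
    then have "?Q t" using * by (auto simp: less_Suc_eq)
    then show ?thesis using 3 by (simp add: f)
  qed
qed

lemma sum_indicator_alive: "(\<Sum>i<n. if (x i)\<^sup>2 < 1 then 1 else 0) = real (card (alive n x))"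
proof -
  have "(\<Sum>i<n. if (x i)\<^sup>2 < 1 then 1 else 0) = (\<Sum>i\<in>alive n x. 1 :: real)"
    by (rule sum.mono_neutral_cong_right) (auto simp: alive_def)
  then show ?thesis by simp
qed

section \<open>Correctness of the potential, the direction and the line search\<close>

context matrix_family
begin

definition holds_input :: "nat \<Rightarrow> arrays \<Rightarrow> bool" where
  "holds_input q \<rho> \<longleftrightarrow> (\<forall>i<n. \<forall>j<d. \<forall>k<d. \<rho> ''A'' [i, j, k] = A i j k) \<and> \<rho> ''Bq'' [] = Bq q \<and> \<rho> ''Bd'' [] = Bd q"

definition holds_potential :: "nat \<Rightarrow> (nat \<Rightarrow> real) \<Rightarrow> arrays \<Rightarrow> bool" where
  "holds_potential q x \<rho> \<longleftrightarrow>
     (\<forall>i<n. \<forall>l<n. \<rho> ''G'' [i, l] = Hess q x i l) \<and>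
     (\<forall>i<n. \<forall>a<2 * d. \<forall>j<d. \<forall>k<d. \<rho> ''PA'' [i, a, j, k] = mm d (mpow d (comb x) a) (A i) j k) \<and>
     \<rho> ''Dq'' [] = (1 + sq x) ^ q \<and> \<rho> ''Dd'' [] = (1 + sq x) ^ d"

lemma xval_xhpot:
  assumes PA: "\<And>i a j k. i < n \<Longrightarrow> a < 2 * d \<Longrightarrow> j < d \<Longrightarrow> k < d \<Longrightarrow>
      \<rho> ''PA'' [i, a, j, k] = mm d (mpow d (comb x) a) (A i) j k"
    and il: "i < n" "l < n" and p: "\<And>env. ixv n d env q pe = p" "0 < p" "p \<le> d"
    and r: "\<rho> B [] = b" "\<rho> N [] = 1 + Phi p x / b" "\<rho> D [] = (1 + sq x) ^ p"
  shows "xval n d [i, l] q \<rho> (xhpot pe B N D) = hpot p b x i l"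
proof -
  let ?f = "\<lambda>b. real (2 * p - 1 - b) * tr d (mm d (mm d (mpow d (comb x) (2 * p - 2 - b)) (A i)) (mm d (mpow d (comb x) b) (A l)))"
  have "xval n d [i, l] q \<rho> (xhess pe) = (\<Sum>b<d + d. if Suc b < 2 * p
      then real (2 * p - 1 - b) * (\<Sum>j<d. \<Sum>k<d. \<rho> ''PA'' [i, 2 * p - 2 - b, j, k] * \<rho> ''PA'' [l, b, k, j]) else 0)"
  proof -
    have "1 + real b < 2 * real p \<longleftrightarrow> Suc b < 2 * p" for b by linarith
    then show ?thesis by (simp add: xhess_def p(1))
  qed
  also have "\<dots> = (\<Sum>b<2 * d. if b < 2 * p - 1 then ?f b else 0)"
  proof (rule sum.cong)
    fix b assume "b \<in> {..<2 * d}"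
    have eq: "Suc b < 2 * p \<longleftrightarrow> b < 2 * p - 1" by auto
    show "(if Suc b < 2 * p
      then real (2 * p - 1 - b) * (\<Sum>j<d. \<Sum>k<d. \<rho> ''PA'' [i, 2 * p - 2 - b, j, k] * \<rho> ''PA'' [l, b, k, j]) else 0)
      = (if b < 2 * p - 1 then ?f b else 0)"
    proof (cases "b < 2 * p - 1")
      case True
      then have "2 * p - 2 - b < 2 * d" "b < 2 * d" using p by auto
      then have "(\<Sum>j<d. \<Sum>k<d. \<rho> ''PA'' [i, 2 * p - 2 - b, j, k] * \<rho> ''PA'' [l, b, k, j])
        = tr d (mm d (mm d (mpow d (comb x) (2 * p - 2 - b)) (A i)) (mm d (mpow d (comb x) b) (A l)))"
        unfolding tr_mm using il by (intro sum.cong refl) (simp only: PA lessThan_iff)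
      then show ?thesis using True by (simp only: eq if_True)
    next
      case False
      then show ?thesis by (simp only: eq if_False)
    qed
  qed (simp add: mult_2)
  also have "\<dots> = hess2 p x i l"
    unfolding hess2_def using p by (intro sum_if_less) simp
  finally show ?thesis
    using p r by (simp add: xhpot_def hpot_def)
qed


lemma xval_xgpot:
  assumes PA: "\<And>i a j k. i < n \<Longrightarrow> a < 2 * d \<Longrightarrow> j < d \<Longrightarrow> k < d \<Longrightarrow>
      \<rho> ''PA'' [i, a, j, k] = mm d (mpow d (comb x) a) (A i) j k"
    and i: "i < n" and p: "\<And>env. ixv n d env q pe = p" "0 < p" "p \<le> d"
    and r: "\<rho> B [] = b" "\<rho> D [] = (1 + sq x) ^ p"
  shows "xval n d [i] q \<rho> (xgpot pe B D) = gpot p b x i"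
proof -
  have "2 * p - 1 < 2 * d" using p by auto
  then have "(\<Sum>j<d. \<rho> ''PA'' [i, 2 * p - 1, j, j]) = tr d (mm d (mpow d (comb x) (2 * p - 1)) (A i))"
    unfolding tr_def using i by (intro sum.cong refl) (simp only: PA lessThan_iff)
  then show ?thesis
    using r by (simp add: xgpot_def gpot_def grad1_def p(1))
qed

lemma potential_stmt_correct:
  assumes q: "0 < q" "q \<le> d" and inp: "holds_input q \<rho>"
  shows "holds_potential q (\<lambda>i. \<rho> ''x'' [i]) (snd (sem n d [] potential_stmt (q, \<rho>)))"
proof -
  define x where "x = (\<lambda>i. \<rho> ''x'' [i])"
  have A: "\<rho> ''A'' [i, j, k] = A i j k" if "i < n" "j < d" "k < d" for i j k
    using inp that by (simp add: holds_input_def)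
  define \<rho>1 where "\<rho>1 = snd (sem n d [] (matrix_stmt) (q, \<rho>))"
  have M: "\<rho>1 ''M'' [j, k] = comb x j k" if "j < d" "k < d" for j k
    using that A unfolding \<rho>1_def by (simp add: comb_def x_def)
  define \<rho>2 where "\<rho>2 = snd (sem n d [] (pow_stmt ''M'' ''P'' (BAdd BD BD)) (q, \<rho>1))"
  have P: "\<rho>2 ''P'' [a, j, k] = mpow d (comb x) a j k" if "a \<le> 2 * d" "j < d" "k < d" for a j k
  proof -
    have "\<rho>2 ''P'' [a, j, k] = mpow d (\<lambda>j k. \<rho>1 ''M'' [j, k]) a j k"
      unfolding \<rho>2_def using that by (intro pow_stmt_correct) auto
    also have "\<dots> = mpow d (comb x) a j k" using M that by (intro mpow_cong) auto
    finally show ?thesis .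
  qed
  have fr2: "\<rho>2 a = \<rho> a" if "a \<notin> {''M'', ''P'', ''W''}" for a
    unfolding \<rho>2_def \<rho>1_def using that by (subst sem_frame) (auto simp: pow_stmt_def)
  have st2: "sem n d [] (pow_stmt ''M'' ''P'' (BAdd BD BD)) (q, \<rho>1) = (q, \<rho>2)"
    unfolding \<rho>2_def by (rule sem_eqI[OF _ refl]) (simp add: pow_stmt_def)
  define \<rho>3 where "\<rho>3 = snd (sem n d [] (
     Tab ''s'' [] [] (XAdd (num 1) (XDiv (XSum BN (xsq (IV 0))) (XNat IN))) ;;
     Tab ''Nq'' [] [] (XAdd (num 1) (XDiv (XSum BD (XArr ''P'' [xtwice IQ, IV 0, IV 0])) (XArr ''Bq'' []))) ;;
     Tab ''Nd'' [] [] (XAdd (num 1) (XDiv (XSum BD (XArr ''P'' [xtwice ID, IV 0, IV 0])) (XArr ''Bd'' []))) ;;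
     Tab ''Dq'' [] [] (XProd BD (XIf (XNat (IV 0)) (XNat IQ) (XArr ''s'' []) (num 1))) ;;
     Tab ''Dd'' [] [] (XProd BD (XArr ''s'' [])) ;;
     Tab ''PA'' [] [BN, BAdd BD BD, BD, BD] (XSum BD (XMul (XArr ''P'' [IV 1, IV 2, IV 4]) (XArr ''A'' [IV 0, IV 4, IV 3])))) (q, \<rho>2))"
  have s: "1 + (\<Sum>i<n. (\<rho> ''x'' [i])\<^sup>2) / real n = 1 + sq x"
    by (simp add: sq_def x_def)
  have trP: "(\<Sum>j<d. \<rho>2 ''P'' [2 * p, j, j]) = Phi p x" if "p \<le> d" for p
    unfolding Phi_def tr_def using P that by simp
  have 3: "\<rho>3 ''Nq'' [] = 1 + Phi q x / Bq q" "\<rho>3 ''Nd'' [] = 1 + Phi d x / Bd q"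
    "\<rho>3 ''Dq'' [] = (1 + sq x) ^ q" "\<rho>3 ''Dd'' [] = (1 + sq x) ^ d" "\<rho>3 ''Bq'' [] = Bq q" "\<rho>3 ''Bd'' [] = Bd q"
    unfolding \<rho>3_def using q inp trP[of q] trP[of d] by (simp_all add: fr2 s prod_if_less holds_input_def)
  have PA: "\<rho>3 ''PA'' [i, a, j, k] = mm d (mpow d (comb x) a) (A i) j k" if "i < n" "a < 2 * d" "j < d" "k < d" for i a j k
    unfolding \<rho>3_def using that P A by (simp add: fr2 mm_def mult_2)
  have G: "xval n d [i, l] q \<rho>3 (xhpot IQ ''Bq'' ''Nq'' ''Dq'') = hpot q (Bq q) x i l"
    "xval n d [i, l] q \<rho>3 (xhpot ID ''Bd'' ''Nd'' ''Dd'') = hpot d (Bd q) x i l" if "i < n" "l < n" for i l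
    using that q d_pos 3 PA by (auto intro!: xval_xhpot)
  have "snd (sem n d [] potential_stmt (q, \<rho>)) = snd (sem n d [] (Tab ''G'' [] [BN, BN] (XAdd (xhpot IQ ''Bq'' ''Nq'' ''Dq'') (xhpot ID ''Bd'' ''Nd'' ''Dd''))) (q, \<rho>3))"
  proof -
    have "sem n d [] (matrix_stmt) (q, \<rho>) = (q, \<rho>1)"
      unfolding \<rho>1_def by (rule sem_eqI[OF _ refl]) simp
    then show ?thesis unfolding potential_stmt_def \<rho>3_def sem_seq by (simp only: st2 sem.simps snd_conv)
  qed
  then show ?thesis
    unfolding holds_potential_def x_def[symmetric] using 3 PA G by (simp add: Hess_def)
qed

lemma direction_stmt_correct:
  assumes q: "16 \<le> n" "0 < q" "T \<le> sqrt (real n) * \<sigma> * 2 ^ q"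
    and x: "sq x \<le> 1" "Psi q x \<le> 2" "active n x" "x = (\<lambda>i. \<rho> ''x'' [i])"
    and G: "\<And>i l. i < n \<Longrightarrow> l < n \<Longrightarrow> \<rho> ''G'' [i, l] = Hess q x i l"
  defines "v \<equiv> \<lambda>i. snd (sem n d [] direction_stmt (q, \<rho>)) ''v'' [i]"
  shows "(\<forall>i<n. i \<notin> alive n x \<longrightarrow> v i = 0) \<and> ip n x v = 0 \<and> (\<Sum>i<n. \<bar>v i\<bar>) = 1 \<and> bil n (Hess q x) v v \<le> 0"
proof -
  define \<rho>1 where "\<rho>1 = snd (sem n d [] (
     basis_stmt) (q, \<rho>))"
  have xf: "(\<Sum>i<n. if (x i)\<^sup>2 < 1 then (x i)\<^sup>2 else 0) = (\<Sum>m\<in>alive n x. (x m)\<^sup>2)"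
    by (rule sum.mono_neutral_cong_right) (auto simp: alive_def)
  have b: "\<rho>1 ''b'' [i, l] = basis_vec n x i l" if "i < n" "l < n" for i l
    using that xf unfolding \<rho>1_def by (simp add: basis_vec_def alive_def x(4))
  have G1: "\<rho>1 ''G'' [i, l] = Hess q x i l" if "i < n" "l < n" for i l
    using that G unfolding \<rho>1_def by simp
  let ?c1 = "gs_coeff ;;
       gs_vector ;;
       gs_save ;;
       gs_form ;;
       gs_norm"
  let ?c2 = "gs_select"
  let ?c = "gs_coeff ;;
       gs_vector ;;
       gs_save ;;
       gs_form ;;
       gs_norm ;; ?c2"
  let ?H = "Hess q x" and ?b = "basis_vec n x"
  let ?w = "\<lambda>st k l. snd st ''w'' [k, l]" and ?cf = "\<lambda>st k j. snd st ''cf'' [k, j]" and ?g = "\<lambda>st k. snd st ''g'' [k]"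
  let ?good = "\<lambda>st k. bil n ?H (?w st k) (?w st k) \<le> 0 \<and> 0 < (\<Sum>l<n. \<bar>?w st k l\<bar>)"
  \<comment> \<open>After \<open>k\<close> rounds the first \<open>k\<close> rows obey the
    Gram-Schmidt recursion with the exact values of the form, and \<open>v\<close> is a normalised
    acceptable row as soon as one has occurred.\<close>
  define I where "I = (\<lambda>k (st :: nat \<times> arrays). snd st ''b'' = \<rho>1 ''b'' \<and> snd st ''G'' = \<rho>1 ''G'' \<and>
     (\<forall>j<k. \<forall>l<n. ?w st j l = ?b j l - (\<Sum>i<j. ?cf st j i * ?w st i l)) \<and>
     (\<forall>j<k. \<forall>i<j. ?cf st j i = bil n ?H (?w st i) (?b j) / bil n ?H (?w st i) (?w st i)) \<and>
     (\<forall>j<k. ?g st j = bil n ?H (?w st j) (?w st j)) \<and>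
     ((\<exists>j<k. ?good st j \<and> (\<forall>l<n. snd st ''v'' [l] = ?w st j l / (\<Sum>l<n. \<bar>?w st j l\<bar>))) \<or> (\<forall>j<k. \<not> ?good st j)))"
  have step: "I (Suc k) (sem n d ([] @ [k]) ?c st)" if k: "k < n" and I: "I k st" for k st
  proof -
    obtain q' \<rho>' where st: "st = (q', \<rho>')" by (cases st)
    note I' = I[unfolded I_def st snd_conv]
    have fr: "\<rho>' ''b'' = \<rho>1 ''b''" "\<rho>' ''G'' = \<rho>1 ''G''" using I' by blast+
    have w: "\<rho>' ''w'' [j, l] = ?b j l - (\<Sum>i<j. \<rho>' ''cf'' [j, i] * \<rho>' ''w'' [i, l])" if "j < k" "l < n" for j l
      using I' that by blast
    have cf: "\<rho>' ''cf'' [j, i] = bil n ?H (\<lambda>l. \<rho>' ''w'' [i, l]) (?b j) / bil n ?H (\<lambda>l. \<rho>' ''w'' [i, l]) (\<lambda>l. \<rho>' ''w'' [i, l])"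
      if "j < k" "i < j" for j i
      using I' that by blast
    have g: "\<rho>' ''g'' [j] = bil n ?H (\<lambda>l. \<rho>' ''w'' [j, l]) (\<lambda>l. \<rho>' ''w'' [j, l])" if "j < k" for j
      using I' that by blast
    have good: "(\<exists>j<k. ?good (q', \<rho>') j \<and> (\<forall>l<n. \<rho>' ''v'' [l] = \<rho>' ''w'' [j, l] / (\<Sum>l<n. \<bar>\<rho>' ''w'' [j, l]\<bar>))) \<or> (\<forall>j<k. \<not> ?good (q', \<rho>') j)"
      using I' unfolding snd_conv by blast
    define cfk where "cfk = (\<lambda>j. (\<Sum>i<n. \<Sum>l<n. \<rho>' ''w'' [j, i] * \<rho>1 ''G'' [i, l] * \<rho>1 ''b'' [k, l]) / \<rho>' ''g'' [j])"
    have cfk: "cfk j = bil n ?H (\<lambda>l. \<rho>' ''w'' [j, l]) (?b k) / bil n ?H (\<lambda>l. \<rho>' ''w'' [j, l]) (\<lambda>l. \<rho>' ''w'' [j, l])"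
      if "j < k" for j
    proof -
      have "(\<Sum>i<n. \<Sum>l<n. \<rho>' ''w'' [j, i] * \<rho>1 ''G'' [i, l] * \<rho>1 ''b'' [k, l]) = bil n ?H (\<lambda>l. \<rho>' ''w'' [j, l]) (?b k)"
        unfolding bil_def using G1 b k by (intro sum.cong refl) simp
      then show ?thesis using g[OF that] by (simp add: cfk_def)
    qed
    define wk where "wk = (\<lambda>l. ?b k l - (\<Sum>i<k. cfk i * \<rho>' ''w'' [i, l]))"
    define \<rho>2 where "\<rho>2 = snd (sem n d [k] ?c1 (q', \<rho>'))"
    have wt: "\<rho>1 ''b'' [k, l] - (\<Sum>i<n. if i < k then cfk i * \<rho>' ''w'' [i, l] else 0) = wk l" if "l < n" for l
      using sum_if_less[of k n "\<lambda>i. cfk i * \<rho>' ''w'' [i, l]"] k b[OF k that] by (simp add: wk_def)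
    have fr2: "\<rho>2 a = \<rho>' a" if "a \<notin> {''cf'', ''wt'', ''w'', ''g'', ''nz''}" for a
      unfolding \<rho>2_def using that by (subst sem_frame) auto
    let ?t1 = "gs_coeff"
    let ?t2 = "gs_vector"
    let ?t3 = "gs_save"
    let ?t4 = "gs_form"
    let ?t5 = "gs_norm"
    define a1 where "a1 = snd (sem n d [k] ?t1 (q', \<rho>'))"
    define a2 where "a2 = snd (sem n d [k] ?t2 (q', a1))"
    define a3 where "a3 = snd (sem n d [k] ?t3 (q', a2))"
    define a4 where "a4 = snd (sem n d [k] ?t4 (q', a3))"
    define a5 where "a5 = snd (sem n d [k] ?t5 (q', a4))"
    have s1: "sem n d [k] ?t1 (q', \<rho>') = (q', a1)" unfolding a1_def by (rule sem_eqI[OF _ refl]) simp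
    have s2: "sem n d [k] ?t2 (q', a1) = (q', a2)" unfolding a2_def by (rule sem_eqI[OF _ refl]) simp
    have s3: "sem n d [k] ?t3 (q', a2) = (q', a3)" unfolding a3_def by (rule sem_eqI[OF _ refl]) simp
    have s4: "sem n d [k] ?t4 (q', a3) = (q', a4)" unfolding a4_def by (rule sem_eqI[OF _ refl]) simp
    have \<rho>2: "\<rho>2 = a5" unfolding \<rho>2_def a5_def sem_seq s1 s2 s3 s4 ..
    have f1: "a1 a = \<rho>' a" if "a \<noteq> ''cf''" for a unfolding a1_def using that by (subst sem_frame) auto
    have f2: "a2 a = a1 a" if "a \<noteq> ''wt''" for a unfolding a2_def using that by (subst sem_frame) auto
    have f3: "a3 a = a2 a" if "a \<noteq> ''w''" for a unfolding a3_def using that by (subst sem_frame) auto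
    have f4: "a4 a = a3 a" if "a \<noteq> ''g''" for a unfolding a4_def using that by (subst sem_frame) auto
    have f5: "a5 a = a4 a" if "a \<noteq> ''nz''" for a unfolding a5_def using that by (subst sem_frame) auto
    have a1cf: "a1 ''cf'' [j, i] = (if j = k \<and> i < n then cfk i else \<rho>' ''cf'' [j, i])" for j i
      unfolding a1_def by (simp add: fr cfk_def)
    have cf2: "\<rho>2 ''cf'' [j, i] = (if j = k \<and> i < n then cfk i else \<rho>' ''cf'' [j, i])" for j i
      using a1cf by (simp add: \<rho>2 f5 f4 f3 f2)
    have a2wt: "a2 ''wt'' [l] = wk l" if "l < n" for l
    proof -
      have "a2 ''wt'' [l] = a1 ''b'' [k, l] - (\<Sum>i<n. if i < k then a1 ''cf'' [k, i] * a1 ''w'' [i, l] else 0)"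
        unfolding a2_def using that by simp
      also have "\<dots> = \<rho>1 ''b'' [k, l] - (\<Sum>i<n. if i < k then cfk i * \<rho>' ''w'' [i, l] else 0)"
        by (simp add: f1 a1cf fr cong: sum.cong_simp)
      finally show ?thesis using wt[OF that] by simp
    qed
    have wt2: "\<rho>2 ''wt'' [l] = wk l" if "l < n" for l
      using a2wt[OF that] by (simp add: \<rho>2 f5 f4 f3)
    have a3w: "a3 ''w'' [j, l] = (if j = k \<and> l < n then wk l else \<rho>' ''w'' [j, l])" for j l
      unfolding a3_def using a2wt[of l] by (simp add: f2 f1)
    then have w2: "\<rho>2 ''w'' [j, l] = (if j = k \<and> l < n then wk l else \<rho>' ''w'' [j, l])" for j l
      by (simp add: \<rho>2 f5 f4)
    have a3wt: "a3 ''wt'' [l] = wk l" "a4 ''wt'' [l] = wk l" if "l < n" for l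
      using a2wt[OF that] by (simp_all add: f3 f4)
    have a3G: "a3 ''G'' [i, l] = ?H i l" if "i < n" "l < n" for i l
      using G1[OF that] by (simp add: f3 f2 f1 fr)
    have "a4 ''g'' [k] = (\<Sum>i<n. \<Sum>l<n. a3 ''wt'' [i] * a3 ''G'' [i, l] * a3 ''wt'' [l])"
      unfolding a4_def by simp
    also have "\<dots> = bil n ?H wk wk"
      unfolding bil_def by (intro sum.cong refl) (simp add: a3wt a3G)
    finally have gk: "\<rho>2 ''g'' [k] = bil n ?H wk wk" by (simp add: \<rho>2 f5)
    have g2: "\<rho>2 ''g'' [j] = \<rho>' ''g'' [j]" if "j \<noteq> k" for j
    proof -
      have "a4 ''g'' [j] = a3 ''g'' [j]" unfolding a4_def using that by simp
      then show ?thesis by (simp add: \<rho>2 f5 f3 f2 f1)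
    qed
    have "a5 ''nz'' [] = (\<Sum>l<n. if a4 ''wt'' [l] < 0 then 0 - a4 ''wt'' [l] else a4 ''wt'' [l])"
      unfolding a5_def by simp
    also have "\<dots> = (\<Sum>l<n. \<bar>wk l\<bar>)"
      by (intro sum.cong refl) (simp add: a3wt abs_real_def)
    finally have nz: "\<rho>2 ''nz'' [] = (\<Sum>l<n. \<bar>wk l\<bar>)" by (simp add: \<rho>2)
    let ?P = "bil n ?H wk wk \<le> 0 \<and> 0 < (\<Sum>l<n. \<bar>wk l\<bar>)"
    define \<rho>3 where "\<rho>3 = snd (sem n d [k] ?c st)"
    have "sem n d [k] ?c1 st = (q', \<rho>2)"
      unfolding st \<rho>2_def by (rule sem_eqI[OF _ refl]) simp
    then have r3: "\<rho>3 = snd (sem n d [k] ?c2 (q', \<rho>2))"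
      unfolding \<rho>3_def by (simp only: sem_seq)
    have fr3: "\<rho>3 a = \<rho>2 a" if "a \<noteq> ''v''" for a
      unfolding r3 using that by (subst sem_frame) auto
    have v3: "\<rho>3 ''v'' [l] = (if ?P then wk l / (\<Sum>l<n. \<bar>wk l\<bar>) else \<rho>' ''v'' [l])" if "l < n" for l
      unfolding r3 using that wt2[OF that] by (auto simp: nz gk fr2)
    have wold: "(\<lambda>l. \<rho>3 ''w'' [j, l]) = (\<lambda>l. \<rho>' ''w'' [j, l])" if "j < k" for j
      using that by (simp add: fr3 w2)
    have wnew: "\<rho>3 ''w'' [k, l] = wk l" if "l < n" for l
      using that by (simp add: fr3 w2)
    have bnew: "bil n ?H (\<lambda>l. \<rho>3 ''w'' [k, l]) (\<lambda>l. \<rho>3 ''w'' [k, l]) = bil n ?H wk wk"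
      using wnew by (intro bil_cong) auto
    have nnew: "(\<Sum>l<n. \<bar>\<rho>3 ''w'' [k, l]\<bar>) = (\<Sum>l<n. \<bar>wk l\<bar>)"
      using wnew by (intro sum.cong) auto
    have old: "\<rho>3 ''w'' [j, l] = \<rho>' ''w'' [j, l]" "\<rho>3 ''cf'' [j, i] = \<rho>' ''cf'' [j, i]" "\<rho>3 ''g'' [j] = \<rho>' ''g'' [j]"
      if "j < k" for j l i
      using that by (simp_all add: fr3 w2 cf2 g2)
    have c1: "\<rho>3 ''w'' [j, l] = ?b j l - (\<Sum>i<j. \<rho>3 ''cf'' [j, i] * \<rho>3 ''w'' [i, l])" if "j < Suc k" "l < n" for j l
    proof (cases "j = k")
      case True
      have "(\<Sum>i<k. \<rho>3 ''cf'' [k, i] * \<rho>3 ''w'' [i, l]) = (\<Sum>i<k. cfk i * \<rho>' ''w'' [i, l])"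
        using k by (intro sum.cong refl) (simp add: old fr3 cf2 w2)
      then show ?thesis using wnew[OF that(2)] True by (simp add: wk_def)
    next
      case False
      then have jk: "j < k" using that by simp
      have "(\<Sum>i<j. \<rho>3 ''cf'' [j, i] * \<rho>3 ''w'' [i, l]) = (\<Sum>i<j. \<rho>' ''cf'' [j, i] * \<rho>' ''w'' [i, l])"
        using jk by (intro sum.cong refl) (simp add: old)
      then show ?thesis using w[OF jk that(2)] old(1)[OF jk] by simp
    qed
    have c2: "\<rho>3 ''cf'' [j, i] = bil n ?H (\<lambda>l. \<rho>3 ''w'' [i, l]) (?b j) / bil n ?H (\<lambda>l. \<rho>3 ''w'' [i, l]) (\<lambda>l. \<rho>3 ''w'' [i, l])"
      if "j < Suc k" "i < j" for i j
    proof (cases "j = k")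
      case True
      have "\<rho>3 ''cf'' [k, i] = cfk i" using that True k by (simp add: fr3 cf2)
      then show ?thesis using cfk[of i] wold[of i] that True by simp
    next
      case False
      then have "j < k" "i < k" using that by auto
      then show ?thesis using cf[of j i] old(2)[of j i] wold[of i] that by simp
    qed
    have c3: "\<rho>3 ''g'' [j] = bil n ?H (\<lambda>l. \<rho>3 ''w'' [j, l]) (\<lambda>l. \<rho>3 ''w'' [j, l])" if "j < Suc k" for j
    proof (cases "j = k")
      case True
      then show ?thesis using gk bnew by (simp add: fr3)
    next
      case False
      then have "j < k" using that by simp
      then show ?thesis using g[of j] old(3)[of j] wold[of j] by simp
    qed
    have c4: "(\<exists>j<Suc k. ?good (q', \<rho>3) j \<and> (\<forall>l<n. \<rho>3 ''v'' [l] = \<rho>3 ''w'' [j, l] / (\<Sum>l<n. \<bar>\<rho>3 ''w'' [j, l]\<bar>)))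
        \<or> (\<forall>j<Suc k. \<not> ?good (q', \<rho>3) j)"
    proof (cases ?P)
      case True
      then have "?good (q', \<rho>3) k \<and> (\<forall>l<n. \<rho>3 ''v'' [l] = \<rho>3 ''w'' [k, l] / (\<Sum>l<n. \<bar>\<rho>3 ''w'' [k, l]\<bar>))"
        using v3 wnew bnew nnew by simp
      then show ?thesis by blast
    next
      case False
      have sg: "?good (q', \<rho>3) j \<longleftrightarrow> ?good (q', \<rho>') j" if "j < k" for j
        using wold[OF that] old(1)[OF that] by simp
      from good show ?thesis
      proof
        assume "\<exists>j<k. ?good (q', \<rho>') j \<and> (\<forall>l<n. \<rho>' ''v'' [l] = \<rho>' ''w'' [j, l] / (\<Sum>l<n. \<bar>\<rho>' ''w'' [j, l]\<bar>))"
        then obtain j where j: "j < k" "?good (q', \<rho>') j" "\<forall>l<n. \<rho>' ''v'' [l] = \<rho>' ''w'' [j, l] / (\<Sum>l<n. \<bar>\<rho>' ''w'' [j, l]\<bar>)" by blast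
        have "?good (q', \<rho>3) j" using sg[OF j(1)] j(2) by blast
        moreover have "\<forall>l<n. \<rho>3 ''v'' [l] = \<rho>3 ''w'' [j, l] / (\<Sum>l<n. \<bar>\<rho>3 ''w'' [j, l]\<bar>)"
          using j(3) v3 False old(1)[OF j(1)] by simp
        ultimately show ?thesis using j(1) less_SucI by blast
      next
        assume "\<forall>j<k. \<not> ?good (q', \<rho>') j"
        then have "\<not> ?good (q', \<rho>3) j" if "j < k" for j using sg that by blast
        moreover have "\<not> ?good (q', \<rho>3) k" using False bnew nnew by simp
        ultimately show ?thesis by (metis less_Suc_eq)
      qed
    qed
    have q3: "sem n d ([] @ [k]) ?c st = (fst (sem n d [k] ?c st), \<rho>3)"
      unfolding \<rho>3_def by simp
    show ?thesis
    proof -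
      have "\<rho>3 ''b'' = \<rho>1 ''b''" "\<rho>3 ''G'' = \<rho>1 ''G''" by (simp_all add: fr fr3 fr2)
      then show ?thesis unfolding q3 I_def snd_conv using c1 c2 c3 c4[unfolded snd_conv] by blast
    qed
  qed
  have st1: "sem n d [] (
     basis_stmt) (q, \<rho>) = (q, \<rho>1)"
    unfolding \<rho>1_def by (rule sem_eqI[OF _ refl]) simp
  define st where "st = iter_upto (\<lambda>k. sem n d ([] @ [k]) ?c) n (q, \<rho>1)"
  have "I n st" unfolding st_def
    by (rule iter_upto_invariant[where P = I]) (simp add: I_def, rule step)
  have vst: "v = (\<lambda>i. snd st ''v'' [i])"
    unfolding v_def st_def direction_stmt_def using st1 by (simp only: sem_seq sem.simps(3) bndv.simps)
  define w cf where "w = ?w st" and "cf = ?cf st"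
  have w: "w j l = ?b j l - (\<Sum>i<j. cf j i * w i l)" if "j < n" "l < n" for j l
    using \<open>I n st\<close> that unfolding I_def w_def cf_def by blast
  have cf: "cf j i = bil n ?H (w i) (?b j) / bil n ?H (w i) (w i)" if "j < n" "i < j" for j i
    using \<open>I n st\<close> that unfolding I_def w_def cf_def by blast
  have "alive n x \<subseteq> {..<n}" by (auto simp: alive_def)
  then obtain v0 where v0: "\<forall>i<n. i \<notin> alive n x \<longrightarrow> v0 i = 0" "ip n x v0 = 0" "qform ?H v0 < 0"
    using negative_direction[OF q, of "alive n x" x] x by (auto simp: active_def)
  have "\<exists>k<n. bil n ?H (w k) (w k) \<le> 0 \<and> (\<exists>l<n. w k l \<noteq> 0)"
  proof (rule gram_schmidt_nonpositive[where b = ?b and cf = cf and v = v0 and a = v0])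
    show "v0 l = (\<Sum>k<n. v0 k * ?b k l)" if "l < n" for l
      using v0 that by (intro basis_vec_span) auto
    show "bil n ?H v0 v0 < 0" using v0 by (simp add: bil_def qform_def)
    show "?H i l = ?H l i" if "i < n" "l < n" for i l by (rule Hess_sym[OF that])
    show "w k l = ?b k l - (\<Sum>j<k. cf k j * w j l)" if "k < n" "l < n" for k l by (rule w[OF that])
    show "cf k j = bil n ?H (w j) (?b k) / bil n ?H (w j) (w j)" if "k < n" "j < k" for k j by (rule cf[OF that])
  qed
  then obtain k where k: "k < n" "bil n ?H (w k) (w k) \<le> 0" "\<exists>l<n. w k l \<noteq> 0" by blast
  have "0 < (\<Sum>l<n. \<bar>w k l\<bar>)"
  proof -
    obtain l where "l < n" "w k l \<noteq> 0" using k by blast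
    then show ?thesis by (intro sum_pos2[of _ l]) auto
  qed
  then have "\<not> (\<forall>j<n. \<not> ?good st j)" using k unfolding w_def by blast
  then obtain j where j: "j < n" "bil n ?H (w j) (w j) \<le> 0" "0 < (\<Sum>l<n. \<bar>w j l\<bar>)"
    "\<And>l. l < n \<Longrightarrow> v l = w j l / (\<Sum>l<n. \<bar>w j l\<bar>)"
    using \<open>I n st\<close> unfolding I_def vst w_def by blast
  \<comment> \<open>All vectors of the recursion are combinations of the spanning family and inherit
    its support and its orthogonality to \<open>x\<close>.\<close>
  have props: "(\<forall>i<n. i \<notin> alive n x \<longrightarrow> w m i = 0) \<and> ip n x (w m) = 0" if "m < n" for m
    using that
  proof (induction m rule: less_induct)
    case (less m)
    have "w m i = 0" if "i < n" "i \<notin> alive n x" for i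
    proof -
      have "(\<Sum>l<m. cf m l * w l i) = 0" using less that by (intro sum.neutral) auto
      then show ?thesis using w[OF less.prems that(1)] that by (simp add: basis_vec_def)
    qed
    moreover have "ip n x (w m) = 0"
    proof -
      have "ip n x (w m) = ip n x (\<lambda>l. ?b m l - (\<Sum>i<m. cf m i * w i l))"
        unfolding ip_def using w[OF less.prems] by (intro sum.cong refl) simp
      also have "\<dots> = ip n x (?b m) - (\<Sum>i<m. cf m i * ip n x (w i))"
        unfolding ip_diff_right ip_sum_right ip_scale_right ..
      also have "(\<Sum>i<m. cf m i * ip n x (w i)) = 0" using less by (intro sum.neutral) auto
      finally show ?thesis by (simp add: ip_basis_vec)
    qed
    ultimately show ?case by blast
  qed
  define s where "s = (\<Sum>l<n. \<bar>w j l\<bar>)"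
  have v: "v l = (1 / s) * w j l" if "l < n" for l using j(4)[OF that] by (simp add: s_def)
  have s: "0 < s" using j by (simp add: s_def)
  have "ip n x v = (1 / s) * ip n x (w j)"
    unfolding ip_def sum_distrib_left using v by (intro sum.cong refl) simp
  moreover have "(\<Sum>i<n. \<bar>v i\<bar>) = 1"
  proof -
    have "(\<Sum>i<n. \<bar>v i\<bar>) = (\<Sum>i<n. \<bar>w j i\<bar> / s)"
      using v s by (intro sum.cong refl) (simp add: abs_mult)
    then show ?thesis using s by (simp add: sum_divide_distrib[symmetric] s_def)
  qed
  moreover have "bil n ?H v v \<le> 0"
  proof -
    have "bil n ?H v v = (\<Sum>i<n. \<Sum>l<n. (1 / s * (1 / s)) * (w j i * ?H i l * w j l))"
      unfolding bil_def using v by (intro sum.cong refl) (simp add: mult_ac)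
    also have "\<dots> = (1 / s * (1 / s)) * bil n ?H (w j) (w j)" by (simp only: bil_def sum_distrib_left)
    also have "\<dots> \<le> 0" using j s by (intro mult_nonneg_nonpos) auto
    finally show ?thesis .
  qed
  ultimately show ?thesis using props[OF j(1)] v by auto
qed

lemma line_stmt_correct:
  assumes q: "0 < q" "q \<le> d" and x: "x = (\<lambda>i. \<rho> ''x'' [i])" "\<And>i. i < n \<Longrightarrow> \<bar>x i\<bar> \<le> 1" "active n x"
    and pot: "holds_potential q x \<rho>" "\<rho> ''Bq'' [] = Bq q" "\<rho> ''Bd'' [] = Bd q"
    and v: "v = (\<lambda>i. \<rho> ''v'' [i])" "\<forall>i<n. i \<notin> alive n x \<longrightarrow> v i = 0" "ip n x v = 0" "(\<Sum>i<n. \<bar>v i\<bar>) = 1"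
      "bil n (Hess q x) v v \<le> 0"
  shows "cube_step q x (\<lambda>i. snd (sem n d [] line_stmt (q, \<rho>)) ''x'' [i])"
proof -
  define c where "c = (\<Sum>i<n. v i * Grad q x i)"
  define u where "u = (\<lambda>i. if 0 < c then - v i else v i)"
  define \<rho>1 where "\<rho>1 = snd (sem n d [] (
     gradient_stmt ;;
     orient_stmt ;;
     length_stmt) (q, \<rho>))"
  have g: "xval n d [i] q \<rho> (xgpot IQ ''Bq'' ''Dq'') = gpot q (Bq q) x i"
    "xval n d [i] q \<rho> (xgpot ID ''Bd'' ''Dd'') = gpot d (Bd q) x i" if "i < n" for i
    using that q d_pos pot by (auto intro!: xval_xgpot simp: holds_potential_def)
  have "(\<Sum>i<n. \<rho> ''v'' [i] * (xval n d [i] q \<rho> (xgpot IQ ''Bq'' ''Dq'') + xval n d [i] q \<rho> (xgpot ID ''Bd'' ''Dd''))) = c"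
    unfolding c_def Grad_def v(1) using g by (intro sum.cong refl) simp
  then have u1: "\<rho>1 ''u'' [i] = u i" if "i < n" for i
    unfolding \<rho>1_def using that by (simp add: u_def v(1))
  have t1: "\<rho>1 ''t'' [] = step_bound n d"
    unfolding \<rho>1_def by (simp add: step_bound_def power3_eq_cube power2_eq_square)
  have x1: "\<rho>1 ''x'' [i] = x i" for i
    unfolding \<rho>1_def by (simp add: x(1))
  have st1: "sem n d [] (
     gradient_stmt ;;
     orient_stmt ;;
     length_stmt) (q, \<rho>) = (q, \<rho>1)"
    unfolding \<rho>1_def by (rule sem_eqI[OF _ refl]) simp
  let ?c = "clip_stmt"
  define f where "f = (\<lambda>i t. if 1 < x i + t * u i then (1 - x i) / u i
      else if x i + t * u i < - 1 then (- 1 - x i) / u i else t)"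
  define st where "st = iter_upto (\<lambda>k. sem n d ([] @ [k]) ?c) n (q, \<rho>1)"
  have inv: "snd st ''t'' [] = iter_upto f n (step_bound n d) \<and> snd st ''x'' = \<rho>1 ''x'' \<and> snd st ''u'' = \<rho>1 ''u''"
    unfolding st_def
  proof (rule iter_upto_invariant[where P = "\<lambda>k (st :: nat \<times> arrays). snd st ''t'' [] = iter_upto f k (step_bound n d) \<and> snd st ''x'' = \<rho>1 ''x'' \<and> snd st ''u'' = \<rho>1 ''u''"])
    fix k and st :: "nat \<times> arrays"
    assume k: "k < n" and *: "snd st ''t'' [] = iter_upto f k (step_bound n d) \<and> snd st ''x'' = \<rho>1 ''x'' \<and> snd st ''u'' = \<rho>1 ''u''"
    obtain q' \<rho>' where st: "st = (q', \<rho>')" by (cases st)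
    show "snd (sem n d ([] @ [k]) ?c st) ''t'' [] = iter_upto f (Suc k) (step_bound n d) \<and>
        snd (sem n d ([] @ [k]) ?c st) ''x'' = \<rho>1 ''x'' \<and> snd (sem n d ([] @ [k]) ?c st) ''u'' = \<rho>1 ''u''"
      using * k by (simp add: st f_def x1 u1 mult.commute)
  qed (simp add: t1)
  define t where "t = iter_upto f n (step_bound n d)"
  have "0 \<le> step_bound n d" by (simp add: step_bound_def)
  from line_search[of f x u n, OF _ x(2) this]
  have t: "0 \<le> t" "t \<le> step_bound n d" "\<forall>i<n. \<bar>x i + t * u i\<bar> \<le> 1"
    "t = step_bound n d \<or> (\<exists>i<n. u i \<noteq> 0 \<and> \<bar>x i + t * u i\<bar> = 1)"
    unfolding t_def by (auto simp: f_def)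
  obtain q' \<rho>' where st: "st = (q', \<rho>')" by (cases st)
  have "snd (sem n d [] line_stmt (q, \<rho>)) ''x'' [i] = x i + t * u i" if "i < n" for i
  proof -
    have "sem n d [] line_stmt (q, \<rho>) = sem n d [] (move_stmt) st"
      unfolding line_stmt_def st_def using st1 by (simp only: sem_seq sem.simps(3) bndv.simps)
    then show ?thesis using inv that by (simp add: st x1 u1 t_def)
  qed
  then have x': "\<forall>i<n. snd (sem n d [] line_stmt (q, \<rho>)) ''x'' [i] = x i + t * u i" by blast
  have u: "\<forall>i<n. i \<notin> alive n x \<longrightarrow> u i = 0" using v(2) by (simp add: u_def)
  have "ip n x u = 0" using v(3) by (cases "0 < c") (auto simp: u_def ip_def sum_negf)
  moreover have "(\<Sum>i<n. \<bar>u i\<bar>) = 1" using v(4) by (cases "0 < c") (auto simp: u_def)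
  moreover have "bil n (Hess q x) u u \<le> 0" using v(5) by (cases "0 < c") (auto simp: u_def bil_def)
  moreover have "(\<Sum>i<n. u i * Grad q x i) \<le> 0" by (cases "0 < c") (auto simp: u_def c_def[symmetric] sum_negf)
  moreover have "t = step_bound n d \<or> (\<exists>i\<in>alive n x. \<bar>snd (sem n d [] line_stmt (q, \<rho>)) ''x'' [i]\<bar> = 1)"
    using t(4) u x' by metis
  ultimately show ?thesis
    unfolding cube_step_def using x(3) t x' u by (simp only: if_True) (intro exI[of _ u] exI[of _ t], simp)
qed

lemma step_stmt_input: "holds_input q \<rho> \<Longrightarrow> holds_input q (snd (sem n d [] step_stmt (q, \<rho>)))"
  unfolding holds_input_def
  by (subst (1 2 3) sem_frame) (auto simp: step_stmt_def potential_stmt_def direction_stmt_def line_stmt_def pow_stmt_def)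

lemma step_stmt_q: "fst (sem n d env step_stmt st) = fst st"
  by (rule sem_frame_q) (simp add: step_stmt_def potential_stmt_def direction_stmt_def line_stmt_def pow_stmt_def)

theorem step_stmt_correct:
  assumes n: "16 \<le> n" and q: "0 < q" "q \<le> d" "T \<le> sqrt (real n) * \<sigma> * 2 ^ q" and inp: "holds_input q \<rho>"
    and x: "x = (\<lambda>i. \<rho> ''x'' [i])" "\<And>i. i < n \<Longrightarrow> \<bar>x i\<bar> \<le> 1" "Psi q x \<le> 2"
  shows "cube_step q x (\<lambda>i. snd (sem n d [] step_stmt (q, \<rho>)) ''x'' [i])"
proof (cases "active n x")
  case False
  have "\<not> real n < 2 * real (card (alive n x))" using False by (simp add: active_def)
  then have "sem n d [] step_stmt (q, \<rho>) = (q, \<rho>)"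
    using sum_indicator_alive[where x = x and n = n] by (simp add: step_stmt_def x(1))
  then show ?thesis using False by (simp add: cube_step_def x(1))
next
  case True
  then have "real n < 2 * real (card (alive n x))" by (simp add: active_def)
  then have s: "sem n d [] step_stmt (q, \<rho>) = sem n d [] line_stmt (sem n d [] direction_stmt (sem n d [] potential_stmt (q, \<rho>)))"
    using sum_indicator_alive[where x = x and n = n] by (simp add: step_stmt_def x(1))
  define \<rho>1 where "\<rho>1 = snd (sem n d [] potential_stmt (q, \<rho>))"
  define \<rho>2 where "\<rho>2 = snd (sem n d [] direction_stmt (q, \<rho>1))"
  have st1: "sem n d [] potential_stmt (q, \<rho>) = (q, \<rho>1)"
    unfolding \<rho>1_def by (rule sem_eqI[OF _ refl]) (simp add: potential_stmt_def pow_stmt_def)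
  have st2: "sem n d [] direction_stmt (q, \<rho>1) = (q, \<rho>2)"
    unfolding \<rho>2_def by (rule sem_eqI[OF _ refl]) (simp add: direction_stmt_def)
  have fr1: "\<rho>1 a = \<rho> a" if "a \<in> {''x'', ''Bq'', ''Bd''}" for a
    unfolding \<rho>1_def using that by (subst sem_frame) (auto simp: potential_stmt_def pow_stmt_def)
  have fr2: "\<rho>2 a = \<rho>1 a" if "a \<in> {''x'', ''Bq'', ''Bd'', ''G'', ''PA'', ''Dq'', ''Dd''}" for a
    unfolding \<rho>2_def using that by (subst sem_frame) (auto simp: direction_stmt_def)
  have pot: "holds_potential q x \<rho>1"
    unfolding \<rho>1_def x(1) by (rule potential_stmt_correct[OF q(1,2) inp])
  then have pot2: "holds_potential q x \<rho>2" by (simp add: holds_potential_def fr2)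
  have x1: "x = (\<lambda>i. \<rho>1 ''x'' [i])" by (simp add: fr1 x(1))
  have x2: "x = (\<lambda>i. \<rho>2 ''x'' [i])" by (simp add: fr2 fr1 x(1))
  have sq1: "sq x \<le> 1" by (rule sq_le_1) (rule x(2))
  from direction_stmt_correct[where x = x and \<rho> = \<rho>1, OF n q(1,3) sq1 x(3) True x1] pot
  have v: "(\<forall>i<n. i \<notin> alive n x \<longrightarrow> \<rho>2 ''v'' [i] = 0) \<and> ip n x (\<lambda>i. \<rho>2 ''v'' [i]) = 0 \<and>
      (\<Sum>i<n. \<bar>\<rho>2 ''v'' [i]\<bar>) = 1 \<and> bil n (Hess q x) (\<lambda>i. \<rho>2 ''v'' [i]) (\<lambda>i. \<rho>2 ''v'' [i]) \<le> 0"
    unfolding \<rho>2_def holds_potential_def by simp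
  show ?thesis
    unfolding s st1 st2
    by (rule line_stmt_correct[where v = "\<lambda>i. \<rho>2 ''v'' [i]"])
      (use q x2 x(2) True pot2 inp v in \<open>auto simp: fr2 fr1 holds_input_def\<close>)
qed

end

section \<open>The sum of squares\<close>

definition sqsum :: "nat \<Rightarrow> nat \<Rightarrow> (nat \<Rightarrow> nat \<Rightarrow> nat \<Rightarrow> real) \<Rightarrow> nat \<Rightarrow> nat \<Rightarrow> real" where
  "sqsum n d A j k = (\<Sum>i<n. \<Sum>l<d. A i j l * A i l k)"

text \<open>The quadratic form of the sum of squares, written as a sum of squared lengths: this is
  visibly nonnegative and has the shape of the assumption \<open>squares_le\<close>.\<close>

definition energy :: "nat \<Rightarrow> nat \<Rightarrow> (nat \<Rightarrow> nat \<Rightarrow> nat \<Rightarrow> real) \<Rightarrow> (nat \<Rightarrow> real) \<Rightarrow> real" where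
  "energy n d A y = (\<Sum>i<n. ip d (\<lambda>j. ip d (A i j) y) (\<lambda>j. ip d (A i j) y))"

lemma quadratic_form_eigen:
  assumes e: "eigenbasis d M u l"
  shows "(\<Sum>j<d. \<Sum>k<d. y j * M j k * y k) = (\<Sum>p<d. l p * (ip d (u p) y)\<^sup>2)"
proof -
  have "(\<Sum>j<d. \<Sum>k<d. y j * M j k * y k) = (\<Sum>j<d. \<Sum>k<d. \<Sum>p<d. l p * ((u p j * y j) * (u p k * y k)))"
  proof (rule sum.cong[OF refl], rule sum.cong[OF refl])
    fix j k assume "j \<in> {..<d}" "k \<in> {..<d}"
    then have "M j k = (\<Sum>p<d. l p * u p j * u p k)" using e by (simp add: eigenbasis_def)
    then show "y j * M j k * y k = (\<Sum>p<d. l p * ((u p j * y j) * (u p k * y k)))"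
      by (simp add: sum_distrib_left sum_distrib_right mult_ac)
  qed
  also have "\<dots> = (\<Sum>j<d. \<Sum>p<d. \<Sum>k<d. l p * ((u p j * y j) * (u p k * y k)))"
    by (rule sum.cong, rule refl, rule sum.swap)
  also have "\<dots> = (\<Sum>p<d. \<Sum>j<d. \<Sum>k<d. l p * ((u p j * y j) * (u p k * y k)))" by (rule sum.swap)
  also have "\<dots> = (\<Sum>p<d. l p * (ip d (u p) y)\<^sup>2)"
    unfolding ip_def power2_eq_square sum_product by (simp add: sum_distrib_left)
  finally show ?thesis .
qed

lemma energy_eq:
  assumes sym: "\<And>i j k. i < n \<Longrightarrow> j < d \<Longrightarrow> k < d \<Longrightarrow> A i j k = A i k j"
  shows "energy n d A y = (\<Sum>j<d. \<Sum>k<d. y j * sqsum n d A j k * y k)"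
proof -
  let ?f = "\<lambda>i m j k. (A i m j * y j) * (A i m k * y k)"
  have "energy n d A y = (\<Sum>i<n. \<Sum>m<d. \<Sum>j<d. \<Sum>k<d. ?f i m j k)"
    unfolding energy_def ip_def sum_product ..
  also have "\<dots> = (\<Sum>i<n. \<Sum>j<d. \<Sum>m<d. \<Sum>k<d. ?f i m j k)"
    by (rule sum.cong, rule refl, rule sum.swap)
  also have "\<dots> = (\<Sum>i<n. \<Sum>j<d. \<Sum>k<d. \<Sum>m<d. ?f i m j k)"
    by (rule sum.cong, rule refl, rule sum.cong, rule refl, rule sum.swap)
  also have "\<dots> = (\<Sum>j<d. \<Sum>i<n. \<Sum>k<d. \<Sum>m<d. ?f i m j k)" by (rule sum.swap)
  also have "\<dots> = (\<Sum>j<d. \<Sum>k<d. \<Sum>i<n. \<Sum>m<d. ?f i m j k)"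
    by (rule sum.cong, rule refl, rule sum.swap)
  also have "\<dots> = (\<Sum>j<d. \<Sum>k<d. y j * sqsum n d A j k * y k)"
  proof (rule sum.cong[OF refl], rule sum.cong[OF refl])
    fix j k assume jk: "j \<in> {..<d}" "k \<in> {..<d}"
    have "y j * sqsum n d A j k * y k = (\<Sum>i<n. \<Sum>m<d. y j * (A i j m * A i m k) * y k)"
      by (simp add: sqsum_def sum_distrib_left sum_distrib_right)
    also have "\<dots> = (\<Sum>i<n. \<Sum>m<d. ?f i m j k)"
    proof (rule sum.cong[OF refl], rule sum.cong[OF refl])
      fix i m assume "i \<in> {..<n}" "m \<in> {..<d}"
      then have "A i j m = A i m j" using sym jk by simp
      then show "y j * (A i j m * A i m k) * y k = ?f i m j k" by simp
    qed
    finally show "(\<Sum>i<n. \<Sum>m<d. ?f i m j k) = y j * sqsum n d A j k * y k" by simp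
  qed
  finally show ?thesis .
qed

lemma sqsum_sym:
  assumes sym: "\<And>i j k. i < n \<Longrightarrow> j < d \<Longrightarrow> k < d \<Longrightarrow> A i j k = A i k j" and "j < d" "k < d"
  shows "sqsum n d A j k = sqsum n d A k j"
  unfolding sqsum_def
proof (rule sum.cong[OF refl], rule sum.cong[OF refl])
  fix i l assume "i \<in> {..<n}" "l \<in> {..<d}"
  then have "A i j l = A i l j" "A i l k = A i k l" using assms by simp_all
  then show "A i j l * A i l k = A i k l * A i l j" by simp
qed

lemma tr_sqsum:
  assumes sym: "\<And>i j k. i < n \<Longrightarrow> j < d \<Longrightarrow> k < d \<Longrightarrow> A i j k = A i k j"
  shows "tr d (sqsum n d A) = (\<Sum>i<n. \<Sum>j<d. ip d (A i j) (A i j))"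
proof -
  have "tr d (sqsum n d A) = (\<Sum>i<n. \<Sum>j<d. \<Sum>l<d. A i j l * A i l j)"
    unfolding tr_def sqsum_def by (rule sum.swap)
  also have "\<dots> = (\<Sum>i<n. \<Sum>j<d. ip d (A i j) (A i j))"
    unfolding ip_def using sym by (intro sum.cong refl) auto
  finally show ?thesis .
qed

text \<open>\<open>\<Lambda>\<close> is the largest eigenvalue of the sum of squares, characterised
  through a whole eigenbasis so that the traces of all powers can be estimated from the same
  data.\<close>

definition top_energy :: "nat \<Rightarrow> nat \<Rightarrow> (nat \<Rightarrow> nat \<Rightarrow> nat \<Rightarrow> real) \<Rightarrow> real \<Rightarrow> bool" where
  "top_energy n d A \<Lambda> \<longleftrightarrow> (\<exists>u l. eigenbasis d (sqsum n d A) u l \<and> (\<forall>p<d. 0 \<le> l p \<and> l p \<le> \<Lambda>) \<and> (\<exists>p<d. l p = \<Lambda>))"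

lemma top_energy_exists:
  assumes sym: "\<And>i j k. i < n \<Longrightarrow> j < d \<Longrightarrow> k < d \<Longrightarrow> A i j k = A i k j" and d: "0 < d"
  shows "\<exists>\<Lambda>. top_energy n d A \<Lambda>"
proof -
  obtain u l where e: "eigenbasis d (sqsum n d A) u l"
    using spectral_theorem[of d "sqsum n d A"] sqsum_sym[of n d A, OF sym] by blast
  have u: "orthonormal d d u" using e by (simp add: eigenbasis_def)
  have en: "energy n d A y = (\<Sum>p<d. l p * (ip d (u p) y)\<^sup>2)" for y
    unfolding quadratic_form_eigen[OF e, symmetric] by (rule energy_eq[OF sym])
  have nonneg: "0 \<le> l p" if "p < d" for p
  proof -
    have "energy n d A (u p) = (\<Sum>r<d. if r = p then l p else 0)"
      unfolding en using u that by (intro sum.cong refl) (auto simp: orthonormal_def)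
    then have "energy n d A (u p) = l p" using that by simp
    moreover have "0 \<le> energy n d A (u p)"
      unfolding energy_def by (intro sum_nonneg ip_self_nonneg)
    ultimately show ?thesis by simp
  qed
  define \<Lambda> where "\<Lambda> = Max (l ` {..<d})"
  have "l p \<le> \<Lambda>" if "p < d" for p unfolding \<Lambda>_def using that by (intro Max_ge) auto
  moreover have "\<Lambda> \<in> l ` {..<d}" unfolding \<Lambda>_def using d by (intro Max_in) auto
  ultimately show ?thesis unfolding top_energy_def using e nonneg by blast
qed

lemma top_energy_bound:
  assumes sym: "\<And>i j k. i < n \<Longrightarrow> j < d \<Longrightarrow> k < d \<Longrightarrow> A i j k = A i k j" and t: "top_energy n d A \<Lambda>"
  shows "energy n d A y \<le> \<Lambda> * ip d y y"
proof -
  obtain u l where e: "eigenbasis d (sqsum n d A) u l" and l: "\<And>p. p < d \<Longrightarrow> l p \<le> \<Lambda>"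
    using t unfolding top_energy_def by blast
  have u: "orthonormal d d u" using e by (simp add: eigenbasis_def)
  have en: "energy n d A y = (\<Sum>p<d. l p * (ip d (u p) y)\<^sup>2)"
    unfolding quadratic_form_eigen[OF e, symmetric] by (rule energy_eq[OF sym])
  have "energy n d A y \<le> (\<Sum>p<d. \<Lambda> * (ip d (u p) y)\<^sup>2)"
    unfolding en using l by (intro sum_mono mult_right_mono) auto
  then show ?thesis by (simp add: sum_distrib_left[symmetric] parseval[OF u])
qed

lemma top_energy_nonneg: "top_energy n d A \<Lambda> \<Longrightarrow> 0 \<le> \<Lambda>"
  by (auto simp: top_energy_def)

lemma top_energy_trace:
  assumes "top_energy n d A \<Lambda>"
  shows "\<Lambda> \<le> tr d (sqsum n d A)" "tr d (sqsum n d A) \<le> real d * \<Lambda>"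
    "\<Lambda> ^ m \<le> tr d (mpow d (sqsum n d A) m)" "tr d (mpow d (sqsum n d A) m) \<le> real d * \<Lambda> ^ m"
    "0 < m \<Longrightarrow> tr d (mpow d (sqsum n d A) m) \<le> tr d (sqsum n d A) ^ m"
proof -
  obtain u l where e: "eigenbasis d (sqsum n d A) u l" and l: "\<And>p. p < d \<Longrightarrow> 0 \<le> l p" "\<And>p. p < d \<Longrightarrow> l p \<le> \<Lambda>"
    and top: "\<exists>p<d. l p = \<Lambda>"
    using assms unfolding top_energy_def by blast
  have T: "tr d (sqsum n d A) = (\<Sum>p<d. l p)"
  proof -
    have u: "orthonormal d d u" using e by (simp add: eigenbasis_def)
    have "hat d u (sqsum n d A) p p = l p" if "p < d" for p using hat_eigenbasis[OF e that that] by simp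
    then show ?thesis unfolding tr_hat[OF u] by simp
  qed
  obtain p where p: "p < d" "l p = \<Lambda>" using top by blast
  show "\<Lambda> \<le> tr d (sqsum n d A)"
    unfolding T p(2)[symmetric] using l p by (intro member_le_sum) auto
  have "(\<Sum>p<d. l p) \<le> (\<Sum>p<d. \<Lambda>)" using l by (intro sum_mono) auto
  then show "tr d (sqsum n d A) \<le> real d * \<Lambda>" unfolding T by simp
  show "\<Lambda> ^ m \<le> tr d (mpow d (sqsum n d A) m)"
    unfolding tr_mpow[OF e] p(2)[symmetric] using l p by (intro member_le_sum) auto
  have "(\<Sum>p<d. l p ^ m) \<le> (\<Sum>p<d. \<Lambda> ^ m)" using l by (intro sum_mono power_mono) auto
  then show "tr d (mpow d (sqsum n d A) m) \<le> real d * \<Lambda> ^ m" unfolding tr_mpow[OF e] by simp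
  assume m: "0 < m"
  then obtain m' where m': "m = Suc m'" by (cases m) auto
  have "(\<Sum>p<d. l p ^ m) \<le> (\<Sum>p<d. l p * (\<Sum>p<d. l p) ^ m')"
  proof (rule sum_mono)
    fix p assume "p \<in> {..<d}"
    then have "l p \<le> (\<Sum>p<d. l p)" "0 \<le> l p" using l by (auto intro!: member_le_sum)
    then show "l p ^ m \<le> l p * (\<Sum>p<d. l p) ^ m'" unfolding m' by (simp add: mult_left_mono power_mono)
  qed
  also have "\<dots> = (\<Sum>p<d. l p) ^ m" by (simp add: m' sum_distrib_right)
  finally show "tr d (mpow d (sqsum n d A) m) \<le> tr d (sqsum n d A) ^ m" unfolding T tr_mpow[OF e] .
qed

section \<open>Correctness of the initialisation\<close>

text \<open>\<open>R\<close> lies between \<open>\<Lambda>^d\<close> and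
  \<open>d \<Lambda>^d\<close>, which is less than \<open>(2 \<Lambda>)^d\<close>; comparing
  \<open>d\<close>-th powers thus locates \<open>\<Lambda>\<close> up to a constant factor without
  roots.\<close>

lemma halving_search:
  assumes t: "top_energy n d A \<Lambda>" and T: "T = tr d (sqsum n d A)" "0 < T"
    and R: "R = tr d (mpow d (sqsum n d A) d)"
  defines "\<sigma> \<equiv> iter_upto (\<lambda>i s. if (s / 2) ^ d < R then s else s / 2) d T"
  shows "0 < \<sigma> \<and> \<Lambda> \<le> \<sigma> \<and> \<sigma> \<le> 4 * \<Lambda>"
proof -
  have \<Lambda>0: "0 \<le> \<Lambda>" by (rule top_energy_nonneg[OF t])
  have \<Lambda>: "0 < \<Lambda>"
  proof (rule ccontr)
    assume "\<not> 0 < \<Lambda>"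
    then have "\<Lambda> = 0" using \<Lambda>0 by simp
    then show False using top_energy_trace(2)[OF t] T by simp
  qed
  have d: "0 < d" using t by (auto simp: top_energy_def)
  have d2: "real d < 2 ^ d" by (rule of_nat_less_two_power)
  have "0 < \<sigma> \<and> R \<le> \<sigma> ^ d \<and> ((\<sigma> / 2) ^ d < R \<or> \<sigma> = T / 2 ^ d)"
    unfolding \<sigma>_def
    by (rule iter_upto_invariant[where P = "\<lambda>i s. 0 < s \<and> R \<le> s ^ d \<and> ((s / 2) ^ d < R \<or> s = T / 2 ^ i)"])
      (use T R top_energy_trace(5)[OF t d] in auto)
  then have \<sigma>: "0 < \<sigma>" "R \<le> \<sigma> ^ d" "(\<sigma> / 2) ^ d < R \<or> \<sigma> = T / 2 ^ d" by auto
  have "\<Lambda> ^ d \<le> \<sigma> ^ d" using \<sigma>(2) top_energy_trace(3)[OF t, of d] R by simp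
  then have le: "\<Lambda> \<le> \<sigma>" using power_mono_iff[OF \<Lambda>0, of \<sigma> d] \<sigma>(1) d by simp
  \<comment> \<open>The search ends within its \<open>d\<close> rounds: halving in all of them would
    give \<open>T / 2^d\<close>, which is below \<open>\<Lambda>\<close> because \<open>T\<close> is
    at most \<open>d \<Lambda>\<close>.\<close>
  have "(\<sigma> / 2) ^ d < R"
  proof (rule ccontr)
    assume "\<not> (\<sigma> / 2) ^ d < R"
    then have "\<sigma> = T / 2 ^ d" using \<sigma> by blast
    also have "\<dots> \<le> real d * \<Lambda> / 2 ^ d" using top_energy_trace(2)[OF t] T by (intro divide_right_mono) auto
    also have "\<dots> < \<Lambda>" using d2 \<Lambda> by (simp add: divide_less_eq)
    finally show False using le by simp
  qed
  also have "R \<le> real d * \<Lambda> ^ d" using top_energy_trace(4)[OF t, of d] R by simp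
  also have "\<dots> \<le> 2 ^ d * \<Lambda> ^ d" using d2 \<Lambda> by (intro mult_right_mono) auto
  also have "\<dots> = (2 * \<Lambda>) ^ d" by (rule power_mult_distrib[symmetric])
  finally have "\<sigma> / 2 < 2 * \<Lambda>" using \<Lambda> by (intro power_less_imp_less_base[of "\<sigma> / 2" d]) auto
  then show ?thesis using le \<sigma>(1) by simp
qed

text \<open>The upper bound on \<open>T\<close> limits the number of large eigenvalues; the last
  condition, minimality of \<open>q\<close>, later bounds \<open>q\<close> by the logarithm.\<close>

definition good_init :: "nat \<Rightarrow> nat \<Rightarrow> (nat \<Rightarrow> nat \<Rightarrow> nat \<Rightarrow> real) \<Rightarrow> real \<Rightarrow> real \<Rightarrow> real \<Rightarrow> nat \<Rightarrow> bool" where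
  "good_init n d A \<Lambda> T \<sigma> q \<longleftrightarrow> 0 < \<sigma> \<and> \<Lambda> \<le> \<sigma> \<and> \<sigma> \<le> 4 * \<Lambda> \<and> 0 < q \<and> q \<le> d \<and>
     T \<le> sqrt (real n) * \<sigma> * 2 ^ q \<and> (q = 1 \<or> sqrt (real n) * \<sigma> * 2 ^ (q - 1) < T)"

lemma init_stmt_correct:
  fixes q0 :: nat and \<rho> :: arrays
  assumes A: "\<And>i j k. i < n \<Longrightarrow> j < d \<Longrightarrow> k < d \<Longrightarrow> \<rho> ''A'' [i, j, k] = A i j k"
    and T: "T = tr d (sqsum n d A)"
  defines "st \<equiv> sem n d [] init_stmt (q0, \<rho>)"
  shows "snd st ''A'' = \<rho> ''A''"
    and "i < n \<Longrightarrow> snd st ''x'' [i] = (if n < 16 \<or> T \<le> 0 then 1 else 0)"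
    and "top_energy n d A \<Lambda> \<Longrightarrow> 0 < T \<Longrightarrow> 0 < n \<Longrightarrow>
      \<exists>\<sigma>. good_init n d A \<Lambda> T \<sigma> (fst st) \<and>
        snd st ''Bq'' [] = (512 * real (fst st) * \<sigma>) ^ fst st * (T / \<sigma>) \<and>
        snd st ''Bd'' [] = (131072 * real (fst st) * \<sigma>) ^ d * (T / \<sigma>)"
proof -
  let ?s1 = "square_stmt"
  let ?s2 = "pow_stmt ''S'' ''P'' BD"
  let ?s3 = "Tab ''T'' [] [] (XSum BD (XArr ''S'' [IV 0, IV 0]))"
  let ?s4 = "Tab ''r'' [] [] (XSum BD (XArr ''P'' [ID, IV 0, IV 0]))"
  let ?s5 = "Tab ''sigma'' [] [] (XArr ''T'' [])"
  let ?c6 = "halve_stmt"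
  let ?c7 = "raise_q_stmt"
  let ?s8 = "scale_stmt"
  have st: "st = sem n d [] ?s8 (sem n d [] (For BD ?c7) (sem n d [] (SetQ (IC 1)) (sem n d [] (For BD ?c6)
      (sem n d [] ?s5 (sem n d [] ?s4 (sem n d [] ?s3 (sem n d [] ?s2 (sem n d [] ?s1 (q0, \<rho>)))))))))"
    unfolding st_def init_stmt_def by (simp only: sem_seq)
  show frA: "snd st ''A'' = \<rho> ''A''"
    unfolding st_def by (subst sem_frame) (auto simp: init_stmt_def pow_stmt_def)
  define \<rho>1 where "\<rho>1 = snd (sem n d [] ?s1 (q0, \<rho>))"
  have s1: "sem n d [] ?s1 (q0, \<rho>) = (q0, \<rho>1)" unfolding \<rho>1_def by (rule sem_eqI[OF _ refl]) simp
  have S: "\<rho>1 ''S'' [j, k] = sqsum n d A j k" if "j < d" "k < d" for j k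
    unfolding \<rho>1_def using that A by (simp add: sqsum_def)
  define \<rho>2 where "\<rho>2 = snd (sem n d [] ?s2 (q0, \<rho>1))"
  have s2: "sem n d [] ?s2 (q0, \<rho>1) = (q0, \<rho>2)"
    unfolding \<rho>2_def by (rule sem_eqI[OF _ refl]) (simp add: pow_stmt_def)
  have P: "\<rho>2 ''P'' [a, j, k] = mpow d (sqsum n d A) a j k" if "a \<le> d" "j < d" "k < d" for a j k
  proof -
    have "\<rho>2 ''P'' [a, j, k] = mpow d (\<lambda>j k. \<rho>1 ''S'' [j, k]) a j k"
      unfolding \<rho>2_def using that by (intro pow_stmt_correct) auto
    also have "\<dots> = mpow d (sqsum n d A) a j k" using S that by (intro mpow_cong) auto
    finally show ?thesis .
  qed
  have S2: "\<rho>2 ''S'' = \<rho>1 ''S''" unfolding \<rho>2_def by (subst sem_frame) (auto simp: pow_stmt_def)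
  define R where "R = tr d (mpow d (sqsum n d A) d)"
  define \<rho>5 where "\<rho>5 = snd (sem n d [] (?s3 ;; ?s4 ;; ?s5) (q0, \<rho>2))"
  have s5: "sem n d [] ?s5 (sem n d [] ?s4 (sem n d [] ?s3 (q0, \<rho>2))) = (q0, \<rho>5)"
  proof -
    have "sem n d [] (?s3 ;; ?s4 ;; ?s5) (q0, \<rho>2) = (q0, \<rho>5)"
      unfolding \<rho>5_def by (rule sem_eqI[OF _ refl]) simp
    then show ?thesis by (simp only: sem_seq)
  qed
  have T5: "\<rho>5 ''T'' [] = T" "\<rho>5 ''sigma'' [] = T" "\<rho>5 ''r'' [] = R"
    unfolding \<rho>5_def using S P by (simp_all add: S2 T R_def tr_def)
  define f where "f = (\<lambda>(i :: nat) s. if (s / 2) ^ d < R then s else s / 2)"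
  define \<sigma> where "\<sigma> = iter_upto f d T"
  define st6 where "st6 = sem n d [] (For BD ?c6) (q0, \<rho>5)"
  have 6: "snd st6 ''sigma'' [] = \<sigma>" "snd st6 ''T'' [] = T"
  proof -
    have "snd (iter_upto (\<lambda>i. sem n d ([] @ [i]) ?c6) d (q0, \<rho>5)) ''sigma'' [] = iter_upto f d T \<and>
      snd (iter_upto (\<lambda>i. sem n d ([] @ [i]) ?c6) d (q0, \<rho>5)) ''T'' = \<rho>5 ''T'' \<and>
      snd (iter_upto (\<lambda>i. sem n d ([] @ [i]) ?c6) d (q0, \<rho>5)) ''r'' = \<rho>5 ''r''"
    proof (rule iter_upto_invariant[where P = "\<lambda>k (st :: nat \<times> arrays). snd st ''sigma'' [] = iter_upto f k T \<and>
        snd st ''T'' = \<rho>5 ''T'' \<and> snd st ''r'' = \<rho>5 ''r''"])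
      fix k and st :: "nat \<times> arrays"
      assume *: "snd st ''sigma'' [] = iter_upto f k T \<and> snd st ''T'' = \<rho>5 ''T'' \<and> snd st ''r'' = \<rho>5 ''r''"
      obtain q' \<rho>' where st: "st = (q', \<rho>')" by (cases st)
      show "snd (sem n d ([] @ [k]) ?c6 st) ''sigma'' [] = iter_upto f (Suc k) T \<and>
        snd (sem n d ([] @ [k]) ?c6 st) ''T'' = \<rho>5 ''T'' \<and> snd (sem n d ([] @ [k]) ?c6 st) ''r'' = \<rho>5 ''r''"
        using * T5 by (simp add: st f_def)
    qed (use T5 in simp)
    then show "snd st6 ''sigma'' [] = \<sigma>" "snd st6 ''T'' [] = T"
      unfolding st6_def \<sigma>_def using T5 by simp_all
  qed
  obtain q6 \<rho>6 where st6: "st6 = (q6, \<rho>6)" by (cases st6)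
  define st7 where "st7 = sem n d [] (For BD ?c7) (1, \<rho>6)"
  have \<rho>7: "snd st7 = \<rho>6"
    unfolding st7_def by (rule ext, subst sem_frame) auto
  obtain q where st7: "st7 = (q, \<rho>6)" using \<rho>7 by (cases st7) auto
  have st8: "st = sem n d [] ?s8 (q, \<rho>6)"
    unfolding st s1 s2 s5 st6_def[symmetric] st6 using st7_def st7 by simp
  then have q: "fst st = q" by (simp add: sem_frame_q)
  have T6: "\<rho>6 ''T'' [] = T" "\<rho>6 ''sigma'' [] = \<sigma>" using 6 by (simp_all add: st6)
  show "snd st ''x'' [i] = (if n < 16 \<or> T \<le> 0 then 1 else 0)" if "i < n" for i
    unfolding st8 using that T6 by simp
  assume t: "top_energy n d A \<Lambda>" and T0: "0 < T" and n: "0 < n"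
  have \<sigma>: "0 < \<sigma>" "\<Lambda> \<le> \<sigma>" "\<sigma> \<le> 4 * \<Lambda>"
    using halving_search[OF t T T0 R_def] unfolding \<sigma>_def f_def by auto
  have d: "0 < d" using t by (auto simp: top_energy_def)
  \<comment> \<open>This keeps \<open>q\<close> within \<open>d\<close>: the trace is at most
    \<open>d \<Lambda> \<le> 2^d \<sigma>\<close>, so the test for raising \<open>q\<close> fails at
    \<open>q = d\<close> at the latest.\<close>
  have dd: "T\<^sup>2 \<le> real n * \<sigma>\<^sup>2 * 4 ^ d"
  proof -
    have "T \<le> real d * \<Lambda>" using top_energy_trace(2)[OF t] T by simp
    also have "\<dots> \<le> 2 ^ d * \<sigma>"
      using \<sigma> of_nat_less_two_power[of d, where 'a = real] top_energy_nonneg[OF t] by (intro mult_mono) auto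
    finally have "T\<^sup>2 \<le> (2 ^ d * \<sigma>)\<^sup>2" using T0 by (intro power_mono) auto
    also have "\<dots> = 1 * (\<sigma>\<^sup>2 * 4 ^ d)"
      by (simp add: power_mult_distrib power2_eq_square flip: power_mult_distrib)
    also have "\<dots> \<le> real n * (\<sigma>\<^sup>2 * 4 ^ d)" using n by (intro mult_right_mono) auto
    finally show ?thesis by (simp add: mult.assoc)
  qed
  have "0 < fst st7 \<and> fst st7 \<le> d \<and> (fst st7 = 1 \<or> real n * \<sigma>\<^sup>2 * 4 ^ (fst st7 - 1) < T\<^sup>2) \<and>
      (T\<^sup>2 \<le> real n * \<sigma>\<^sup>2 * 4 ^ fst st7 \<or> fst st7 = Suc d) \<and> snd st7 = \<rho>6"
    unfolding st7_def sem.simps bndv.simps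
  \<comment> \<open>The alternative \<open>fst st = Suc k\<close> records that \<open>q\<close>,
    which starts at 1, was raised in every round so far; after \<open>d\<close> rounds it
    contradicts \<open>fst st \<le> d\<close>.\<close>
  proof (rule iter_upto_invariant[where P = "\<lambda>k (st :: nat \<times> arrays). 0 < fst st \<and> fst st \<le> d \<and>
      (fst st = 1 \<or> real n * \<sigma>\<^sup>2 * 4 ^ (fst st - 1) < T\<^sup>2) \<and>
      (T\<^sup>2 \<le> real n * \<sigma>\<^sup>2 * 4 ^ fst st \<or> fst st = Suc k) \<and> snd st = \<rho>6"])
    fix k and st :: "nat \<times> arrays"
    assume *: "0 < fst st \<and> fst st \<le> d \<and>
      (fst st = 1 \<or> real n * \<sigma>\<^sup>2 * 4 ^ (fst st - 1) < T\<^sup>2) \<and>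
      (T\<^sup>2 \<le> real n * \<sigma>\<^sup>2 * 4 ^ fst st \<or> fst st = Suc k) \<and> snd st = \<rho>6"
    obtain q' where st: "st = (q', \<rho>6)" using * by (cases st) auto
    have q': "0 < q'" "q' \<le> d" "q' = 1 \<or> real n * \<sigma>\<^sup>2 * 4 ^ (q' - 1) < T\<^sup>2" "T\<^sup>2 \<le> real n * \<sigma>\<^sup>2 * 4 ^ q' \<or> q' = Suc k"
      using * by (simp_all add: st)
    have s: "sem n d ([] @ [k]) ?c7 st = (if real n * \<sigma>\<^sup>2 * 4 ^ q' < T\<^sup>2 then (Suc q', \<rho>6) else (q', \<rho>6))"
      using q'(2) T6 by (simp add: st prod_if_less power2_eq_square)
    show "0 < fst (sem n d ([] @ [k]) ?c7 st) \<and> fst (sem n d ([] @ [k]) ?c7 st) \<le> d \<and>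
      (fst (sem n d ([] @ [k]) ?c7 st) = 1 \<or> real n * \<sigma>\<^sup>2 * 4 ^ (fst (sem n d ([] @ [k]) ?c7 st) - 1) < T\<^sup>2) \<and>
      (T\<^sup>2 \<le> real n * \<sigma>\<^sup>2 * 4 ^ fst (sem n d ([] @ [k]) ?c7 st) \<or> fst (sem n d ([] @ [k]) ?c7 st) = Suc (Suc k)) \<and>
      snd (sem n d ([] @ [k]) ?c7 st) = \<rho>6"
    proof (cases "real n * \<sigma>\<^sup>2 * 4 ^ q' < T\<^sup>2")
      case True
      then have "q' \<noteq> d" using dd by auto
      then show ?thesis unfolding s using True q' by auto
    next
      case False
      then show ?thesis unfolding s using q' by auto
    qed
  qed (use d in auto)
  then have q7: "0 < q" "q \<le> d" "q = 1 \<or> real n * \<sigma>\<^sup>2 * 4 ^ (q - 1) < T\<^sup>2" "T\<^sup>2 \<le> real n * \<sigma>\<^sup>2 * 4 ^ q"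
    by (auto simp: st7)
  have sq: "real n * \<sigma>\<^sup>2 * 4 ^ m = (sqrt (real n) * \<sigma> * 2 ^ m)\<^sup>2" for m
    by (simp add: power_mult_distrib power_mult[symmetric] mult.commute[of m 2]) (simp add: power_mult)
  have "T \<le> sqrt (real n) * \<sigma> * 2 ^ q"
    using q7(4) unfolding sq by (rule power2_le_imp_le) (use \<sigma> in simp)
  moreover have "q = 1 \<or> sqrt (real n) * \<sigma> * 2 ^ (q - 1) < T"
    using q7(3) unfolding sq using power2_less_imp_less[of _ T] T0 by auto
  ultimately have "good_init n d A \<Lambda> T \<sigma> q" unfolding good_init_def using \<sigma> q7 by simp
  moreover have "snd st ''Bq'' [] = (512 * real q * \<sigma>) ^ q * (T / \<sigma>)" "snd st ''Bd'' [] = (131072 * real q * \<sigma>) ^ d * (T / \<sigma>)"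
    unfolding st8 using T6 q7 by (simp_all add: prod_if_less)
  ultimately show "\<exists>\<sigma>. good_init n d A \<Lambda> T \<sigma> (fst st) \<and>
        snd st ''Bq'' [] = (512 * real (fst st) * \<sigma>) ^ fst st * (T / \<sigma>) \<and>
        snd st ''Bd'' [] = (131072 * real (fst st) * \<sigma>) ^ d * (T / \<sigma>)"
    unfolding q by blast
qed

section \<open>The output of the program\<close>

lemma step_stmt_idle:
  assumes "\<not> active n (\<lambda>i. \<rho> ''x'' [i])"
  shows "sem n d [] step_stmt (q, \<rho>) = (q, \<rho>)"
proof -
  have "\<not> real n < 2 * real (card (alive n (\<lambda>i. \<rho> ''x'' [i])))" using assms by (simp add: active_def)
  then show ?thesis
    using sum_indicator_alive[where x = "\<lambda>i. \<rho> ''x'' [i]" and n = n] by (simp add: step_stmt_def)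
qed

lemma not_active_card:
  assumes "\<not> active n x" "\<And>i. i < n \<Longrightarrow> \<bar>x i\<bar> \<le> 1"
  shows "real n / 2 \<le> real (card {i. i < n \<and> \<bar>x i\<bar> = 1})"
proof -
  have "{i. i < n \<and> \<bar>x i\<bar> = 1} = {..<n} - alive n x"
  proof -
    have "\<bar>x i\<bar> = 1 \<longleftrightarrow> \<not> (x i)\<^sup>2 < 1" if "i < n" for i
      using assms(2)[OF that] abs_square_less_1[of "x i"] by auto
    then show ?thesis by (auto simp: alive_def)
  qed
  then have "card {i. i < n \<and> \<bar>x i\<bar> = 1} = n - card (alive n x)"
    using finite_alive by (simp add: card_Diff_subset alive_def subset_eq)
  then show ?thesis using assms(1) by (simp add: active_def)
qed

text \<open>Cauchy-Schwarz over the \<open>n\<close> summands loses a factor \<open>n\<close>, which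
  is harmless since this coloring is the output only if \<open>n < 16\<close> or
  \<open>\<Lambda> = 0\<close>.\<close>

lemma opbound_ones:
  assumes sym: "\<And>i j k. i < n \<Longrightarrow> j < d \<Longrightarrow> k < d \<Longrightarrow> A i j k = A i k j" and t: "top_energy n d A \<Lambda>"
    and x: "\<And>i. i < n \<Longrightarrow> x i = 1"
  shows "opbound d (\<lambda>j k. \<Sum>i<n. x i * A i j k) (sqrt (real n * \<Lambda>))"
  unfolding opbound_def
proof (intro conjI allI)
  fix y
  let ?a = "\<lambda>i j. ip d (A i j) y"
  have 1: "(\<Sum>k<d. (\<Sum>i<n. x i * A i j k) * y k) = (\<Sum>i<n. 1 * ?a i j)" for j
  proof -
    have "(\<Sum>k<d. (\<Sum>i<n. x i * A i j k) * y k) = (\<Sum>k<d. \<Sum>i<n. A i j k * y k)"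
      using x by (simp add: sum_distrib_right)
    also have "\<dots> = (\<Sum>i<n. 1 * ?a i j)" by (subst sum.swap) (simp add: ip_def)
    finally show ?thesis .
  qed
  have "(\<Sum>j<d. (\<Sum>k<d. (\<Sum>i<n. x i * A i j k) * y k)\<^sup>2) \<le> (\<Sum>j<d. (\<Sum>i<n. 1\<^sup>2) * (\<Sum>i<n. (?a i j)\<^sup>2))"
    unfolding 1 by (intro sum_mono Cauchy_Schwarz_ineq_sum)
  also have "\<dots> = real n * (\<Sum>j<d. \<Sum>i<n. (?a i j)\<^sup>2)"
    by (simp add: sum_distrib_left)
  also have "(\<Sum>j<d. \<Sum>i<n. (?a i j)\<^sup>2) = energy n d A y"
    unfolding energy_def ip_self_eq_sum by (rule sum.swap)
  also have "real n * energy n d A y \<le> real n * (\<Lambda> * ip d y y)"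
    using top_energy_bound[of n d A, OF sym t] by (intro mult_left_mono) auto
  finally have "sqrt (\<Sum>j<d. (\<Sum>k<d. (\<Sum>i<n. x i * A i j k) * y k)\<^sup>2) \<le> sqrt (real n * \<Lambda>) * sqrt (ip d y y)"
    unfolding real_sqrt_mult[symmetric] by (simp add: mult.assoc)
  then show "L2_set (\<lambda>j. \<Sum>k<d. (\<Sum>i<n. x i * A i j k) * y k) {..<d} \<le> sqrt (real n * \<Lambda>) * L2_set y {..<d}"
    by (simp add: L2_set_def ip_self_eq_sum)
qed (use top_energy_nonneg[OF t] in simp)

lemma program_output:
  fixes AA :: "nat \<Rightarrow> real Matrix.mat"
  assumes sym: "\<And>i j k. i < n \<Longrightarrow> j < d \<Longrightarrow> k < d \<Longrightarrow> AA i $$ (j, k) = AA i $$ (k, j)"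
    and t: "0 < d \<Longrightarrow> top_energy n d (\<lambda>i j k. AA i $$ (j, k)) \<Lambda>"
    and T: "T = tr d (sqsum n d (\<lambda>i j k. AA i $$ (j, k)))"
  defines "x \<equiv> \<lambda>i. repeat_result init_stmt 29 step_stmt n d AA ''x'' [i]"
  shows "(\<forall>i<n. \<bar>x i\<bar> \<le> 1) \<and> \<not> active n x \<and>
    (0 < d \<longrightarrow> ((n < 16 \<or> \<Lambda> = 0) \<and> opbound d (\<lambda>j k. \<Sum>i<n. x i * AA i $$ (j, k)) (sqrt (real n * \<Lambda>))) \<or>
      (\<exists>\<sigma> q. 0 < n \<and> good_init n d (\<lambda>i j k. AA i $$ (j, k)) \<Lambda> T \<sigma> q \<and>
         opbound d (\<lambda>j k. \<Sum>i<n. x i * AA i $$ (j, k)) (sqrt (1048576 * real q * \<sigma>))))"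
proof -
  let ?A = "\<lambda>i j k. AA i $$ (j, k)"
  define \<rho> where "\<rho> = snd (input_store n d AA)"
  define st where "st = sem n d [] init_stmt (0, \<rho>)"
  have A: "\<rho> ''A'' [i, j, k] = ?A i j k" if "i < n" "j < d" "k < d" for i j k
    using that by (simp add: \<rho>_def input_store_def)
  have init1: "snd st ''A'' = \<rho> ''A''"
    unfolding st_def by (rule init_stmt_correct(1)[where A = ?A and n = n and d = d and \<rho> = \<rho> and T = T, OF A T])
  have init2: "snd st ''x'' [i] = (if n < 16 \<or> T \<le> 0 then 1 else 0)" if "i < n" for i
    unfolding st_def by (rule init_stmt_correct(2)[where A = ?A and n = n and d = d and \<rho> = \<rho> and T = T, OF A T that])
  have xK: "x = (\<lambda>i. snd ((sem n d [] step_stmt ^^ ((n + d + 2) ^ 29)) st) ''x'' [i])"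
    unfolding x_def repeat_result_def st_def \<rho>_def ..
  show ?thesis
  proof (cases "n < 16 \<or> T \<le> 0")
    case True
    then have x0: "snd st ''x'' [i] = 1" if "i < n" for i using init2[OF that] by simp
    then have "alive n (\<lambda>i. snd st ''x'' [i]) = {}" by (auto simp: alive_def)
    then have na: "\<not> active n (\<lambda>i. snd st ''x'' [i])" by (simp add: active_def)
    then have idle: "sem n d [] step_stmt st = st"
      using step_stmt_idle[where q = "fst st" and \<rho> = "snd st" and n = n and d = d] by simp
    have "(sem n d [] step_stmt ^^ k) st = st" for k
    proof (induction k)
      case (Suc k)
      then show ?case using idle by simp
    qed simp
    then have x: "x = (\<lambda>i. snd st ''x'' [i])" unfolding xK by simp
    have "(n < 16 \<or> \<Lambda> = 0) \<and> opbound d (\<lambda>j k. \<Sum>i<n. x i * ?A i j k) (sqrt (real n * \<Lambda>))" if "0 < d"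
    proof
      show "n < 16 \<or> \<Lambda> = 0"
        using True top_energy_trace(1)[OF t[OF that]] top_energy_nonneg[OF t[OF that]] T by auto
      show "opbound d (\<lambda>j k. \<Sum>i<n. x i * ?A i j k) (sqrt (real n * \<Lambda>))"
        by (rule opbound_ones[of n d ?A, OF sym t[OF that]]) (simp_all add: x x0)
    qed
    then show ?thesis using na x0 by (auto simp: x)
  next
    case False
    then have n16: "16 \<le> n" "0 < n" and T0: "0 < T" by auto
    have d: "0 < d" using T0 T by (cases d) (auto simp: tr_def)
    note t' = t[OF d]
    define q where "q = fst st"
    have init3: "\<exists>\<sigma>. good_init n d ?A \<Lambda> T \<sigma> (fst st) \<and>
        snd st ''Bq'' [] = (512 * real (fst st) * \<sigma>) ^ fst st * (T / \<sigma>) \<and>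
        snd st ''Bd'' [] = (131072 * real (fst st) * \<sigma>) ^ d * (T / \<sigma>)"
      unfolding st_def by (rule init_stmt_correct(3)[where A = ?A and n = n and d = d and \<rho> = \<rho> and T = T, OF A T t' T0 n16(2)])
    obtain \<sigma> where g: "good_init n d ?A \<Lambda> T \<sigma> q"
      and B: "snd st ''Bq'' [] = (512 * real q * \<sigma>) ^ q * (T / \<sigma>)" "snd st ''Bd'' [] = (131072 * real q * \<sigma>) ^ d * (T / \<sigma>)"
      using init3 unfolding q_def by blast
    have \<sigma>: "0 < \<sigma>" "\<Lambda> \<le> \<sigma>" "\<sigma> \<le> 4 * \<Lambda>" and q: "0 < q" "q \<le> d" "T \<le> sqrt (real n) * \<sigma> * 2 ^ q"
      using g by (auto simp: good_init_def)
    \<comment> \<open>The search gives \<sigma> within a factor 4 of \<open>\<Lambda>\<close>, and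
      \<open>\<Lambda>\<close> is at most the trace; this is where the factor in
      \<open>\<sigma> \<le> 4 * T\<close> comes from.\<close>
    interpret matrix_family n d ?A \<sigma> T
    proof
      show "?A i j k = ?A i k j" if "i < n" "j < d" "k < d" for i j k by (rule sym[OF that])
      show "(\<Sum>i<n. ip d (\<lambda>j. ip d (?A i j) y) (\<lambda>j. ip d (?A i j) y)) \<le> \<sigma> * ip d y y" for y
      proof -
        have "energy n d ?A y \<le> \<Lambda> * ip d y y" by (rule top_energy_bound[of n d ?A, OF sym t'])
        also have "\<dots> \<le> \<sigma> * ip d y y" using \<sigma> ip_self_nonneg by (intro mult_right_mono) auto
        finally show ?thesis by (simp add: energy_def)
      qed
      show "T = (\<Sum>i<n. \<Sum>j<d. ip d (?A i j) (?A i j))" unfolding T by (rule tr_sqsum[of n d ?A, OF sym])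
      show "0 < \<sigma>" by fact
      show "\<sigma> \<le> 4 * T" using \<sigma> top_energy_trace(1)[OF t'] T by simp
    qed
    define X where "X = (\<lambda>k i. snd ((sem n d [] step_stmt ^^ k) st) ''x'' [i])"
    have state: "fst ((sem n d [] step_stmt ^^ k) st) = q \<and> holds_input q (snd ((sem n d [] step_stmt ^^ k) st))" for k
    proof (induction k)
      case 0
      show ?case using A init1 B by (simp add: q_def[symmetric] holds_input_def Bq_def Bd_def)
    next
      case (Suc k)
      obtain \<rho>' where "(sem n d [] step_stmt ^^ k) st = (q, \<rho>')" using Suc by (metis prod.collapse)
      then show ?case using Suc step_stmt_input[of q \<rho>'] step_stmt_q by simp
    qed
    have "(\<forall>i<n. \<bar>X ((n + d + 2) ^ 29) i\<bar> \<le> 1) \<and> Psi q (X ((n + d + 2) ^ 29)) \<le> 2 \<and> \<not> active n (X ((n + d + 2) ^ 29))"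
    proof (rule cube_walk_terminates[where X = X])
      show "X 0 i = 0" if "i < n" for i using init2[OF that] False by (simp add: X_def)
    next
      fix k assume k: "\<And>i. i < n \<Longrightarrow> \<bar>X k i\<bar> \<le> 1" "Psi q (X k) \<le> 2"
      obtain \<rho>' where \<rho>': "(sem n d [] step_stmt ^^ k) st = (q, \<rho>')" using state[of k] by (metis prod.collapse)
      have Xk: "X k = (\<lambda>i. \<rho>' ''x'' [i])" and XS: "X (Suc k) = (\<lambda>i. snd (sem n d [] step_stmt (q, \<rho>')) ''x'' [i])"
        by (simp_all add: X_def \<rho>')
      have "holds_input q \<rho>'" using state[of k] by (simp add: \<rho>')
      from step_stmt_correct[OF n16(1) q this Xk k] show "cube_step q (X k) (X (Suc k))" unfolding XS .
    qed (use q in auto)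
    moreover have xX: "x = X ((n + d + 2) ^ 29)" by (simp add: xK X_def)
    ultimately have x: "\<forall>i<n. \<bar>x i\<bar> \<le> 1" "Psi q x \<le> 2" "\<not> active n x" by auto
    have "opbound d (comb x) (sqrt (1048576 * real q * \<sigma>))" using x q by (intro comb_opbound) auto
    then show ?thesis using x g n16 by (auto simp: comb_def)
  qed
qed

section \<open>Spectral norms\<close>

lemma l2_norm_L2_set: "v \<in> carrier_vec d \<Longrightarrow> l2_norm v = L2_set (vec_index v) {..<d}"
  by (simp add: l2_norm_def L2_set_def scalar_prod_def power2_eq_square lessThan_atLeast0 carrier_vecD)

lemma l2_norm_mult_mat_vec:
  assumes M: "M \<in> carrier_mat d d" and v: "v \<in> carrier_vec d"
  shows "l2_norm (M *\<^sub>v v) = L2_set (\<lambda>j. \<Sum>k<d. M $$ (j, k) * vec_index v k) {..<d}"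
proof -
  have "l2_norm (M *\<^sub>v v) = L2_set (vec_index (M *\<^sub>v v)) {..<d}"
    using M v by (intro l2_norm_L2_set) auto
  also have "\<dots> = L2_set (\<lambda>j. \<Sum>k<d. M $$ (j, k) * vec_index v k) {..<d}"
    using M v by (intro L2_set_cong) (auto simp: scalar_prod_def lessThan_atLeast0)
  finally show ?thesis .
qed

lemma l2_norm_mult_le:
  assumes M: "M \<in> carrier_mat d d" and b: "opbound d (\<lambda>j k. M $$ (j, k)) \<mu>"
    and v: "v \<in> carrier_vec d" "l2_norm v \<le> 1"
  shows "l2_norm (M *\<^sub>v v) \<le> \<mu>"
proof -
  have "l2_norm (M *\<^sub>v v) \<le> \<mu> * l2_norm v"
    using b v(1) by (simp add: l2_norm_mult_mat_vec[OF M v(1)] l2_norm_L2_set[OF v(1)] opbound_def)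
  also have "\<dots> \<le> \<mu> * 1" using b v by (intro mult_left_mono) (auto simp: opbound_def)
  finally show ?thesis by simp
qed

lemma spectral_norm_le:
  assumes M: "M \<in> carrier_mat d d" and b: "opbound d (\<lambda>j k. M $$ (j, k)) \<mu>"
  shows "spectral_norm M \<le> \<mu>"
  unfolding spectral_norm_def
proof (rule cSup_least)
  have "0\<^sub>v d \<in> carrier_vec (dim_col M)" "l2_norm (0\<^sub>v d) \<le> 1" using M by (auto simp: l2_norm_def)
  then show "{l2_norm (M *\<^sub>v v) |v. v \<in> carrier_vec (dim_col M) \<and> l2_norm v \<le> 1} \<noteq> {}" by blast
qed (use l2_norm_mult_le[OF M b] M in auto)

lemma spectral_norm_ge:
  assumes M: "M \<in> carrier_mat d d" and b: "opbound d (\<lambda>j k. M $$ (j, k)) \<mu>"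
    and v: "v \<in> carrier_vec d" "l2_norm v \<le> 1"
  shows "l2_norm (M *\<^sub>v v) \<le> spectral_norm M"
  unfolding spectral_norm_def
proof (rule cSup_upper)
  show "bdd_above {l2_norm (M *\<^sub>v v) |v. v \<in> carrier_vec (dim_col M) \<and> l2_norm v \<le> 1}"
    using l2_norm_mult_le[OF M b] M by (intro bdd_aboveI[of _ \<mu>]) auto
qed (use M v in auto)

lemma opbound_cong:
  assumes "\<And>j k. j < d \<Longrightarrow> k < d \<Longrightarrow> M j k = N j k" "opbound d M \<mu>"
  shows "opbound d N \<mu>"
proof -
  have "L2_set (\<lambda>j. \<Sum>k<d. N j k * y k) {..<d} = L2_set (\<lambda>j. \<Sum>k<d. M j k * y k) {..<d}" for y
    using assms(1) by (intro L2_set_cong) auto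
  then show ?thesis using assms(2) by (simp add: opbound_def)
qed

text \<open>All eigenvalues are nonnegative, so the largest one bounds the operator norm, and its
  eigenvector attains the bound.\<close>

lemma spectral_norm_top_energy:
  assumes sym: "\<And>i j k. i < n \<Longrightarrow> j < d \<Longrightarrow> k < d \<Longrightarrow> A i j k = A i k j" and t: "top_energy n d A \<Lambda>"
    and S: "S \<in> carrier_mat d d" "\<And>j k. j < d \<Longrightarrow> k < d \<Longrightarrow> S $$ (j, k) = sqsum n d A j k"
  shows "spectral_norm S = \<Lambda>"
proof -
  obtain u l p where e: "eigenbasis d (sqsum n d A) u l" and l: "\<And>p. p < d \<Longrightarrow> 0 \<le> l p" "\<And>p. p < d \<Longrightarrow> l p \<le> \<Lambda>"
    and p: "p < d" "l p = \<Lambda>"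
    using t unfolding top_energy_def by blast
  have u: "orthonormal d d u" using e by (simp add: eigenbasis_def)
  have "opbound d (sqsum n d A) \<Lambda>"
    by (rule opbound_eigen[OF e sqsum_sym[of n d A, OF sym]]) (use l top_energy_nonneg[OF t] in auto)
  then have b: "opbound d (\<lambda>j k. S $$ (j, k)) \<Lambda>" by (rule opbound_cong[rotated]) (simp add: S(2))
  have le: "spectral_norm S \<le> \<Lambda>" by (rule spectral_norm_le[OF S(1) b])
  define v where "v = Matrix.vec d (u p)"
  have v: "v \<in> carrier_vec d" by (simp add: v_def)
  have ev: "ip d (u r) (\<lambda>j. ip d (sqsum n d A j) y) = l r * ip d (u r) y" if "r < d" for r y
    by (rule eigenvector_ip[OF e that sqsum_sym[of n d A, OF sym]])
  have uu: "ip d (u p) (u p) = 1" using u p by (simp add: orthonormal_def)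
  have nv: "l2_norm v = 1"
    unfolding l2_norm_L2_set[OF v] using uu by (simp add: v_def L2_set_def ip_self_eq_sum)
  have Su: "(\<Sum>k<d. S $$ (j, k) * vec_index v k) = \<Lambda> * u p j" if "j < d" for j
  proof -
    have "(\<Sum>k<d. S $$ (j, k) * vec_index v k) = ip d (sqsum n d A j) (u p)"
      using S(2) that by (simp add: v_def ip_def)
    also have "\<dots> = (\<Sum>r<d. ip d (u r) (\<lambda>j. ip d (sqsum n d A j) (u p)) * u r j)"
      by (rule orthonormal_expand[OF u that])
    also have "\<dots> = (\<Sum>r<d. if r = p then \<Lambda> * u p j else 0)"
      using u p by (intro sum.cong refl) (auto simp: ev orthonormal_def)
    finally show ?thesis using p by simp
  qed
  have "l2_norm (S *\<^sub>v v) = L2_set (\<lambda>j. \<Lambda> * u p j) {..<d}"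
    unfolding l2_norm_mult_mat_vec[OF S(1) v] using Su by (intro L2_set_cong) auto
  also have "\<dots> = \<Lambda>"
  proof -
    have "(\<Sum>j<d. (\<Lambda> * u p j)\<^sup>2) = \<Lambda>\<^sup>2 * ip d (u p) (u p)"
      by (simp add: ip_self_eq_sum power_mult_distrib sum_distrib_left)
    then show ?thesis using uu top_energy_nonneg[OF t] by (simp add: L2_set_def)
  qed
  finally have "\<Lambda> \<le> spectral_norm S" using spectral_norm_ge[OF S(1) b v] nv by simp
  then show ?thesis using le by simp
qed

text \<open>For \<open>q > 1\<close> minimality gives
  \<open>2^(q-1) < T / (sqrt n * \<Lambda>)\<close>, and \<open>ln 2 \<ge> 1 / 2\<close> makes
  \<open>q - 1\<close> at most twice the truncated logarithm \<open>L\<close>. The constant is the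
  root of \<open>1048576 * 4 * 4\<close>: one factor 4 from \<open>q \<le> 4 * (1 + L)\<close>, the
  other from \<open>\<sigma> \<le> 4 * \<Lambda>\<close>.\<close>

lemma good_init_bound:
  assumes g: "good_init n d A \<Lambda> T \<sigma> q" and n: "0 < n"
  shows "sqrt (1048576 * real q * \<sigma>) \<le> 4096 * (sqrt \<Lambda> * sqrt (1 + max 0 (ln (T / (sqrt (real n) * \<Lambda>)))))"
proof -
  define L where "L = max 0 (ln (T / (sqrt (real n) * \<Lambda>)))"
  have \<sigma>: "0 < \<sigma>" "\<Lambda> \<le> \<sigma>" "\<sigma> \<le> 4 * \<Lambda>" "0 < q" using g by (auto simp: good_init_def)
  then have \<Lambda>: "0 < \<Lambda>" by linarith
  have qL: "real q \<le> 4 * (1 + L)"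
  proof (cases "q = 1")
    case True
    then show ?thesis by (simp add: L_def)
  next
    case False
    then have "sqrt (real n) * \<sigma> * 2 ^ (q - 1) < T" using g by (simp add: good_init_def)
    moreover have "sqrt (real n) * \<Lambda> * 2 ^ (q - 1) \<le> sqrt (real n) * \<sigma> * 2 ^ (q - 1)"
      using \<sigma> by (intro mult_right_mono mult_left_mono) auto
    ultimately have "2 ^ (q - 1) * (sqrt (real n) * \<Lambda>) < T" by (simp add: mult_ac)
    moreover have pos: "0 < sqrt (real n) * \<Lambda>" using n \<Lambda> by simp
    ultimately have le: "2 ^ (q - 1) \<le> T / (sqrt (real n) * \<Lambda>)" by (simp add: le_divide_eq)
    have p2: "(0 :: real) < 2 ^ (q - 1)" by simp
    have "0 < T / (sqrt (real n) * \<Lambda>)" by (rule less_le_trans[OF p2 le])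
    then have "ln (2 ^ (q - 1)) \<le> ln (T / (sqrt (real n) * \<Lambda>))"
      using le p2 by (simp only: ln_le_cancel_iff)
    then have "real (q - 1) * ln 2 \<le> L" by (simp add: ln_realpow L_def)
    moreover have "real (q - 1) * (1 / 2) \<le> real (q - 1) * ln 2"
      using ln2_ge_two_thirds by (intro mult_left_mono) auto
    ultimately have "real (q - 1) * (1 / 2) \<le> L" by (rule order.trans[rotated])
    moreover obtain m where "q = Suc m" using \<sigma>(4) by (cases q) auto
    moreover have "0 \<le> L" by (simp add: L_def)
    ultimately show ?thesis by simp
  qed
  have "1048576 * real q * \<sigma> \<le> 1048576 * (4 * (1 + L)) * (4 * \<Lambda>)"
    using qL \<sigma> \<Lambda> by (intro mult_mono) (auto simp: L_def)
  also have "\<dots> = 4096\<^sup>2 * (\<Lambda> * (1 + L))" by simp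
  finally have "sqrt (1048576 * real q * \<sigma>) \<le> sqrt (4096\<^sup>2 * (\<Lambda> * (1 + L)))" by (rule real_sqrt_le_mono)
  then show ?thesis unfolding L_def[symmetric] by (simp add: real_sqrt_mult)
qed

theorem program_good:
  assumes sym: "symmetric_family n d A"
    and x: "x = Matrix.vec n (\<lambda>i. repeat_result init_stmt 29 step_stmt n d A ''x'' [i])"
  shows "good_partial_coloring (1 / 2) 4096 n d A x"
proof -
  let ?a = "\<lambda>i j k. A i $$ (j, k)" and ?x = "\<lambda>i. repeat_result init_stmt 29 step_stmt n d A ''x'' [i]"
  have Ai: "A i \<in> carrier_mat d d" "transpose_mat (A i) = A i" if "i < n" for i
    using sym that by (auto simp: symmetric_family_def)
  have s: "?a i j k = ?a i k j" if "i < n" "j < d" "k < d" for i j k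
    using Ai[OF that(1)] that by (metis carrier_matD index_transpose_mat(1))
  have dims: "dim_row (A i) = d" "dim_col (A i) = d" if "i < n" for i
    using Ai(1)[OF that] by auto
  define S where "S = mat_sum n d (\<lambda>i. A i * A i)"
  have S: "S \<in> carrier_mat d d" by (simp add: S_def mat_sum_def)
  have Sjk: "S $$ (j, k) = sqsum n d ?a j k" if "j < d" "k < d" for j k
    unfolding S_def mat_sum_def sqsum_def using that dims
    by (auto simp: scalar_prod_def lessThan_atLeast0 intro!: sum.cong)
  have trS: "mat_trace S = tr d (sqsum n d ?a)"
    unfolding mat_trace_def tr_def using S Sjk by (intro sum.cong) auto
  define M where "M = mat_sum n d (\<lambda>i. vec_index x i \<cdot>\<^sub>m A i)"
  have M: "M \<in> carrier_mat d d" by (simp add: M_def mat_sum_def)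
  have Mjk: "M $$ (j, k) = (\<Sum>i<n. ?x i * A i $$ (j, k))" if "j < d" "k < d" for j k
    using that dims by (auto simp: M_def mat_sum_def x intro!: sum.cong)
  have tE: "\<exists>\<Lambda>. top_energy n d ?a \<Lambda>" if "0 < d" using top_energy_exists[of n d ?a, OF s that] .
  define \<Lambda> where "\<Lambda> = spectral_norm S"
  have t: "top_energy n d ?a \<Lambda>" if d: "0 < d"
  proof -
    obtain \<Lambda>' where \<Lambda>': "top_energy n d ?a \<Lambda>'" using tE[OF d] by blast
    have "spectral_norm S = \<Lambda>'" by (rule spectral_norm_top_energy[of n d ?a, OF s \<Lambda>' S Sjk])
    then show ?thesis using \<Lambda>' by (simp add: \<Lambda>_def)
  qed
  note out = program_output[of n d A \<Lambda>, OF s t refl]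
  have D: "discrepancy_bound n d A = sqrt \<Lambda> * sqrt (1 + max 0 (ln (mat_trace S / (sqrt (real n) * \<Lambda>))))"
    by (simp add: discrepancy_bound_def Let_def S_def \<Lambda>_def)
  have norm: "spectral_norm M \<le> 4096 * discrepancy_bound n d A"
  proof (cases "0 < d")
    \<comment> \<open>For \<open>d = 0\<close> there is no top eigenvalue. Every matrix has the
      operator bound 0, and the zero vector shows that \<open>\<Lambda>\<close> is
      nonnegative.\<close>
    case False
    then have z: "opbound d (\<lambda>j k. N $$ (j, k)) 0" for N :: "real Matrix.mat" by (simp add: opbound_def L2_set_def)
    have "0\<^sub>v d \<in> carrier_vec d" "l2_norm (0\<^sub>v d) \<le> 1" by (auto simp: l2_norm_def)
    then have "l2_norm (S *\<^sub>v 0\<^sub>v d) \<le> \<Lambda>" unfolding \<Lambda>_def by (rule spectral_norm_ge[OF S z])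
    then have "0 \<le> \<Lambda>" using False l2_norm_mult_mat_vec[OF S, of "0\<^sub>v d"] by (simp add: L2_set_def)
    then have "0 \<le> discrepancy_bound n d A" unfolding D by simp
    then show ?thesis using spectral_norm_le[OF M z] by simp
  next
    case True
    have \<Lambda>0: "0 \<le> \<Lambda>" by (rule top_energy_nonneg[OF t[OF True]])
    consider "n < 16 \<or> \<Lambda> = 0" "opbound d (\<lambda>j k. \<Sum>i<n. ?x i * A i $$ (j, k)) (sqrt (real n * \<Lambda>))"
      | \<sigma> q where "good_init n d ?a \<Lambda> (mat_trace S) \<sigma> q" "0 < n"
          "opbound d (\<lambda>j k. \<Sum>i<n. ?x i * A i $$ (j, k)) (sqrt (1048576 * real q * \<sigma>))"
      using out True unfolding trS by blast
    then show ?thesis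
    proof cases
      case 1
      have "opbound d (\<lambda>j k. M $$ (j, k)) (sqrt (real n * \<Lambda>))"
        by (rule opbound_cong[OF _ 1(2)]) (simp add: Mjk)
      then have "spectral_norm M \<le> sqrt (real n * \<Lambda>)" by (rule spectral_norm_le[OF M])
      moreover have nb: "real n * \<Lambda> \<le> 4096\<^sup>2 * (\<Lambda> * (1 + max 0 (ln (mat_trace S / (sqrt (real n) * \<Lambda>)))))"
      proof -
        have "real n * \<Lambda> \<le> 16 * \<Lambda>"
          using 1(1) \<Lambda>0 by (cases "\<Lambda> = 0") (auto intro: mult_right_mono)
        also have "\<dots> \<le> 4096\<^sup>2 * (\<Lambda> * 1)" using \<Lambda>0 by simp
        also have "\<dots> \<le> 4096\<^sup>2 * (\<Lambda> * (1 + max 0 (ln (mat_trace S / (sqrt (real n) * \<Lambda>)))))"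
          using \<Lambda>0 by (intro mult_left_mono) auto
        finally show ?thesis .
      qed
      have "sqrt (real n * \<Lambda>) \<le> 4096 * discrepancy_bound n d A"
        unfolding D using real_sqrt_le_mono[OF nb] by (simp add: real_sqrt_mult)
      ultimately show ?thesis by linarith
    next
      case 2
      have "opbound d (\<lambda>j k. M $$ (j, k)) (sqrt (1048576 * real q * \<sigma>))"
        by (rule opbound_cong[OF _ 2(3)]) (simp add: Mjk)
      then have "spectral_norm M \<le> sqrt (1048576 * real q * \<sigma>)" by (rule spectral_norm_le[OF M])
      also have "\<dots> \<le> 4096 * discrepancy_bound n d A"
        unfolding D by (rule good_init_bound[OF 2(1,2)])
      finally show ?thesis .
    qed
  qed
  have xi: "vec_index x i = ?x i" if "i < n" for i using that by (simp add: x)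
  have "{i. i < n \<and> \<bar>vec_index x i\<bar> = 1} = {i. i < n \<and> \<bar>?x i\<bar> = 1}" using xi by auto
  then have "1 / 2 * real n \<le> real (card {i. i < n \<and> \<bar>vec_index x i\<bar> = 1})"
    using not_active_card[of n ?x] out by auto
  moreover have "\<forall>i<n. vec_index x i \<in> {-1..1}" using out xi by (auto simp: abs_le_iff)
  ultimately show ?thesis
    unfolding good_partial_coloring_def using norm by (simp add: M_def x)
qed

theorem mainTheorem2:
  shows "\<exists>c::real. \<exists>C::real. 0 < c \<and> 0 < C \<and>
    (\<forall>n d A. symmetric_family n d A \<longrightarrow> (\<exists>x. good_partial_coloring c C n d A x)) \<and>
    (\<forall>K::nat. \<exists>P. polynomial_time P \<and>
       (\<forall>n d A. symmetric_family n d A \<longrightarrow>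
          success_prob P n d A (good_partial_coloring c C n d A) \<ge> 1 - 1 / real n ^ K))"
proof (rule exI[of _ "1 / 2"], rule exI[of _ 4096], intro conjI allI impI)
  fix n d A
  assume "symmetric_family n d A"
  then show "\<exists>x. good_partial_coloring (1 / 2) 4096 n d A x" using program_good by blast
next
  fix K :: nat
  \<comment> \<open>The run is deterministic and always ends with a good coloring, so one program
    serves every \<open>K\<close>.\<close>
  let ?P = "repeat_program init_stmt 29 step_stmt"
  obtain p :: "nat poly" where p: "\<And>n d A. \<exists>\<sigma>. (\<forall>T \<ge> poly p (n + d). run T ?P (input_store n d A) = return_pmf (Skip, \<sigma>)) \<and>
      (\<forall>a. a \<noteq> ''#'' \<longrightarrow> snd \<sigma> a = repeat_result init_stmt 29 step_stmt n d A a)"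
    using repeat_program_correct[OF wf_init_stmt wf_step_stmt, of 29] by blast
  have "polynomial_time ?P"
    unfolding polynomial_time_def
  proof (intro exI[of _ p] allI impI ballI)
    fix n d A z
    assume z: "z \<in> set_pmf (run (poly p (n + d)) ?P (input_store n d A))"
    obtain \<sigma> where "run (poly p (n + d)) ?P (input_store n d A) = return_pmf (Skip, \<sigma>)" using p[of n d A] by blast
    then show "case z of (p, s) \<Rightarrow> p = Skip" using z by simp
  qed
  moreover have "1 - 1 / real n ^ K \<le> success_prob ?P n d A (good_partial_coloring (1 / 2) 4096 n d A)"
    if A: "symmetric_family n d A" for n d A
  proof -
    let ?E = "{(p, s). p = Skip \<and> good_partial_coloring (1 / 2) 4096 n d A (output_vec n s)}"
    obtain \<sigma> where \<sigma>: "run (poly p (n + d)) ?P (input_store n d A) = return_pmf (Skip, \<sigma>)"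
      "\<And>a. a \<noteq> ''#'' \<Longrightarrow> snd \<sigma> a = repeat_result init_stmt 29 step_stmt n d A a" using p[of n d A] by blast
    have "good_partial_coloring (1 / 2) 4096 n d A (output_vec n \<sigma>)"
      by (rule program_good[OF A]) (simp add: output_vec_def \<sigma>(2))
    then have "1 = measure_pmf.prob (run (poly p (n + d)) ?P (input_store n d A)) ?E"
      unfolding \<sigma>(1) by (simp add: measure_return_pmf)
    also have "\<dots> \<le> success_prob ?P n d A (good_partial_coloring (1 / 2) 4096 n d A)"
      unfolding success_prob_def by (intro cSUP_upper bdd_aboveI[of _ 1]) auto
    finally have "1 \<le> success_prob ?P n d A (good_partial_coloring (1 / 2) 4096 n d A)" .
    moreover have "0 \<le> 1 / real n ^ K" by simp
    ultimately show ?thesis by linarith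
  qed
  ultimately show "\<exists>P. polynomial_time P \<and> (\<forall>n d A. symmetric_family n d A \<longrightarrow>
      success_prob P n d A (good_partial_coloring (1 / 2) 4096 n d A) \<ge> 1 - 1 / real n ^ K)" by blast
qed simp_all

end
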